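(* Let $t\geq 3$ and let $(\alpha,\beta;\gamma,\delta)$, with $\alpha\neq 0$ and $\alpha+2\beta=2^t$, be any dual type of an additive extended perfect code. Let $l$ be any integer such that $l\in\{t+1,\ldots,2t\}$ if $\delta=1$, and $l\in\{t+1,\ldots,2t+1\}$ if $\delta\neq 1$. Then there exist two additive extended perfect codes $\mathcal{C}_1,\mathcal{C}_2\subseteq\mathbb{Z}_2^\alpha\times\mathbb{Z}_4^\beta$ of dual type $(\alpha,\beta;\gamma,\delta)$ such that $\eta(\mathcal{C}_1,\mathcal{C}_2)=|\mathcal{C}_1\cap\mathcal{C}_2|=2^{\alpha+2\beta-l}$.
   Context: An additive code is a subgroup $\mathcal{C}$ of $\mathbb{Z}_2^{\alpha}\times\mathbb{Z}_4^{\beta}$. It is of type $(\alpha,\beta;\gamma,\delta)$ if $\mathcal{C}\cong\mathbb{Z}_2^{\gamma}\times\mathbb{Z}_4^{\delta}$ as a group. The inner product is $\langle u,v\rangle=2\big(\sum_{i=1}^{\alpha}u_iv_i\big)+\sum_{j=\alpha+1}^{\alpha+\beta}u_jv_j\in\mathbb{Z}_4$, and $\mathcal{C}^\perp=\{u:\langle u,v\rangle=0\text{ for all }v\in\mathcal{C}\}$. A code is of dual type $(\ldots)$ if its additive dual is of type $(\ldots)$. The Gray map $\Phi:\mathbb{Z}_2^\alpha\times\mathbb{Z}_4^\beta\to\mathbb{Z}_2^{\alpha+2\beta}$ is the identity on binary coordinates and sends each quaternary coordinate by $0\mapsto(0,0),\ 1\mapsto(0,1),\ 2\mapsto(1,1),\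 3\mapsto(1,0)$. An additive extended perfect code is an additive code $\mathcal{C}$ such that $\Phi(\mathcal{C})$ has the parameters of an extended perfect binary code: length $\alpha+2\beta=2^t$, $2^{2^t-t-1}$ codewords, minimum Hamming distance $4$. *)

theory Defs
  imports "HOL-Algebra.Elementary_Groups" "HOL-Algebra.Product_Groups"
begin

(* Words are pairs (u, w) with u extensional on {..<\<alpha>} with values in {0,1} and
   w extensional on {..<\<beta>} with values in {0,1,2,3}. *)
definition additive_space :: "nat \<Rightarrow> nat \<Rightarrow> ((nat \<Rightarrow> int) \<times> (nat \<Rightarrow> int)) monoid" where
  "additive_space \<alpha> \<beta> =
     product_group {..<\<alpha>} (\<lambda>_. integer_mod_group 2) \<times>\<times>
     product_group {..<\<beta>} (\<lambda>_. integer_mod_group 4)"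

definition additive_code :: "nat \<Rightarrow> nat \<Rightarrow> ((nat \<Rightarrow> int) \<times> (nat \<Rightarrow> int)) set \<Rightarrow> bool" where
  "additive_code \<alpha> \<beta> C \<longleftrightarrow> subgroup C (additive_space \<alpha> \<beta>)"

definition of_type ::
  "nat \<Rightarrow> nat \<Rightarrow> nat \<Rightarrow> nat \<Rightarrow> ((nat \<Rightarrow> int) \<times> (nat \<Rightarrow> int)) set \<Rightarrow> bool" where
  "of_type \<alpha> \<beta> \<gamma> \<delta> C \<longleftrightarrow>
     additive_code \<alpha> \<beta> C \<and> (additive_space \<alpha> \<beta>)\<lparr>carrier := C\<rparr> \<cong> additive_space \<gamma> \<delta>"

(* The value in Z/4Z is given by its representative in {0,1,2,3}. *)
definition additive_inner ::
  "nat \<Rightarrow> nat \<Rightarrow> (nat \<Rightarrow> int) \<times> (nat \<Rightarrow> int) \<Rightarrow> (nat \<Rightarrow> int) \<times> (nat \<Rightarrow> int) \<Rightarrow> int" where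
  "additive_inner \<alpha> \<beta> u v =
     (2 * (\<Sum>i<\<alpha>. fst u i * fst v i) + (\<Sum>j<\<beta>. snd u j * snd v j)) mod 4"

definition additive_dual ::
  "nat \<Rightarrow> nat \<Rightarrow> ((nat \<Rightarrow> int) \<times> (nat \<Rightarrow> int)) set \<Rightarrow> ((nat \<Rightarrow> int) \<times> (nat \<Rightarrow> int)) set" where
  "additive_dual \<alpha> \<beta> C =
     {u \<in> carrier (additive_space \<alpha> \<beta>). \<forall>v\<in>C. additive_inner \<alpha> \<beta> u v = 0}"

definition of_dual_type ::
  "nat \<Rightarrow> nat \<Rightarrow> nat \<Rightarrow> nat \<Rightarrow> ((nat \<Rightarrow> int) \<times> (nat \<Rightarrow> int)) set \<Rightarrow> bool" where
  "of_dual_type \<alpha> \<beta> \<gamma> \<delta> C \<longleftrightarrow> of_type \<alpha> \<beta> \<gamma> \<delta> (additive_dual \<alpha> \<beta> C)"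

definition gray4 :: "int \<Rightarrow> int \<times> int" where
  "gray4 x = (if x = 0 then (0, 0) else if x = 1 then (0, 1) else if x = 2 then (1, 1) else (1, 0))"

(* Quaternary coordinate j occupies the binary positions \<alpha> + 2j and \<alpha> + 2j + 1. *)
definition gray_map :: "nat \<Rightarrow> nat \<Rightarrow> (nat \<Rightarrow> int) \<times> (nat \<Rightarrow> int) \<Rightarrow> nat \<Rightarrow> int" where
  "gray_map \<alpha> \<beta> u =
     (\<lambda>k\<in>{..<\<alpha> + 2 * \<beta>}.
        if k < \<alpha> then fst u k
        else if even (k - \<alpha>) then fst (gray4 (snd u ((k - \<alpha>) div 2)))
        else snd (gray4 (snd u ((k - \<alpha>) div 2))))"

definition hamming_dist :: "nat \<Rightarrow> (nat \<Rightarrow> int) \<Rightarrow> (nat \<Rightarrow> int) \<Rightarrow> nat" where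
  "hamming_dist n x y = card {k. k < n \<and> x k \<noteq> y k}"

(* Only meaningful for codes with at least two codewords. *)
definition min_dist :: "nat \<Rightarrow> (nat \<Rightarrow> int) set \<Rightarrow> nat" where
  "min_dist n B = Min {hamming_dist n x y | x y. x \<in> B \<and> y \<in> B \<and> x \<noteq> y}"

definition extended_perfect_parameters :: "nat \<Rightarrow> (nat \<Rightarrow> int) set \<Rightarrow> bool" where
  "extended_perfect_parameters n B \<longleftrightarrow>
     (\<exists>t. n = 2 ^ t \<and> card B = 2 ^ (2 ^ t - t - 1) \<and> min_dist n B = 4)"

definition additive_extended_perfect_code ::
  "nat \<Rightarrow> nat \<Rightarrow> ((nat \<Rightarrow> int) \<times> (nat \<Rightarrow> int)) set \<Rightarrow> bool" where
  "additive_extended_perfect_code \<alpha> \<beta> C \<longleftrightarrow>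
     additive_code \<alpha> \<beta> C \<and>
     extended_perfect_parameters (\<alpha> + 2 * \<beta>) (gray_map \<alpha> \<beta> ` C)"

end

theory Submission
  imports Defs "HOL-Library.Numeral_Type" "HOL-Library.Function_Algebras"
    "HOL-Computational_Algebra.Group_Closure" Complex_Main
begin

text \<open>
  Let \<open>B = \<int>\<^sub>2\<^bsup>\<gamma>-1\<^esup> \<times> \<int>\<^sub>4\<^bsup>\<delta>\<^esup>\<close> and \<open>A = \<int>\<^sub>2 \<times> B\<close>, with \<open>e\<close> the generator of the first factor. The
  coset \<open>e + B\<close> has \<open>2\<^sup>t\<close> elements, \<open>\<alpha>\<close> of them of order 2 and the others forming \<open>\<beta>\<close> pairs \<open>\<plusminus>x\<close>.
  Labelling the binary coordinates by the former and the quaternary ones by representatives of the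
  latter defines a syndrome map onto \<open>A\<close>. Unit errors have distinct syndromes, all outside \<open>B\<close>, so
  its kernel is extended perfect; its dual is the character group of \<open>A\<close>. That the parameters of a
  given code force these cardinalities follows from counting with characters.

  Relabelling by an odd permutation \<open>\<sigma>\<close> of \<open>B\<close> gives a second code. If \<open>\<sigma>\<close> fixes a generating set
  of \<open>B\<close> and \<open>N\<close> is generated by all \<open>\<sigma> b - b\<close>, the pair of syndromes has \<open>|A| |N|\<close> values, so
  the codes meet in \<open>2\<^bsup>\<alpha>+2\<beta>\<^esup> / (|A| |N|)\<close> words. It remains to realise every possible \<open>|N| = 2\<^sup>k\<close>.
  Composing \<open>\<sigma>\<close> with the swap of \<open>\<plusminus>z\<close> and \<open>\<plusminus>v\<close> adjoins \<open>v - z\<close> to \<open>N\<close>; cycles of such swaps settle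
  the small groups \<open>\<int>\<^sub>2\<^sup>3\<close>, \<open>\<int>\<^sub>2 \<times> \<int>\<^sub>4\<close>, \<open>\<int>\<^sub>4\<^sup>2\<close>, and each further cyclic factor \<open>\<langle>c\<rangle>\<close> of \<open>B\<close> can be
  adjoined to \<open>N\<close> by one swap of \<open>z\<close> and \<open>z + c\<close>.
\<close>

section \<open>Odd permutations generating a prescribed subgroup\<close>

text \<open>Fixing a generating set of B decouples the two syndromes: words on which they agree
  still reach all of A, so the difference of the syndromes takes each of its values already on the
  first code. A quaternary coordinate carries a label x together with -x, hence only odd
  permutations come into question, and oddness is the main obstacle. It makes the permutation
  preserve the elements with 2b = 0. If \<delta> = 1, these form a subgroup of index 2 whose
  complement is a single coset, so every displacement lies in that subgroup and N = B is impossible;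
  this accounts for the missing value l = 2t + 1. For the same reason a factor Z4 can be adjoined to
  N only by swapping two elements of order 4. Groups with two or more such factors therefore keep an
  element of order 4 free for the next swap, while for \<delta> = 1 only factors Z2 are adjoined to
  the starting group. Splitting off the factor generated by e presupposes \<gamma> >= 1. This, like
  2\<alpha> = 2^(\<gamma>+\<delta>), has to be extracted from the code that is given.\<close>

definition add_subgroup :: "'a::ab_group_add set \<Rightarrow> bool" where
  "add_subgroup M \<longleftrightarrow> 0 \<in> M \<and> (\<forall>x\<in>M. \<forall>y\<in>M. x - y \<in> M)"

lemma add_subgroup_zero: "add_subgroup M \<Longrightarrow> 0 \<in> M"
  and add_subgroup_diff: "add_subgroup M \<Longrightarrow> x \<in> M \<Longrightarrow> y \<in> M \<Longrightarrow> x - y \<in> M"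
  by (simp_all add: add_subgroup_def)

lemma add_subgroup_minus: "add_subgroup M \<Longrightarrow> x \<in> M \<Longrightarrow> - x \<in> M"
  using add_subgroup_diff[of M 0 x] add_subgroup_zero[of M] by simp

lemma add_subgroup_add: "add_subgroup M \<Longrightarrow> x \<in> M \<Longrightarrow> y \<in> M \<Longrightarrow> x + y \<in> M"
  using add_subgroup_diff[of M x "- y"] add_subgroup_minus[of M y] by simp

lemma add_subgroup_sum:
  "add_subgroup M \<Longrightarrow> (\<And>i. i \<in> A \<Longrightarrow> f i \<in> M) \<Longrightarrow> sum f A \<in> M"
  by (induction A rule: infinite_finite_induct)
    (auto simp: add_subgroup_zero add_subgroup_add)

lemma add_subgroup_group_closure: "add_subgroup (group_closure S)"
  by (simp add: add_subgroup_def group_closure.diff)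

lemma group_closure_subset_iff:
  assumes "add_subgroup M"
  shows "group_closure S \<subseteq> M \<longleftrightarrow> S \<subseteq> M"
proof
  assume S: "S \<subseteq> M"
  have "x \<in> M" if "x \<in> group_closure S" for x
    using that by induction (use S assms in \<open>auto simp: add_subgroup_def\<close>)
  then show "group_closure S \<subseteq> M" by blast
qed (auto intro: group_closure.base)

lemma group_closure_mono: "S \<subseteq> group_closure T \<Longrightarrow> group_closure S \<subseteq> group_closure T"
  by (simp add: group_closure_subset_iff add_subgroup_group_closure)

text \<open>The last clause asks that the displacements outside \<open>E\<close> already generate
  \<open>N\<close>; the permutation may then be altered on \<open>E\<close> without losing a
  generator. The set \<open>F\<close> is the fixed generating set, and \<open>0 \<in> F\<close>
  stands for fixing the label e itself.\<close>

definition shuffle ::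
  "'a::ab_group_add set \<Rightarrow> 'a set \<Rightarrow> 'a set \<Rightarrow> ('a \<Rightarrow> 'a) \<Rightarrow> 'a set \<Rightarrow> bool" where
  "shuffle B F N \<sigma> E \<longleftrightarrow>
     bij_betw \<sigma> B B \<and> (\<forall>b\<in>B. \<sigma> (- b) = - \<sigma> b) \<and>
     0 \<in> F \<and> F \<subseteq> B \<and> B \<subseteq> group_closure F \<and> (\<forall>b\<in>F. \<sigma> b = b) \<and>
     (\<forall>b\<in>B. \<sigma> b - b \<in> N) \<and> N \<subseteq> group_closure ((\<lambda>b. \<sigma> b - b) ` (B - E))"

lemma shuffle_id:
  "0 \<in> F \<Longrightarrow> F \<subseteq> B \<Longrightarrow> B \<subseteq> group_closure F \<Longrightarrow> shuffle B F {0} id E"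
  by (simp add: shuffle_def)

lemma shuffle_antimono: "shuffle B F N \<sigma> E \<Longrightarrow> E' \<subseteq> E \<Longrightarrow> shuffle B F N \<sigma> E'"
proof -
  assume sh: "shuffle B F N \<sigma> E" and "E' \<subseteq> E"
  then have "group_closure ((\<lambda>b. \<sigma> b - b) ` (B - E)) \<subseteq> group_closure ((\<lambda>b. \<sigma> b - b) ` (B - E'))"
    by (intro group_closure_mono) (auto intro: group_closure.base)
  then show ?thesis using sh by (auto simp: shuffle_def)
qed

text \<open>A fixed point has displacement 0 and contributes no generator; by oddness the same holds
  for its negative. This clears the points that the next swap is to move.\<close>

lemma shuffle_exclude_fixed:
  assumes "shuffle B F N \<sigma> E" and "add_subgroup B" and "v \<in> B" and "\<sigma> v = v"
  shows "shuffle B F N \<sigma> (E \<union> {v, - v})"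
proof -
  let ?d = "\<lambda>b. \<sigma> b - b"
  have "?d b \<in> group_closure (?d ` (B - (E \<union> {v, - v})))" if "b \<in> B - E" for b
  proof (cases "b \<in> {v, - v}")
    case True
    then have "?d b = 0" using assms by (auto simp: shuffle_def)
    then show ?thesis by simp
  next
    case False
    then show ?thesis using that by (auto intro!: group_closure.base)
  qed
  then have "group_closure (?d ` (B - E)) \<subseteq> group_closure (?d ` (B - (E \<union> {v, - v})))"
    by (intro group_closure_mono) blast
  then show ?thesis using assms(1) unfolding shuffle_def by blast
qed

text \<open>Precomposing with the swap leaves the old generators of \<open>N\<close> alone, since
  they sit outside \<open>E\<close>, and produces one new displacement at \<open>z\<close>. Nothing
  is needed from \<open>v\<close>, so \<open>v\<close> and \<open>- v\<close> are free for a further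
  swap. The hypothesis \<open>inv\<close> is what makes the swap an odd involution: self-negative
  elements can only be exchanged with self-negative ones.\<close>

lemma shuffle_swap:
  fixes B :: "'a::ab_group_add set"
  assumes sh: "shuffle B F N \<sigma> E" and E: "{z, - z, v, - v} \<subseteq> E"
    and B: "add_subgroup B" and N: "add_subgroup N"
    and mem: "z \<in> B" "v \<in> B" and F: "F \<inter> {z, - z, v, - v} = {}"
    and ne: "z \<noteq> v" "z \<noteq> - v" and inv: "z = - z \<longleftrightarrow> v = - v"
    and N': "add_subgroup N'" "N \<subseteq> N'" "v - z \<in> N'" "N' \<subseteq> group_closure (insert (v - z) N)"
  obtains \<sigma>' where "shuffle B F N' \<sigma>' {v, - v}"
    and "\<And>w. w \<notin> {z, - z, v, - v} \<Longrightarrow> \<sigma>' w = \<sigma> w"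
proof
  define \<tau> where "\<tau> b = (if b = z then v else if b = v then z else if b = - z then - v
    else if b = - v then - z else b)" for b
  have minus_mem: "- z \<in> B" "- v \<in> B"
    using mem B by (simp_all add: add_subgroup_minus)
  have ne': "- z \<noteq> v" "- v \<noteq> z" using ne by (auto simp: minus_equation_iff)
  have \<tau>\<tau>: "\<tau> (\<tau> b) = b" for b
    using ne ne' inv by (auto simp: \<tau>_def)
  have \<tau>B: "\<tau> b \<in> B" if "b \<in> B" for b
    using that mem minus_mem by (auto simp: \<tau>_def)
  have bij\<tau>: "bij_betw \<tau> B B"
    by (rule bij_betw_byWitness[where f' = \<tau>]) (auto simp: \<tau>\<tau> \<tau>B)
  have odd\<tau>: "\<tau> (- b) = - \<tau> b" for b
    using ne ne' inv by (auto simp: \<tau>_def minus_equation_iff[of b])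
  have fixed: "\<tau> b = b" if "b \<notin> {z, - z, v, - v}" for b
    using that by (auto simp: \<tau>_def)
  have \<tau>z: "\<tau> z = v" using ne by (auto simp: \<tau>_def)
  have sig: "bij_betw \<sigma> B B" "\<And>b. b \<in> B \<Longrightarrow> \<sigma> (- b) = - \<sigma> b" "0 \<in> F" "F \<subseteq> B"
    "B \<subseteq> group_closure F" "\<And>b. b \<in> F \<Longrightarrow> \<sigma> b = b" "\<And>b. b \<in> B \<Longrightarrow> \<sigma> b - b \<in> N"
    "N \<subseteq> group_closure ((\<lambda>b. \<sigma> b - b) ` (B - E))"
    using sh by (auto simp: shuffle_def)
  define \<sigma>' where "\<sigma>' = \<sigma> \<circ> \<tau>"
  show "\<sigma>' w = \<sigma> w" if "w \<notin> {z, - z, v, - v}" for w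
    using that by (simp add: \<sigma>'_def fixed)
  let ?G = "group_closure ((\<lambda>b. \<sigma>' b - b) ` (B - {v, - v}))"
  have G: "add_subgroup ?G" by (rule add_subgroup_group_closure)
  have NG: "N \<subseteq> ?G"
  proof -
    have "(\<lambda>b. \<sigma> b - b) ` (B - E) \<subseteq> (\<lambda>b. \<sigma>' b - b) ` (B - {v, - v})"
    proof
      fix y assume "y \<in> (\<lambda>b. \<sigma> b - b) ` (B - E)"
      then obtain b where b: "b \<in> B" "b \<notin> E" "y = \<sigma> b - b" by blast
      then have "\<tau> b = b" using E fixed[of b] by blast
      then show "y \<in> (\<lambda>b. \<sigma>' b - b) ` (B - {v, - v})"
        using b E by (auto simp: \<sigma>'_def intro!: image_eqI[of _ _ b])
    qed
    then have "group_closure ((\<lambda>b. \<sigma> b - b) ` (B - E)) \<subseteq> ?G"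
      by (intro group_closure_mono) (blast intro: group_closure.base)
    then show ?thesis using sig(8) by blast
  qed
  \<comment> \<open>The displacement at \<open>z\<close> is
    \<open>\<sigma> v - z = (\<sigma> v - v) + (v - z)\<close>, and its first summand lies in
    \<open>N\<close>.\<close>
  have "\<sigma>' z - z \<in> ?G"
    using mem ne by (intro group_closure.base) auto
  then have "\<sigma> v - z \<in> ?G" by (simp add: \<sigma>'_def \<tau>z)
  moreover have "\<sigma> v - v \<in> ?G" using sig(7) mem NG by blast
  ultimately have "v - z \<in> ?G"
    using add_subgroup_diff[OF G, of "\<sigma> v - z" "\<sigma> v - v"] by simp
  then have "group_closure (insert (v - z) N) \<subseteq> ?G"
    using NG by (intro group_closure_mono) auto
  with N'(4) have "N' \<subseteq> ?G" by (rule subset_trans)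
  moreover have "\<sigma>' b - b \<in> N'" if b: "b \<in> B" for b
  proof -
    have 1: "\<sigma> (\<tau> b) - \<tau> b \<in> N'" using sig(7) \<tau>B[OF b] N' by blast
    have "- (v - z) \<in> N'" "v - z \<in> N'" using N' by (blast intro: add_subgroup_minus)+
    then have 2: "\<tau> b - b \<in> N'"
      using add_subgroup_zero[OF N'(1)] by (auto simp: \<tau>_def)
    show ?thesis using add_subgroup_add[OF N'(1) 1 2] by (simp add: \<sigma>'_def)
  qed
  moreover have "bij_betw \<sigma>' B B"
    unfolding \<sigma>'_def by (rule bij_betw_trans[OF bij\<tau> sig(1)])
  moreover have "\<sigma>' (- b) = - \<sigma>' b" if "b \<in> B" for b
    using that by (simp add: \<sigma>'_def odd\<tau> sig(2) \<tau>B)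
  moreover have "\<sigma>' b = b" if "b \<in> F" for b
  proof -
    have "b \<notin> {z, - z, v, - v}" using that F by blast
    then show ?thesis using that sig(6) by (simp add: \<sigma>'_def fixed)
  qed
  ultimately show "shuffle B F N' \<sigma>' {v, - v}"
    using sig(3-5) unfolding shuffle_def by (intro conjI ballI) auto
qed

text \<open>The permutation acts on the component in \<open>B\<close> and leaves coordinate
  \<open>p\<close> alone. A displacement then depends on that component only, so \<open>N\<close>
  does not grow, and \<open>e\<close>, whose component is 0, can join the fixed generators.\<close>

lemma shuffle_extend:
  fixes B :: "('i \<Rightarrow> 'a::ab_group_add) set" and c :: 'a and p :: 'i
  defines "e \<equiv> 0(p := c)"
  assumes sh: "shuffle B F N \<sigma> {z, - z}" and z: "z \<in> B"
    and B: "add_subgroup B" and B': "add_subgroup B'"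
    and proj: "\<And>x. x \<in> B' \<Longrightarrow> x(p := 0) \<in> B" "\<And>x. x \<in> B \<Longrightarrow> x p = 0"
    and sub: "B \<subseteq> B'" "e \<in> B'" "B' \<subseteq> group_closure (insert e B)" and c: "c \<noteq> 0"
  obtains \<sigma>' where "shuffle B' (insert e F) N \<sigma>' {z, - z, z + e, - (z + e)}"
proof
  have sig: "bij_betw \<sigma> B B" "\<And>b. b \<in> B \<Longrightarrow> \<sigma> (- b) = - \<sigma> b" "0 \<in> F" "F \<subseteq> B"
    "B \<subseteq> group_closure F" "\<And>b. b \<in> F \<Longrightarrow> \<sigma> b = b" "\<And>b. b \<in> B \<Longrightarrow> \<sigma> b - b \<in> N"
    "N \<subseteq> group_closure ((\<lambda>b. \<sigma> b - b) ` (B - {z, - z}))"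
    using sh by (auto simp: shuffle_def)
  have \<sigma>B: "\<sigma> b \<in> B" if "b \<in> B" for b
    using that sig(1) by (auto simp: bij_betw_def)
  define \<pi> where "\<pi> x = x(p := 0)" for x :: "'i \<Rightarrow> 'a"
  define \<sigma>' where "\<sigma>' x = \<sigma> (\<pi> x) + (x - \<pi> x)" for x
  have \<pi>B: "\<pi> x \<in> B" if "x \<in> B'" for x using proj(1) that by (simp add: \<pi>_def)
  have \<pi>id: "\<pi> x = x" if "x \<in> B" for x
    using proj(2)[OF that] by (auto simp: \<pi>_def fun_eq_iff)
  have \<pi>add: "\<pi> (x + y) = \<pi> x + \<pi> y" "\<pi> (x - y) = \<pi> x - \<pi> y" "\<pi> (- x) = - \<pi> x" for x y
    by (auto simp: \<pi>_def fun_eq_iff)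
  have \<pi>e: "\<pi> e = 0" by (auto simp: \<pi>_def e_def fun_eq_iff)
  have \<sigma>'eq: "\<sigma>' b = \<sigma> b" if "b \<in> B" for b using that by (simp add: \<sigma>'_def \<pi>id)
  have \<sigma>'B': "\<sigma>' x \<in> B'" if "x \<in> B'" for x
    unfolding \<sigma>'_def using that \<pi>B \<sigma>B sub(1) B'
    by (blast intro: add_subgroup_add add_subgroup_diff)
  have \<pi>\<sigma>': "\<pi> (\<sigma>' x) = \<sigma> (\<pi> x)" if "x \<in> B'" for x
    using that by (simp add: \<sigma>'_def \<pi>add \<pi>id \<pi>B \<sigma>B)
  have bij: "bij_betw \<sigma>' B' B'"
  proof (rule bij_betwI')
    fix x y assume xy: "x \<in> B'" "y \<in> B'"
    show "\<sigma>' x = \<sigma>' y \<longleftrightarrow> x = y"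
    proof
      assume eq: "\<sigma>' x = \<sigma>' y"
      then have "\<sigma> (\<pi> x) = \<sigma> (\<pi> y)" using \<pi>\<sigma>' xy by metis
      then have "\<pi> x = \<pi> y"
        using sig(1) \<pi>B xy by (auto simp: bij_betw_def inj_on_def)
      then show "x = y" using eq by (simp add: \<sigma>'_def)
    qed simp
  next
    fix y assume y: "y \<in> B'"
    have "\<pi> y \<in> \<sigma> ` B"
      using \<pi>B[OF y] sig(1) by (simp add: bij_betw_def)
    then obtain b where b: "b \<in> B" "\<sigma> b = \<pi> y" by (metis imageE)
    have "b + (y - \<pi> y) \<in> B'"
      using b y \<pi>B[OF y] sub(1) B' by (blast intro: add_subgroup_add add_subgroup_diff)
    moreover have "\<pi> (b + (y - \<pi> y)) = b"
      using b y by (simp add: \<pi>add \<pi>id \<pi>B)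
    ultimately show "\<exists>x\<in>B'. y = \<sigma>' x"
      using b by (intro bexI[of _ "b + (y - \<pi> y)"]) (simp_all add: \<sigma>'_def)
  qed (rule \<sigma>'B')
  have zp: "z p = 0" "(- z) p = 0" using proj(2)[OF z] by auto
  \<comment> \<open>The new excluded points \<open>z + e\<close> and \<open>- (z + e)\<close> lie
    outside \<open>B\<close>, where no generator of \<open>N\<close> was taken from.\<close>
  have "(z + e) p \<noteq> 0" "(- (z + e)) p \<noteq> 0"
    using zp c by (auto simp: e_def)
  then have "z + e \<notin> B" "- (z + e) \<notin> B" using proj(2) by blast+
  then have "(\<lambda>b. \<sigma> b - b) ` (B - {z, - z}) \<subseteq>
      (\<lambda>b. \<sigma>' b - b) ` (B' - {z, - z, z + e, - (z + e)})"
    using sub(1) by (force simp: \<sigma>'eq)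
  then have span: "N \<subseteq> group_closure ((\<lambda>b. \<sigma>' b - b) ` (B' - {z, - z, z + e, - (z + e)}))"
    using sig(8) group_closure_mono[of "(\<lambda>b. \<sigma> b - b) ` (B - {z, - z})"
      "(\<lambda>b. \<sigma>' b - b) ` (B' - {z, - z, z + e, - (z + e)})"]
    by (blast intro: group_closure.base)
  have "B \<subseteq> group_closure (insert e F)"
    using sig(5) group_closure_mono[of F "insert e F"] by (blast intro: group_closure.base)
  then have "group_closure (insert e B) \<subseteq> group_closure (insert e F)"
    by (intro group_closure_mono) (auto intro: group_closure.base)
  then have "B' \<subseteq> group_closure (insert e F)" using sub(3) by blast
  moreover have "\<sigma>' (- b) = - \<sigma>' b" if "b \<in> B'" for b
    using that by (simp add: \<sigma>'_def \<pi>add sig(2) \<pi>B)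
  moreover have "\<sigma>' b = b" if "b \<in> insert e F" for b
    using that sig(3,4,6) by (auto simp: \<sigma>'eq subset_iff) (simp add: \<sigma>'_def \<pi>e)
  moreover have "\<sigma>' b - b \<in> N" if "b \<in> B'" for b
    using sig(7)[OF \<pi>B[OF that]] by (simp add: \<sigma>'_def)
  ultimately show "shuffle B' (insert e F) N \<sigma>' {z, - z, z + e, - (z + e)}"
    using bij span sig(3,4) sub(1,2) unfolding shuffle_def by (intro conjI ballI) auto
qed

section \<open>Products of cyclic groups of order 2 and 4\<close>

lemma four_cases: "x = 0 \<or> x = 1 \<or> x = 2 \<or> x = 3" for x :: 4
proof (cases x)
  case (of_int z)
  then have "z = 0 \<or> z = 1 \<or> z = 2 \<or> z = 3" by auto
  then show ?thesis using of_int by auto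
qed

lemma four_double_eq_0_iff: "2 * x = 0 \<longleftrightarrow> x = 0 \<or> x = 2" for x :: 4
  using four_cases[of x] by auto

lemma four_of_int_eq_0_iff: "(of_int k :: 4) = 0 \<longleftrightarrow> k mod 4 = 0"
  by (simp add: of_int_eq_0_iff_char_dvd dvd_eq_mod_eq_0)

text \<open>The indices in \<open>I\<close> carry factors Z2, those in \<open>J\<close> factors Z4.
  Realising Z2 as \<open>{0, 2}\<close> inside Z4 puts all these groups into one function space,
  where a factor is added by releasing a coordinate.\<close>

definition box :: "'i set \<Rightarrow> 'i set \<Rightarrow> ('i \<Rightarrow> 4) set" where
  "box I J = {x. (\<forall>i\<in>I. x i \<in> {0, 2}) \<and> (\<forall>i. i \<notin> I \<union> J \<longrightarrow> x i = 0)}"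

lemma add_subgroup_box: "add_subgroup (box I J)"
proof -
  have "a - b \<in> {0, 2}" if "a \<in> {0, 2}" "b \<in> {0, 2}" for a b :: 4
    using that by auto
  then show ?thesis by (simp add: add_subgroup_def box_def)
qed

lemma box_subset:
  assumes M: "add_subgroup M" and fin: "finite I" "finite J"
    and I: "\<And>i. i \<in> I \<Longrightarrow> 0(i := 2) \<in> M" and J: "\<And>j. j \<in> J \<Longrightarrow> 0(j := 1) \<in> M"
  shows "box I J \<subseteq> M"
proof
  fix x :: "'a \<Rightarrow> 4" assume x: "x \<in> box I J"
  have "0(i := x i) \<in> M" if i: "i \<in> I \<union> J" for i
  proof (cases "i \<in> I")
    case True
    then have "x i = 0 \<or> x i = 2" using x by (auto simp: box_def)
    moreover have "(0 :: 'a \<Rightarrow> 4)(i := 0) = 0" by auto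
    ultimately show ?thesis using I[OF True] M by (auto simp: add_subgroup_zero)
  next
    case False
    then have 1: "0(i := 1) \<in> M" using J i by blast
    have upd_add: "(0(i := a) :: 'a \<Rightarrow> 4) + 0(i := b) = 0(i := a + b)" for a b by auto
    have 2: "0(i := 2) \<in> M" using add_subgroup_add[OF M 1 1] by (simp add: upd_add)
    have 3: "0(i := 3) \<in> M" using add_subgroup_add[OF M 1 2] by (simp add: upd_add)
    have "(0 :: 'a \<Rightarrow> 4)(i := 0) = 0" by auto
    then show ?thesis using four_cases[of "x i"] 1 2 3 M by (auto simp: add_subgroup_zero)
  qed
  then have "(\<Sum>i\<in>I \<union> J. 0(i := x i)) \<in> M" by (rule add_subgroup_sum[OF M])
  moreover have "(\<Sum>i\<in>I \<union> J. 0(i := x i)) = x"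
  proof
    fix r
    have "(\<Sum>i\<in>A. 0(i := x i)) r = (\<Sum>i\<in>A. if i = r then x i else 0)" if "finite A" for A
      using that by (induction A) auto
    then show "(\<Sum>i\<in>I \<union> J. 0(i := x i)) r = x r"
      using x fin by (auto simp: box_def)
  qed
  ultimately show "x \<in> M" by simp
qed

lemma card_box_step:
  assumes "p \<notin> I \<union> J" and "C \<noteq> {}"
    and "B' = (\<lambda>(c, x). x(p := c)) ` (C \<times> box I J)"
  shows "card B' = card C * card (box I J)"
proof -
  have "inj_on (\<lambda>(c, x). x(p := c)) (C \<times> box I J)"
  proof (clarsimp simp: inj_on_def)
    fix c d x y assume *: "x \<in> box I J" "y \<in> box I J" "x(p := c) = y(p := d)"
    have "x p = 0" "y p = 0" using * assms(1) by (auto simp: box_def)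
    then show "c = d \<and> x = y" using *(3) by (metis fun_upd_same fun_upd_triv fun_upd_upd)
  qed
  then show ?thesis by (simp add: assms(3) card_image card_cartesian_product)
qed

lemma box_insert_left:
  assumes "p \<notin> I \<union> J"
  shows "box (insert p I) J = (\<lambda>(c, x). x(p := c)) ` ({0, 2} \<times> box I J)"
proof
  show "box (insert p I) J \<subseteq> (\<lambda>(c, x). x(p := c)) ` ({0, 2} \<times> box I J)"
  proof
    fix x assume "x \<in> box (insert p I) J"
    then show "x \<in> (\<lambda>(c, x). x(p := c)) ` ({0, 2} \<times> box I J)"
      using assms by (intro image_eqI[of _ _ "(x p, x(p := 0))"])
        (auto simp: box_def)
  qed
qed (use assms in \<open>auto simp: box_def; blast\<close>)

lemma box_insert_right:
  assumes "p \<notin> I \<union> J"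
  shows "box I (insert p J) = (\<lambda>(c, x). x(p := c)) ` (UNIV \<times> box I J)"
proof
  show "box I (insert p J) \<subseteq> (\<lambda>(c, x). x(p := c)) ` (UNIV \<times> box I J)"
  proof
    fix x assume "x \<in> box I (insert p J)"
    then show "x \<in> (\<lambda>(c, x). x(p := c)) ` (UNIV \<times> box I J)"
      using assms by (intro image_eqI[of _ _ "(x p, x(p := 0))"]) (auto simp: box_def)
  qed
qed (use assms in \<open>auto simp: box_def; blast\<close>)

lemma card_box:
  assumes "finite I" "finite J" "I \<inter> J = {}"
  shows "card (box I J) = 2 ^ card I * 4 ^ card J"
proof -
  have 0: "card (box I {}) = 2 ^ card I" using assms(1)
  proof (induction I)
    case empty
    have "box {} {} = {0 :: 'a \<Rightarrow> 4}" by (auto simp: box_def)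
    then show ?case by simp
  next
    case (insert p I)
    then show ?case
      using card_box_step[OF _ _ box_insert_left[of p I "{}"]] by simp
  qed
  show ?thesis using assms(2,3)
  proof (induction J)
    case (insert p J)
    then have "card (box I (insert p J)) = card (UNIV :: 4 set) * card (box I J)"
      by (intro card_box_step[OF _ _ box_insert_right]) auto
    then show ?case using insert by simp
  qed (simp add: 0)
qed

lemma finite_box: "finite I \<Longrightarrow> finite J \<Longrightarrow> I \<inter> J = {} \<Longrightarrow> finite (box I J)"
  by (rule card_ge_0_finite) (simp add: card_box)

lemma box_double_eq_0: "{x \<in> box I J. x + x = 0} = box (I \<union> J) {}"
  by (auto simp: box_def fun_eq_iff four_double_eq_0_iff)

lemma add_subgroup_upd:
  assumes "add_subgroup C" "add_subgroup N"
  shows "add_subgroup ((\<lambda>(c, x). x(p := c)) ` (C \<times> N))"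
  unfolding add_subgroup_def
proof (intro conjI ballI)
  show "0 \<in> (\<lambda>(c, x). x(p := c)) ` (C \<times> N)"
    using assms by (intro image_eqI[of _ _ "(0, 0)"]) (auto simp: add_subgroup_zero)
  fix x y assume "x \<in> (\<lambda>(c, x). x(p := c)) ` (C \<times> N)" "y \<in> (\<lambda>(c, x). x(p := c)) ` (C \<times> N)"
  then obtain c a d b where "x = a(p := c)" "y = b(p := d)" "c \<in> C" "d \<in> C" "a \<in> N" "b \<in> N" by auto
  then show "x - y \<in> (\<lambda>(c, x). x(p := c)) ` (C \<times> N)"
    using assms by (intro image_eqI[of _ _ "(c - d, a - b)"]) (auto simp: add_subgroup_diff)
qed

text \<open>The new factor either stays out of \<open>N\<close> (first claim) or is adjoined to
  \<open>N\<close> as a whole by swapping \<open>z\<close> with \<open>z + e\<close> (second claim).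
  In the case of Z4 the element \<open>z + e\<close> has order 4, so \<open>z\<close> must have
  order 4 as well; in the case of Z2 any \<open>z\<close> will do, because then \<open>z\<close> and
  \<open>z + e\<close> have the same double.\<close>

lemma shuffle_box_extend:
  fixes I J :: "'i set" and C :: "4 set" and c :: 4 and p :: 'i
  defines "B \<equiv> box I J"
  defines "e \<equiv> 0(p := c)"
  assumes sh: "shuffle B F N \<sigma> {z, - z}" and z: "z \<in> B" "z \<notin> F" "- z \<notin> F"
    and p: "p \<notin> I \<union> J" and N: "add_subgroup N" "N \<subseteq> B"
    and C: "C = {0, 2} \<and> c = 2 \<or> C = UNIV \<and> c = 1 \<and> z + z \<noteq> 0"
    and B': "B' = (\<lambda>(c, x). x(p := c)) ` (C \<times> B)" "add_subgroup B'"
    and N': "N' = (\<lambda>(c, x). x(p := c)) ` (C \<times> N)"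
  shows "\<exists>\<sigma>' F'. shuffle B' F' N \<sigma>' {z, - z} \<and> z \<in> B' \<and> z \<notin> F' \<and> - z \<notin> F'"
    and "\<exists>\<sigma>' F' v. shuffle B' F' N' \<sigma>' {v, - v} \<and> v \<in> B' \<and> v \<notin> F' \<and> - v \<notin> F' \<and>
      (z + z \<noteq> 0 \<longrightarrow> v + v \<noteq> 0)"
    and "add_subgroup N'" and "N' \<subseteq> B'" and "card N' = card C * card N"
proof -
  have c: "c \<noteq> 0" "c \<in> C" "0 \<in> C" using C by auto
  have sC: "add_subgroup C" using C by (auto simp: add_subgroup_def)
  have sB: "add_subgroup B" unfolding B_def by (rule add_subgroup_box)
  have Bp: "x p = 0" if "x \<in> B" for x using that p by (auto simp: B_def box_def)
  have F: "0 \<in> F" "F \<subseteq> B" using sh by (auto simp: shuffle_def)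
  have z0: "z \<noteq> 0" using z F by metis
  have zp: "z p = 0" by (rule Bp[OF z(1)])
  have off: "r = p \<or> e r = 0" for r by (auto simp: e_def)
  have ep: "e p = c" by (simp add: e_def)
  have split: "x(p := d) = x + 0(p := d)" if "x \<in> B" for x d
    using Bp[OF that] by (auto simp: fun_eq_iff)
  have mult: "0(p := d) \<in> group_closure (insert e S)" if "d \<in> C" for d S
  proof -
    have 1: "e \<in> group_closure (insert e S)" by (auto intro: group_closure.base)
    have "(0 :: 'i \<Rightarrow> 4)(p := d) \<in> {0, e, e + e, e + e + e}"
      using C that four_cases[of d] by (auto simp: e_def fun_eq_iff)
    then show ?thesis using 1 group_closure_add[OF 1 1]
        group_closure_add[OF group_closure_add[OF 1 1] 1] by auto
  qed
  have BB': "B \<subseteq> B'"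
  proof
    fix x assume "x \<in> B"
    then show "x \<in> B'" unfolding B'(1)
      using c Bp[of x] by (intro image_eqI[of _ _ "(0, x)"]) (auto simp: fun_eq_iff)
  qed
  have eB': "e \<in> B'" unfolding B'(1) e_def
    using c add_subgroup_zero[OF sB] by (intro image_eqI[of _ _ "(c, 0)"]) auto
  have span: "B' \<subseteq> group_closure (insert e B)" unfolding B'(1)
    using split mult by (auto intro!: group_closure_add intro: group_closure.base)
  have proj: "x(p := 0) \<in> B" if "x \<in> B'" for x
    using that Bp unfolding B'(1) by (auto simp: fun_upd_idem)
  obtain \<sigma>1 where s1: "shuffle B' (insert e F) N \<sigma>1 {z, - z, z + e, - (z + e)}"
    using shuffle_extend[of B F N \<sigma> z B' p c] sh z(1) sB B'(2) proj Bp BB' eB' span c(1)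
    unfolding e_def by blast
  have nF: "x \<notin> F" if "x p \<noteq> 0" for x using that F Bp by blast
  have out: "{z, - z, z + e, - (z + e)} \<inter> insert e F = {}"
  proof -
    have "z \<noteq> e" "- z \<noteq> e" using zp ep c by auto
    moreover have "z + e \<noteq> e" using z0 by simp
    \<comment> \<open>Away from coordinate \<open>p\<close> such an equation says that
      \<open>z\<close> vanishes. But \<open>z\<close> is nonzero, since \<open>0\<close> belongs to
      \<open>F\<close> and \<open>z\<close> does not.\<close>
    moreover have "- (z + e) \<noteq> e"
    proof
      assume *: "- (z + e) = e"
      have "z r = 0" for r
        using fun_cong[OF *, of r] off[of r] zp by auto
      then show False using z0 by auto
    qed
    moreover have "z + e \<notin> F" "- (z + e) \<notin> F"
      using nF[of "z + e"] nF[of "- (z + e)"] zp ep c by auto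
    ultimately show ?thesis using z by blast
  qed
  show "\<exists>\<sigma>' F'. shuffle B' F' N \<sigma>' {z, - z} \<and> z \<in> B' \<and> z \<notin> F' \<and> - z \<notin> F'"
    using shuffle_antimono[OF s1, of "{z, - z}"] z(1) BB' out by blast
  show sN': "add_subgroup N'" unfolding N' by (rule add_subgroup_upd[OF sC N(1)])
  show "N' \<subseteq> B'" unfolding N' B'(1) using N by auto
  have NN': "N \<subseteq> N'"
  proof
    fix x assume "x \<in> N"
    then show "x \<in> N'" unfolding N'
      using c Bp[of x] N(2) by (intro image_eqI[of _ _ "(0, x)"]) (auto simp: fun_eq_iff)
  qed
  have eN': "(z + e) - z \<in> N'"
    unfolding N' using c add_subgroup_zero[OF N(1)] by (intro image_eqI[of _ _ "(c, 0)"]) (auto simp: e_def)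
  have spanN': "N' \<subseteq> group_closure (insert ((z + e) - z) N)"
    using split[OF subsetD[OF N(2)]] mult unfolding N' by (auto intro!: group_closure_add intro: group_closure.base)
  \<comment> \<open>For \<open>c = 2\<close> doubling kills \<open>e\<close>. For
    \<open>c = 1\<close> it leaves 2 at coordinate \<open>p\<close>, so both sides are
    false.\<close>
  have dbl': "z + z = 0 \<longleftrightarrow> z + e + (z + e) = 0"
    using C
  proof
    assume "C = {0, 2} \<and> c = 2"
    then have "e + e = 0" by (auto simp: e_def fun_eq_iff)
    moreover have "z + e + (z + e) = z + z + (e + e)" by (simp add: algebra_simps)
    ultimately show ?thesis by simp
  next
    assume *: "C = UNIV \<and> c = 1 \<and> z + z \<noteq> 0"
    then have "(z + e + (z + e)) p \<noteq> 0" using zp ep by simp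
    then show ?thesis using * by (metis zero_fun_apply)
  qed
  have inv: "z = - z \<longleftrightarrow> z + e = - (z + e)"
    using dbl' by (metis add_eq_0_iff)
  have ne: "z \<noteq> z + e" "z \<noteq> - (z + e)"
  proof -
    show "z \<noteq> z + e" using ep c by auto
    show "z \<noteq> - (z + e)"
    proof
      assume *: "z = - (z + e)"
      show False using fun_cong[OF *, of p] zp ep c by simp
    qed
  qed
  have vB': "z + e \<in> B'" using z BB' eB' B'(2) by (blast intro: add_subgroup_add)
  have zB': "z \<in> B'" using z(1) BB' by blast
  have out': "insert e F \<inter> {z, - z, z + e, - (z + e)} = {}" using out by (simp only: Int_commute)
  obtain \<sigma>2 where "shuffle B' (insert e F) N' \<sigma>2 {z + e, - (z + e)}"
    by (rule shuffle_swap[OF s1 subset_refl B'(2) N(1) zB' vB' out' ne inv sN' NN' eN' spanN'])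
  then show "\<exists>\<sigma>' F' v. shuffle B' F' N' \<sigma>' {v, - v} \<and> v \<in> B' \<and> v \<notin> F' \<and> - v \<notin> F' \<and>
      (z + z \<noteq> 0 \<longrightarrow> v + v \<noteq> 0)"
    using vB' out dbl' by blast
  have "inj_on (\<lambda>(c, x). x(p := c)) (C \<times> N)"
  proof (clarsimp simp: inj_on_def)
    fix c d x y assume *: "x \<in> N" "y \<in> N" "x(p := c) = y(p := d)"
    have "x p = 0" "y p = 0" using * N(2) Bp by auto
    then show "c = d \<and> x = y" using *(3) by (metis fun_upd_same fun_upd_triv fun_upd_upd)
  qed
  then show "card N' = card C * card N" by (simp add: N' card_image card_cartesian_product)
qed

text \<open>The point \<open>z\<close> is the one at which the next swap attaches. Its order is
  prescribed only from two factors Z4 on: that is where further factors Z4 get adjoined, whereas the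
  construction for a single factor Z4 moves elements of order 2.\<close>

definition shufflable :: "'i set \<Rightarrow> 'i set \<Rightarrow> nat \<Rightarrow> bool" where
  "shufflable I J k \<longleftrightarrow> (\<exists>\<sigma> F N z. shuffle (box I J) F N \<sigma> {z, - z} \<and> add_subgroup N \<and>
     N \<subseteq> box I J \<and> card N = 2 ^ k \<and> z \<in> box I J \<and> z \<notin> F \<and> - z \<notin> F \<and>
     (card J \<ge> 2 \<longrightarrow> z + z \<noteq> 0))"

lemma shufflable_insert_left:
  assumes "shufflable I J k" and p: "p \<notin> I \<union> J"
  shows "shufflable (insert p I) J k" and "shufflable (insert p I) J (Suc k)"
proof -
  obtain \<sigma> F N z where *: "shuffle (box I J) F N \<sigma> {z, - z}" "add_subgroup N"
    "N \<subseteq> box I J" "card N = 2 ^ k" "z \<in> box I J" "z \<notin> F" "- z \<notin> F"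
    "card J \<ge> 2 \<longrightarrow> z + z \<noteq> 0"
    using assms(1) unfolding shufflable_def by blast
  let ?B' = "box (insert p I) J" and ?N' = "(\<lambda>(c, x). x(p := c)) ` ({0, 2} \<times> N)"
  have sub: "N \<subseteq> ?B'"
    using *(3) p by (intro subset_trans[OF *(3)]) (auto simp: box_def)
  have C: "{0, 2} = {0, 2} \<and> (2::4) = 2 \<or> {0, 2} = UNIV \<and> (2::4) = 1 \<and> z + z \<noteq> 0" by simp
  note ext = shuffle_box_extend[OF *(1,5,6,7) p *(2,3) C box_insert_left[OF p] add_subgroup_box refl]
  show "shufflable (insert p I) J k"
    unfolding shufflable_def using ext(1) *(2,4,8) sub by blast
  show "shufflable (insert p I) J (Suc k)"
  proof -
    obtain \<sigma>' F' v where "shuffle ?B' F' ?N' \<sigma>' {v, - v}" "v \<in> ?B'" "v \<notin> F'" "- v \<notin> F'"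
      "z + z \<noteq> 0 \<longrightarrow> v + v \<noteq> 0"
      using ext(2) by blast
    moreover have "card ?N' = 2 ^ Suc k"
      unfolding ext(5) by (simp add: *(4) power_add)
    ultimately show ?thesis
      unfolding shufflable_def using ext(3,4) *(8)
      by (intro exI[of _ \<sigma>'] exI[of _ F'] exI[of _ ?N'] exI[of _ v]) simp
  qed
qed

lemma shufflable_insert_right:
  assumes "shufflable I J k" and p: "p \<notin> I \<union> J" and J: "card J \<ge> 2"
  shows "shufflable I (insert p J) k" and "shufflable I (insert p J) (k + 2)"
proof -
  obtain \<sigma> F N z where *: "shuffle (box I J) F N \<sigma> {z, - z}" "add_subgroup N"
    "N \<subseteq> box I J" "card N = 2 ^ k" "z \<in> box I J" "z \<notin> F" "- z \<notin> F" "z + z \<noteq> 0"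
    using assms(1) J unfolding shufflable_def by blast
  let ?B' = "box I (insert p J)" and ?N' = "(\<lambda>(c, x). x(p := c)) ` (UNIV \<times> N)"
  have sub: "N \<subseteq> ?B'"
    using *(3) p by (intro subset_trans[OF *(3)]) (auto simp: box_def)
  have C: "UNIV = {0, 2} \<and> (1::4) = 2 \<or> UNIV = UNIV \<and> (1::4) = 1 \<and> z + z \<noteq> 0"
    using *(8) by simp
  note ext = shuffle_box_extend[OF *(1,5,6,7) p *(2,3) C box_insert_right[OF p] add_subgroup_box refl]
  show "shufflable I (insert p J) k"
    unfolding shufflable_def using ext(1) *(2,4,8) sub by blast
  show "shufflable I (insert p J) (k + 2)"
  proof -
    obtain \<sigma>' F' v where "shuffle ?B' F' ?N' \<sigma>' {v, - v}" "v \<in> ?B'" "v \<notin> F'" "- v \<notin> F'"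
      "z + z \<noteq> 0 \<longrightarrow> v + v \<noteq> 0"
      using ext(2) by blast
    moreover have "card ?N' = 2 ^ (k + 2)"
      unfolding ext(5) by (simp add: *(4) power_add)
    ultimately show ?thesis
      unfolding shufflable_def using ext(3,4) *(8)
      by (intro exI[of _ \<sigma>'] exI[of _ F'] exI[of _ ?N'] exI[of _ v]) simp
  qed
qed

lemma shufflable_grow_left:
  assumes "finite A" "A \<inter> (I \<union> J) = {}" "\<And>k. k \<le> m \<Longrightarrow> shufflable I J k" "k \<le> m + card A"
  shows "shufflable (A \<union> I) J k"
  using assms
proof (induction A arbitrary: k)
  case (insert p A)
  then have p: "p \<notin> (A \<union> I) \<union> J" by auto
  have IH: "shufflable (A \<union> I) J k" if "k \<le> m + card A" for k
    using insert that by auto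
  show ?case
  proof (cases "k \<le> m + card A")
    case True
    then show ?thesis using shufflable_insert_left(1)[OF IH p] by simp
  next
    case False
    then obtain k' where "k = Suc k'" "k' \<le> m + card A"
      using insert by (cases k) auto
    then show ?thesis using shufflable_insert_left(2)[OF IH p] by simp
  qed
qed simp

text \<open>A factor Z4 raises the exponent by 0 or by 2. The attainable exponents stay free of gaps
  because the initial range contains both 0 and 1, which is the purpose of
  \<open>m \<ge> 1\<close>.\<close>

lemma shufflable_grow_right:
  assumes "finite A" "A \<inter> (I \<union> J) = {}" "card J \<ge> 2" "finite J"
    "\<And>k. k \<le> m \<Longrightarrow> shufflable I J k" "m \<ge> 1" "k \<le> m + 2 * card A"
  shows "shufflable I (A \<union> J) k"
  using assms
proof (induction A arbitrary: k)
  case (insert p A)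
  then have p: "p \<notin> I \<union> (A \<union> J)" by auto
  have IH: "shufflable I (A \<union> J) k" if "k \<le> m + 2 * card A" for k
    using insert that by auto
  have J: "card (A \<union> J) \<ge> 2"
    using insert card_mono[of "A \<union> J" J] by auto
  show ?case
  proof (cases "k \<le> m + 2 * card A")
    case True
    then show ?thesis using shufflable_insert_right(1)[OF IH p J] by simp
  next
    case False
    then have "k = (k - 2) + 2" "k - 2 \<le> m + 2 * card A"
      using insert by auto
    then show ?thesis using shufflable_insert_right(2)[OF IH p J, of "k - 2"] by simp
  qed
qed simp

text \<open>The points of \<open>W\<close> are still fixed and are held in reserve as partners of
  later swaps; \<open>z\<close> is the end of the chain of swaps so far.\<close>

definition stage ::
  "'a::ab_group_add set \<Rightarrow> 'a set \<Rightarrow> 'a set \<Rightarrow> ('a \<Rightarrow> 'a) \<Rightarrow> 'a \<Rightarrow> 'a set \<Rightarrow> bool" where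
  "stage B F N \<sigma> z W \<longleftrightarrow> shuffle B F N \<sigma> {z, - z} \<and> z \<in> B \<and> z \<notin> F \<and> - z \<notin> F \<and> (\<forall>w\<in>W. \<sigma> w = w)"

lemma stage_id:
  assumes "0 \<in> F" "F \<subseteq> B" "B \<subseteq> group_closure F" "z \<in> B" "z \<notin> F" "- z \<notin> F"
  shows "stage B F {0} id z W"
  using assms shuffle_id by (auto simp: stage_def)

text \<open>The partner \<open>v\<close> is still fixed, so it and its negative may be excluded
  before the swap; afterwards \<open>v\<close> is the new end of the chain.\<close>

lemma stage_swap:
  assumes st: "stage B F N \<sigma> z W" and B: "add_subgroup B" and N: "add_subgroup N"
    and v: "v \<in> W" "v \<in> B" "v \<notin> F" "- v \<notin> F"
    and ne: "z \<noteq> v" "z \<noteq> - v" and inv: "z = - z \<longleftrightarrow> v = - v"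
    and N': "add_subgroup N'" "N \<subseteq> N'" "v - z \<in> N'" "N' \<subseteq> group_closure (insert (v - z) N)"
  obtains \<sigma>' where "stage B F N' \<sigma>' v (W - {z, - z, v, - v})"
proof -
  have sh: "shuffle B F N \<sigma> ({z, - z} \<union> {v, - v})"
    using st v by (intro shuffle_exclude_fixed[OF _ B]) (auto simp: stage_def)
  have zB: "z \<in> B" and F: "F \<inter> {z, - z, v, - v} = {}" using st v by (auto simp: stage_def)
  have E: "{z, - z, v, - v} \<subseteq> {z, - z} \<union> {v, - v}" by auto
  obtain \<sigma>' where s: "shuffle B F N' \<sigma>' {v, - v}"
    and eq: "\<And>w. w \<notin> {z, - z, v, - v} \<Longrightarrow> \<sigma>' w = \<sigma> w"
    by (rule shuffle_swap[OF sh E B N zB v(2) F ne inv N']) (rule that)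
  then have "stage B F N' \<sigma>' v (W - {z, - z, v, - v})"
    using st v by (auto simp: stage_def)
  then show thesis by (rule that)
qed

lemma stage_shufflable:
  assumes "stage (box I J) F N \<sigma> z W" "add_subgroup N" "N \<subseteq> box I J" "card N = 2 ^ k"
    "card J \<ge> 2 \<longrightarrow> z + z \<noteq> 0"
  shows "shufflable I J k"
  using assms unfolding shufflable_def stage_def
  by (intro exI[of _ \<sigma>] exI[of _ F] exI[of _ N] exI[of _ z]) simp

lemma box_subset_closure:
  assumes "finite I" "finite J"
    and "\<And>i. i \<in> I \<Longrightarrow> 0(i := 2) \<in> group_closure S" "\<And>j. j \<in> J \<Longrightarrow> 0(j := 1) \<in> group_closure S"
  shows "box I J \<subseteq> group_closure S"
  using assms by (intro box_subset add_subgroup_group_closure)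

section \<open>The three starting groups\<close>

definition vec3 :: "'i \<Rightarrow> 'i \<Rightarrow> 'i \<Rightarrow> 4 \<Rightarrow> 4 \<Rightarrow> 4 \<Rightarrow> 'i \<Rightarrow> 4" where
  "vec3 i j l a b c = 0(i := a, j := b, l := c)"

lemma vec3_diff: "vec3 i j l a b c - vec3 i j l a' b' c' = vec3 i j l (a - a') (b - b') (c - c')"
  and vec3_minus: "- vec3 i j l a b c = vec3 i j l (- a) (- b) (- c)"
  and vec3_zero: "vec3 i j l 0 0 0 = 0"
  by (auto simp: vec3_def fun_eq_iff)

lemma vec3_eq_iff:
  "distinct [i, j, l] \<Longrightarrow> vec3 i j l a b c = vec3 i j l a' b' c' \<longleftrightarrow> a = a' \<and> b = b' \<and> c = c'"
  unfolding vec3_def by (auto simp: fun_eq_iff split: if_splits)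

lemma vec3_eq_0_iff: "distinct [i, j, l] \<Longrightarrow> vec3 i j l a b c = 0 \<longleftrightarrow> a = 0 \<and> b = 0 \<and> c = 0"
  using vec3_eq_iff[of i j l a b c 0 0 0] by (simp add: vec3_zero)

lemma vec3_in_box_left:
  "distinct [i, j, l] \<Longrightarrow> vec3 i j l a b c \<in> box {i, j, l} {} \<longleftrightarrow> {a, b, c} \<subseteq> {0, 2}"
  "distinct [i, j, l] \<Longrightarrow> vec3 i j l a b c \<in> box {i, j} {} \<longleftrightarrow> {a, b} \<subseteq> {0, 2} \<and> c = 0"
  "distinct [i, j, l] \<Longrightarrow> vec3 i j l a b c \<in> box {i} {} \<longleftrightarrow> a \<in> {0, 2} \<and> b = 0 \<and> c = 0"
  unfolding vec3_def box_def by (auto split: if_splits)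

lemma vec3_single:
  "distinct [i, j, l] \<Longrightarrow> 0(i := a) = vec3 i j l a 0 0"
  "distinct [i, j, l] \<Longrightarrow> 0(j := a) = vec3 i j l 0 a 0"
  "distinct [i, j, l] \<Longrightarrow> 0(l := a) = vec3 i j l 0 0 a"
  by (auto simp: vec3_def fun_eq_iff)

text \<open>Besides 0 and the basis kept in \<open>F\<close>, exactly four elements remain: 022,
  222, 202, 220. Swapping along this chain ends in a 4-cycle. The successive differences 200, 020,
  022 are independent, so each swap doubles \<open>N\<close>. In Z2 x Z2 only one element would
  remain and nothing could move.\<close>

lemma shufflable_3_0:
  assumes d: "distinct [i, j, l]" and k: "k \<le> 3"
  shows "shufflable {i, j, l} {} k"
proof -
  let ?v = "vec3 i j l" and ?B = "box {i, j, l} {}"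
  let ?F = "{0, ?v 2 0 0, ?v 0 2 0, ?v 0 0 2}"
  let ?W = "{?v 2 2 2, ?v 2 0 2, ?v 2 2 0}"
  let ?N1 = "box {i} {}" and ?N2 = "box {i, j} {}"
  have span: "?B \<subseteq> group_closure ?F"
    by (rule box_subset_closure) (auto simp: vec3_single[OF d] intro: group_closure.base)
  note calc = vec3_eq_iff[OF d] vec3_eq_0_iff[OF d] vec3_in_box_left[OF d] vec3_diff vec3_minus
    vec3_zero add_subgroup_zero[OF add_subgroup_box] eq_commute[of 0 "?v _ _ _"]
  note sub = add_subgroup_box
  have z0: "add_subgroup {0 :: 'a \<Rightarrow> 4}" by (simp add: add_subgroup_def)
  have c: "card ?N1 = 2 ^ 1" "card ?N2 = 2 ^ 2" "card ?B = 2 ^ 3"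
    using d by (simp_all add: card_box)
  have le: "?N1 \<subseteq> ?B" "?N2 \<subseteq> ?B" "?N1 \<subseteq> ?N2" by (auto simp: box_def)
  have s0: "stage ?B ?F {0} id (?v 0 2 2) ?W"
    by (rule stage_id) (use span in \<open>simp_all add: calc\<close>)
  obtain \<sigma>1 where s1: "stage ?B ?F ?N1 \<sigma>1 (?v 2 2 2) (?W - {?v 0 2 2, - ?v 0 2 2, ?v 2 2 2, - ?v 2 2 2})"
  proof (rule stage_swap[OF s0 sub z0])
    show "?N1 \<subseteq> group_closure (insert (?v 2 2 2 - ?v 0 2 2) {0})"
      by (rule box_subset_closure) (auto simp: calc vec3_single[OF d] intro!: group_closure.base)
  qed (use sub in \<open>simp_all add: calc\<close>)
  obtain \<sigma>2 where s2: "stage ?B ?F ?N2 \<sigma>2 (?v 2 0 2) (?W - {?v 0 2 2, - ?v 0 2 2, ?v 2 2 2, - ?v 2 2 2}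
      - {?v 2 2 2, - ?v 2 2 2, ?v 2 0 2, - ?v 2 0 2})"
  proof (rule stage_swap[OF s1 sub sub])
    show "?N2 \<subseteq> group_closure (insert (?v 2 0 2 - ?v 2 2 2) ?N1)"
      by (rule box_subset_closure) (auto simp: calc vec3_single[OF d] intro!: group_closure.base)
  qed (use sub le in \<open>simp_all add: calc\<close>)
  obtain \<sigma>3 where s3: "stage ?B ?F ?B \<sigma>3 (?v 2 2 0) (?W - {?v 0 2 2, - ?v 0 2 2, ?v 2 2 2, - ?v 2 2 2}
      - {?v 2 2 2, - ?v 2 2 2, ?v 2 0 2, - ?v 2 0 2} - {?v 2 0 2, - ?v 2 0 2, ?v 2 2 0, - ?v 2 2 0})"
  proof (rule stage_swap[OF s2 sub sub])
    let ?S = "insert (?v 2 2 0 - ?v 2 0 2) ?N2"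
    have "?v 2 2 0 - ?v 2 0 2 \<in> group_closure ?S" and S: "?v 0 2 0 \<in> group_closure ?S"
      "?v 2 0 0 \<in> group_closure ?S"
      by (auto intro!: group_closure.base simp: calc)
    moreover have "?v 2 2 0 - ?v 2 0 2 - ?v 0 2 0 = ?v 0 0 2" by (simp add: calc)
    ultimately have "?v 0 0 2 \<in> group_closure ?S" by (metis group_closure.diff)
    then show "?B \<subseteq> group_closure ?S"
      using S by (intro box_subset_closure) (auto simp: vec3_single[OF d])
  qed (use sub le in \<open>simp_all add: calc\<close>)
  have "k = 0 \<or> k = 1 \<or> k = 2 \<or> k = 3" using k by auto
  then show ?thesis
    using stage_shufflable[OF s0 z0, of 0] stage_shufflable[OF s1 sub _ c(1)]
      stage_shufflable[OF s2 sub _ c(2)] stage_shufflable[OF s3 sub _ c(3)] le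
    by (auto simp: add_subgroup_zero[OF sub])
qed

definition vec2 :: "'i \<Rightarrow> 'i \<Rightarrow> 4 \<Rightarrow> 4 \<Rightarrow> 'i \<Rightarrow> 4" where
  "vec2 i j a b = 0(i := a, j := b)"

lemma vec2_diff: "vec2 i j a b - vec2 i j a' b' = vec2 i j (a - a') (b - b')"
  and vec2_minus: "- vec2 i j a b = vec2 i j (- a) (- b)"
  and vec2_zero: "vec2 i j 0 0 = 0"
  by (auto simp: vec2_def fun_eq_iff)

lemma vec2_eq_iff: "i \<noteq> j \<Longrightarrow> vec2 i j a b = vec2 i j a' b' \<longleftrightarrow> a = a' \<and> b = b'"
  unfolding vec2_def by (auto simp: fun_eq_iff split: if_splits)

lemma vec2_eq_0_iff: "i \<noteq> j \<Longrightarrow> vec2 i j a b = 0 \<longleftrightarrow> a = 0 \<and> b = 0"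
  using vec2_eq_iff[of i j a b 0 0] by (simp add: vec2_zero)

lemma vec2_in_box:
  "i \<noteq> j \<Longrightarrow> vec2 i j a b \<in> box {i, j} {} \<longleftrightarrow> {a, b} \<subseteq> {0, 2}"
  "i \<noteq> j \<Longrightarrow> vec2 i j a b \<in> box {i} {} \<longleftrightarrow> a \<in> {0, 2} \<and> b = 0"
  "i \<noteq> j \<Longrightarrow> vec2 i j a b \<in> box {j} {} \<longleftrightarrow> a = 0 \<and> b \<in> {0, 2}"
  "i \<noteq> j \<Longrightarrow> vec2 i j a b \<in> box {i} {j} \<longleftrightarrow> a \<in> {0, 2}"
  "i \<noteq> j \<Longrightarrow> vec2 i j a b \<in> box {j} {i} \<longleftrightarrow> b \<in> {0, 2}"
  "i \<noteq> j \<Longrightarrow> vec2 i j a b \<in> box {} {i} \<longleftrightarrow> b = 0"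
  "i \<noteq> j \<Longrightarrow> vec2 i j a b \<in> box {} {i, j}"
  unfolding vec2_def box_def by (auto split: if_splits)

lemma vec2_single:
  "i \<noteq> j \<Longrightarrow> 0(i := a) = vec2 i j a 0"
  "i \<noteq> j \<Longrightarrow> 0(j := a) = vec2 i j 0 a"
  by (auto simp: vec2_def fun_eq_iff)

text \<open>The fixed set contains one element of each of the two pairs of order 4, so only the
  three involutions 22, 02, 20 move. The differences along this chain are 20 and 22, and
  \<open>N\<close> grows up to the subgroup of all elements of order at most 2. Exponent 3 is out of
  reach, as all elements of order 4 lie in one coset of that subgroup.\<close>

lemma shufflable_1_1:
  assumes d: "i \<noteq> j" and k: "k \<le> 2"
  shows "shufflable {i} {j} k"
proof -
  let ?v = "vec2 i j" and ?B = "box {i} {j}"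
  let ?F = "{0, ?v 0 1, ?v 2 1}" and ?W = "{?v 0 2, ?v 2 0}"
  let ?N1 = "box {i} {}" and ?N2 = "box {i, j} {}"
  note calc = vec2_eq_iff[OF d] vec2_eq_0_iff[OF d] vec2_in_box[OF d] vec2_diff vec2_minus
    vec2_zero add_subgroup_zero[OF add_subgroup_box] eq_commute[of 0 "?v _ _"]
  note sub = add_subgroup_box
  have "?v 2 1 \<in> group_closure ?F" "?v 0 1 \<in> group_closure ?F"
    by (auto intro!: group_closure.base)
  moreover have "?v 2 1 - ?v 0 1 = ?v 2 0" by (simp add: calc)
  ultimately have "?v 2 0 \<in> group_closure ?F" by (metis group_closure.diff)
  then have span: "?B \<subseteq> group_closure ?F"
    by (intro box_subset_closure) (auto simp: vec2_single[OF d] intro: group_closure.base)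
  have z0: "add_subgroup {0 :: 'a \<Rightarrow> 4}" by (simp add: add_subgroup_def)
  have c: "card ?N1 = 2 ^ 1" "card ?N2 = 2 ^ 2"
    using d by (simp_all add: card_box)
  have le: "?N1 \<subseteq> ?B" "?N2 \<subseteq> ?B" "?N1 \<subseteq> ?N2" by (auto simp: box_def)
  have s0: "stage ?B ?F {0} id (?v 2 2) ?W"
    by (rule stage_id) (use span in \<open>simp_all add: calc\<close>)
  obtain \<sigma>1 where s1: "stage ?B ?F ?N1 \<sigma>1 (?v 0 2) (?W - {?v 2 2, - ?v 2 2, ?v 0 2, - ?v 0 2})"
  proof (rule stage_swap[OF s0 sub z0])
    show "?N1 \<subseteq> group_closure (insert (?v 0 2 - ?v 2 2) {0})"
      by (rule box_subset_closure) (auto simp: calc vec2_single[OF d] intro!: group_closure.base)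
  qed (use sub in \<open>simp_all add: calc\<close>)
  obtain \<sigma>2 where s2: "stage ?B ?F ?N2 \<sigma>2 (?v 2 0) (?W - {?v 2 2, - ?v 2 2, ?v 0 2, - ?v 0 2}
      - {?v 0 2, - ?v 0 2, ?v 2 0, - ?v 2 0})"
  proof (rule stage_swap[OF s1 sub sub])
    let ?S = "insert (?v 2 0 - ?v 0 2) ?N1"
    have "?v 2 0 - ?v 0 2 \<in> group_closure ?S" and S: "?v 2 0 \<in> group_closure ?S"
      by (auto intro!: group_closure.base simp: calc)
    moreover have "?v 2 0 - ?v 0 2 - ?v 2 0 = ?v 0 2" by (simp add: calc)
    ultimately have "?v 0 2 \<in> group_closure ?S" by (metis group_closure.diff)
    then show "?N2 \<subseteq> group_closure ?S"
      using S by (intro box_subset_closure) (auto simp: vec2_single[OF d])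
  qed (use sub le in \<open>simp_all add: calc\<close>)
  have "k = 0 \<or> k = 1 \<or> k = 2" using k by auto
  then show ?thesis
    using stage_shufflable[OF s0 z0, of 0] stage_shufflable[OF s1 sub _ c(1)]
      stage_shufflable[OF s2 sub _ c(2)] le
    by (auto simp: add_subgroup_zero[OF sub])
qed

text \<open>Of the six pairs of order 4, two meet \<open>F\<close>; the other four form the chain
  01, 11, 13, 12 with differences 10, 02 and -01, which bring the order of \<open>N\<close> to 4, 8
  and 16. Choosing 21 rather than 01 for \<open>F\<close> leaves 01 free and still generates,
  because 21 - 2 * 10 = 01. Every end point recorded for the result has order 4, as
  \<open>shufflable\<close> demands here.\<close>

lemma shufflable_0_2:
  assumes d: "i \<noteq> j" and k: "k \<le> 4"
  shows "shufflable {} {i, j} k"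
proof -
  let ?v = "vec2 i j" and ?B = "box {} {i, j}"
  let ?F = "{0, ?v 1 0, ?v 2 1}"
  note calc = vec2_eq_iff[OF d] vec2_eq_0_iff[OF d] vec2_in_box[OF d] vec2_diff vec2_minus
    vec2_zero add_subgroup_zero[OF add_subgroup_box] eq_commute[of 0 "?v _ _"]
  note sub = add_subgroup_box
  have "?v 2 1 \<in> group_closure ?F" and 1: "?v 1 0 \<in> group_closure ?F"
    by (auto intro!: group_closure.base)
  moreover have "?v 2 1 - ?v 1 0 - ?v 1 0 = ?v 0 1" by (simp add: calc)
  ultimately have "?v 0 1 \<in> group_closure ?F" by (metis group_closure.diff)
  then have span: "?B \<subseteq> group_closure ?F"
    using 1 by (intro box_subset_closure) (auto simp: vec2_single[OF d])
  have z0: "add_subgroup {0 :: 'a \<Rightarrow> 4}" by (simp add: add_subgroup_def)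
  have c: "card (box {j} {}) = 2 ^ 1" "card (box {} {i}) = 2 ^ 2" "card (box {j} {i}) = 2 ^ 3"
      "card ?B = 2 ^ 4"
    using d by (simp_all add: card_box)
  have le: "box {j} {} \<subseteq> ?B" "box {} {i} \<subseteq> ?B" "box {j} {i} \<subseteq> ?B" "box {} {i} \<subseteq> box {j} {i}"
    using d by (auto simp: box_def)
  have ord: "?v 1 1 + ?v 1 1 \<noteq> 0" "?v 1 3 + ?v 1 3 \<noteq> 0" "?v 1 2 + ?v 1 2 \<noteq> 0"
    by (auto simp: vec2_def fun_eq_iff d intro!: exI[of _ i])
  \<comment> \<open>Order 2 is skipped by the long chain, whose first difference has order 4. It is
    obtained from the single swap of 11 and 13, whose difference is 02.\<close>
  have t0: "stage ?B ?F {0} id (?v 1 1) {?v 1 3}"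
    by (rule stage_id) (use span in \<open>simp_all add: calc\<close>)
  obtain \<tau>1 where t1: "stage ?B ?F (box {j} {}) \<tau>1 (?v 1 3)
      ({?v 1 3} - {?v 1 1, - ?v 1 1, ?v 1 3, - ?v 1 3})"
  proof (rule stage_swap[OF t0 sub z0])
    show "box {j} {} \<subseteq> group_closure (insert (?v 1 3 - ?v 1 1) {0})"
      by (rule box_subset_closure) (auto simp: calc vec2_single[OF d] intro!: group_closure.base)
  qed (use sub in \<open>simp_all add: calc\<close>)
  let ?W = "{?v 1 1, ?v 1 3, ?v 1 2}"
  have s0: "stage ?B ?F {0} id (?v 0 1) ?W"
    by (rule stage_id) (use span in \<open>simp_all add: calc\<close>)
  obtain \<sigma>1 where s1: "stage ?B ?F (box {} {i}) \<sigma>1 (?v 1 1)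
      (?W - {?v 0 1, - ?v 0 1, ?v 1 1, - ?v 1 1})"
  proof (rule stage_swap[OF s0 sub z0])
    show "box {} {i} \<subseteq> group_closure (insert (?v 1 1 - ?v 0 1) {0})"
      by (rule box_subset_closure) (auto simp: calc vec2_single[OF d] intro!: group_closure.base)
  qed (use sub in \<open>simp_all add: calc\<close>)
  obtain \<sigma>2 where s2: "stage ?B ?F (box {j} {i}) \<sigma>2 (?v 1 3)
      (?W - {?v 0 1, - ?v 0 1, ?v 1 1, - ?v 1 1} - {?v 1 1, - ?v 1 1, ?v 1 3, - ?v 1 3})"
  proof (rule stage_swap[OF s1 sub sub])
    show "box {j} {i} \<subseteq> group_closure (insert (?v 1 3 - ?v 1 1) (box {} {i}))"
      by (rule box_subset_closure) (auto simp: calc vec2_single[OF d] intro!: group_closure.base)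
  qed (use sub le in \<open>simp_all add: calc\<close>)
  obtain \<sigma>3 where s3: "stage ?B ?F ?B \<sigma>3 (?v 1 2)
      (?W - {?v 0 1, - ?v 0 1, ?v 1 1, - ?v 1 1} - {?v 1 1, - ?v 1 1, ?v 1 3, - ?v 1 3}
       - {?v 1 3, - ?v 1 3, ?v 1 2, - ?v 1 2})"
  proof (rule stage_swap[OF s2 sub sub])
    let ?S = "insert (?v 1 2 - ?v 1 3) (box {j} {i})"
    have "?v 1 2 - ?v 1 3 \<in> group_closure ?S" and S: "?v 1 0 \<in> group_closure ?S"
      by (auto intro!: group_closure.base simp: calc)
    then have "- (?v 1 2 - ?v 1 3) \<in> group_closure ?S" by (simp only: group_closure_minus_iff)
    moreover have "- (?v 1 2 - ?v 1 3) = ?v 0 1" by (simp add: calc)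
    ultimately have "?v 0 1 \<in> group_closure ?S" by metis
    then show "?B \<subseteq> group_closure ?S"
      using S by (intro box_subset_closure) (auto simp: vec2_single[OF d])
  qed (use sub le in \<open>simp_all add: calc\<close>)
  have "k = 0 \<or> k = 1 \<or> k = 2 \<or> k = 3 \<or> k = 4" using k by auto
  then show ?thesis
    using stage_shufflable[OF t0 z0, of 0] stage_shufflable[OF t1 sub _ c(1)]
      stage_shufflable[OF s1 sub _ c(2)] stage_shufflable[OF s2 sub _ c(3)]
      stage_shufflable[OF s3 sub _ c(4)] le ord
    by (auto simp: add_subgroup_zero[OF sub])
qed

text \<open>The number of factors Z4 decides which starting group is contained in the box. The
  strict bound for \<open>card J = 1\<close> is inherited from Z2 x Z4, where the full group is
  never reached; adjoining factors Z2 preserves this defect of one.\<close>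

theorem shufflable_box:
  assumes fin: "finite I" "finite J" "I \<inter> J = {}" and size: "card I + 2 * card J \<ge> 3"
    and k: "k \<le> card I + 2 * card J" "card J = 1 \<Longrightarrow> k < card I + 2 * card J"
  shows "shufflable I J k"
proof -
  consider "card J = 0" | "card J = 1" | "card J \<ge> 2" by linarith
  then show ?thesis
  proof cases
    case 1
    then have J: "J = {}" using fin by simp
    obtain I3 where I3: "I3 \<subseteq> I" "card I3 = 3"
      using obtain_subset_with_card_n[of 3 I] size 1 by auto
    then obtain i j l where ijl: "I3 = {i, j, l}" "distinct [i, j, l]"
      by (auto simp: card_3_iff)
    have "card (I - I3) = card I - 3" "(I - I3) \<union> I3 = I"
      using I3 fin by (auto simp: card_Diff_subset finite_subset)
    then show ?thesis
      using shufflable_grow_left[of "I - I3" I3 "{}" 3 k] shufflable_3_0[OF ijl(2)] ijl J fin k size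
      by auto
  next
    case 2
    then obtain j where J: "J = {j}" by (auto simp: card_1_singleton_iff)
    obtain i where i: "i \<in> I" using size 2 by fastforce
    then have ij: "i \<noteq> j" using fin J by auto
    have "card (I - {i}) = card I - 1" "(I - {i}) \<union> {i} = I" "card I \<ge> 1"
      using i fin by (auto simp: Suc_le_eq card_gt_0_iff)
    then show ?thesis
      using shufflable_grow_left[of "I - {i}" "{i}" J 2 k] shufflable_1_1[OF ij] J fin k
      by auto
  next
    case 3
    obtain J2 where J2: "J2 \<subseteq> J" "card J2 = 2"
      using obtain_subset_with_card_n[of 2 J] 3 by auto
    then obtain i j where ij: "J2 = {i, j}" "i \<noteq> j" by (auto simp: card_2_iff)
    have J2': "card (J - J2) = card J - 2" "(J - J2) \<union> J2 = J" "finite J2"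
      using J2 fin by (auto simp: card_Diff_subset finite_subset)
    have *: "shufflable {} J k" if "k \<le> 2 * card J" for k
      using shufflable_grow_right[of "J - J2" "{}" J2 4 k] shufflable_0_2[OF ij(2)] ij J2 J2' 3 fin that
      by auto
    show ?thesis
      using shufflable_grow_left[of I "{}" J "2 * card J" k] * fin k by auto
  qed
qed

section \<open>Duality for additive codes\<close>

text \<open>Order formula of the first isomorphism theorem, from a group of words in multiplicative
  notation to an additive group of syndromes: every nonempty fibre is a translate of the
  kernel.\<close>

lemma card_kernel_image:
  fixes G (structure) and h :: "'a \<Rightarrow> 'b::ab_group_add"
  assumes "group G" and fin: "finite (carrier G)"
    and hom: "\<And>x y. x \<in> carrier G \<Longrightarrow> y \<in> carrier G \<Longrightarrow> h (x \<otimes>\<^bsub>G\<^esub> y) = h x + h y"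
  shows "card (carrier G) = card {x \<in> carrier G. h x = 0} * card (h ` carrier G)"
proof -
  interpret group G by fact
  have "card {x \<in> carrier G. h x = h g} = card {x \<in> carrier G. h x = 0}" if g: "g \<in> carrier G" for g
  proof -
    have "h (inv g) = - h g"
      using hom[of g "inv g"] hom[of \<one> \<one>] g by (simp add: eq_neg_iff_add_eq_0 add.commute)
    then have "bij_betw (\<lambda>x. g \<otimes> x) {x \<in> carrier G. h x = 0} {x \<in> carrier G. h x = h g}"
      using g by (intro bij_betw_byWitness[where f' = "\<lambda>x. inv g \<otimes> x"])
        (auto simp: hom m_assoc[symmetric])
    then show ?thesis by (simp add: bij_betw_same_card)
  qed
  then have "(\<Sum>y\<in>h ` carrier G. card {x \<in> carrier G. h x = y}) =
      (\<Sum>y\<in>h ` carrier G. card {x \<in> carrier G. h x = 0})"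
    by (intro sum.cong) auto
  moreover have "card (carrier G) = (\<Sum>y\<in>h ` carrier G. card {x \<in> carrier G. h x = y})"
    using sum.image_gen[OF fin, of "\<lambda>_. 1 :: nat" h] by simp
  ultimately show ?thesis by (simp add: mult.commute)
qed

definition quartic :: "4 \<Rightarrow> complex" where
  "quartic a = (if a = 0 then 1 else if a = 1 then \<i> else if a = 2 then - 1 else - \<i>)"

lemma quartic_add: "quartic (a + b) = quartic a * quartic b"
  using four_cases[of a] four_cases[of b] by (elim disjE) (simp_all add: quartic_def)

lemma quartic_eq_1_iff: "quartic a = 1 \<longleftrightarrow> a = 0"
  using four_cases[of a] by (auto simp: quartic_def complex_eq_iff)

text \<open>Orthogonality of characters: translation by an element with
  \<open>h g \<noteq> 0\<close> permutes the summands and multiplies the sum by a factor different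
  from 1.\<close>

lemma sum_quartic_hom:
  fixes G (structure) and h :: "'a \<Rightarrow> 4"
  assumes "group G"
    and hom: "\<And>x y. x \<in> carrier G \<Longrightarrow> y \<in> carrier G \<Longrightarrow> h (x \<otimes>\<^bsub>G\<^esub> y) = h x + h y"
  shows "(\<Sum>x\<in>carrier G. quartic (h x)) =
    (if \<forall>x\<in>carrier G. h x = 0 then of_nat (card (carrier G)) else 0)"
proof (cases "\<forall>x\<in>carrier G. h x = 0")
  case True
  then show ?thesis by (simp add: quartic_def)
next
  case False
  interpret group G by fact
  obtain g where g: "g \<in> carrier G" "h g \<noteq> 0" using False by blast
  have "bij_betw (\<lambda>x. g \<otimes> x) (carrier G) (carrier G)"
    using g by (intro bij_betw_byWitness[where f' = "\<lambda>x. inv g \<otimes> x"])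
      (auto simp: m_assoc[symmetric])
  then have "(\<Sum>x\<in>carrier G. quartic (h x)) = (\<Sum>x\<in>carrier G. quartic (h (g \<otimes> x)))"
    by (rule sum.reindex_bij_betw[symmetric])
  also have "\<dots> = quartic (h g) * (\<Sum>x\<in>carrier G. quartic (h x))"
    using g by (simp add: hom quartic_add sum_distrib_left)
  finally have "(\<Sum>x\<in>carrier G. quartic (h x)) * (1 - quartic (h g)) = 0"
    by (simp add: algebra_simps)
  then have "(\<Sum>x\<in>carrier G. quartic (h x)) = 0"
    using g quartic_eq_1_iff[of "h g"] by simp
  then show ?thesis using False by (simp only: if_False)
qed

text \<open>Both sides evaluate the character sum of \<open>quartic (p x y)\<close> over all pairs \<open>(x, y)\<close>.\<close>

lemma card_annihilators:
  fixes p :: "'a \<Rightarrow> 'b \<Rightarrow> 4"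
  assumes X: "group X" "finite (carrier X)" and Y: "group Y" "finite (carrier Y)"
    and homX: "\<And>x x' y. x \<in> carrier X \<Longrightarrow> x' \<in> carrier X \<Longrightarrow> y \<in> carrier Y \<Longrightarrow>
      p (x \<otimes>\<^bsub>X\<^esub> x') y = p x y + p x' y"
    and homY: "\<And>x y y'. x \<in> carrier X \<Longrightarrow> y \<in> carrier Y \<Longrightarrow> y' \<in> carrier Y \<Longrightarrow>
      p x (y \<otimes>\<^bsub>Y\<^esub> y') = p x y + p x y'"
  shows "card (carrier X) * card {y \<in> carrier Y. \<forall>x\<in>carrier X. p x y = 0} =
    card (carrier Y) * card {x \<in> carrier X. \<forall>y\<in>carrier Y. p x y = 0}"
proof -
  have "(\<Sum>y\<in>carrier Y. \<Sum>x\<in>carrier X. quartic (p x y)) =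
      (\<Sum>y\<in>carrier Y. if \<forall>x\<in>carrier X. p x y = 0 then of_nat (card (carrier X)) else 0)"
    by (intro sum.cong refl sum_quartic_hom X homX) auto
  also have "\<dots> = of_nat (card (carrier X) * card {y \<in> carrier Y. \<forall>x\<in>carrier X. p x y = 0})"
    using Y(2) by (simp add: sum.If_cases Int_def mult.commute)
  finally have 1: "(\<Sum>y\<in>carrier Y. \<Sum>x\<in>carrier X. quartic (p x y)) =
      of_nat (card (carrier X) * card {y \<in> carrier Y. \<forall>x\<in>carrier X. p x y = 0})" .
  have "(\<Sum>x\<in>carrier X. \<Sum>y\<in>carrier Y. quartic (p x y)) =
      (\<Sum>x\<in>carrier X. if \<forall>y\<in>carrier Y. p x y = 0 then of_nat (card (carrier Y)) else 0)"
    by (intro sum.cong refl sum_quartic_hom Y homY) auto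
  also have "\<dots> = of_nat (card (carrier Y) * card {x \<in> carrier X. \<forall>y\<in>carrier Y. p x y = 0})"
    using X(2) by (simp add: sum.If_cases Int_def mult.commute)
  finally have 2: "(\<Sum>x\<in>carrier X. \<Sum>y\<in>carrier Y. quartic (p x y)) =
      of_nat (card (carrier Y) * card {x \<in> carrier X. \<forall>y\<in>carrier Y. p x y = 0})" .
  have "(of_nat (card (carrier X) * card {y \<in> carrier Y. \<forall>x\<in>carrier X. p x y = 0}) :: complex) =
      of_nat (card (carrier Y) * card {x \<in> carrier X. \<forall>y\<in>carrier Y. p x y = 0})"
    unfolding 1[symmetric] 2[symmetric] by (rule sum.swap)
  then show ?thesis by (simp only: of_nat_eq_iff)
qed

section \<open>The ambient group and its inner product\<close>

lemma comm_group_additive_space: "comm_group (additive_space \<alpha> \<beta>)"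
proof -
  have "group (additive_space \<alpha> \<beta>)"
    unfolding additive_space_def by (intro DirProd_group product_group group_integer_mod_group)
  then show ?thesis
    by (rule group.group_comm_groupI)
      (auto simp: additive_space_def add.commute)
qed

lemma group_additive_space: "group (additive_space \<alpha> \<beta>)"
  using comm_group_additive_space comm_group_def by blast

lemma carrier_additive_space:
  "carrier (additive_space \<alpha> \<beta>) = ({..<\<alpha>} \<rightarrow>\<^sub>E {0..<2}) \<times> ({..<\<beta>} \<rightarrow>\<^sub>E {0..<4})"
  by (simp add: additive_space_def carrier_integer_mod_group)

lemma finite_additive_space: "finite (carrier (additive_space \<alpha> \<beta>))"
  by (simp add: carrier_additive_space finite_PiE)

lemma card_additive_space: "card (carrier (additive_space \<alpha> \<beta>)) = 2 ^ (\<alpha> + 2 * \<beta>)"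
proof -
  have "(2::nat) ^ (2 * \<beta>) = 4 ^ \<beta>" by (simp add: power_mult)
  then show ?thesis
    by (simp add: carrier_additive_space card_cartesian_product card_PiE power_add)
qed

lemma fst_bounds: "x \<in> carrier (additive_space \<alpha> \<beta>) \<Longrightarrow> i < \<alpha> \<Longrightarrow> 0 \<le> fst x i \<and> fst x i < 2"
  and snd_bounds: "x \<in> carrier (additive_space \<alpha> \<beta>) \<Longrightarrow> j < \<beta> \<Longrightarrow> 0 \<le> snd x j \<and> snd x j < 4"
  by (auto simp: carrier_additive_space PiE_iff)

lemma fst_cases: "x \<in> carrier (additive_space \<alpha> \<beta>) \<Longrightarrow> i < \<alpha> \<Longrightarrow> fst x i = 0 \<or> fst x i = 1"
  using fst_bounds[of x \<alpha> \<beta> i] by auto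

lemma snd_cases: "x \<in> carrier (additive_space \<alpha> \<beta>) \<Longrightarrow> j < \<beta> \<Longrightarrow>
    snd x j = 0 \<or> snd x j = 1 \<or> snd x j = 2 \<or> snd x j = 3"
  using snd_bounds[of x \<alpha> \<beta> j] by auto

lemma word_eqI:
  assumes "x \<in> carrier (additive_space \<alpha> \<beta>)" "y \<in> carrier (additive_space \<alpha> \<beta>)"
    and "\<And>i. i < \<alpha> \<Longrightarrow> fst x i = fst y i" "\<And>j. j < \<beta> \<Longrightarrow> snd x j = snd y j"
  shows "x = y"
proof (rule prod_eqI)
  show "fst x = fst y"
    by (rule PiE_ext[of _ "{..<\<alpha>}" "\<lambda>_. {0..<2}"]) (use assms in \<open>auto simp: carrier_additive_space\<close>)
  show "snd x = snd y"
    by (rule PiE_ext[of _ "{..<\<beta>}" "\<lambda>_. {0..<4}"]) (use assms in \<open>auto simp: carrier_additive_space\<close>)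
qed

lemma word_mult:
  "i < \<alpha> \<Longrightarrow> fst (x \<otimes>\<^bsub>additive_space \<alpha> \<beta>\<^esub> y) i = (fst x i + fst y i) mod 2"
  "j < \<beta> \<Longrightarrow> snd (x \<otimes>\<^bsub>additive_space \<alpha> \<beta>\<^esub> y) j = (snd x j + snd y j) mod 4"
  by (simp_all add: additive_space_def mult_DirProd')

lemma word_one:
  "i < \<alpha> \<Longrightarrow> fst \<one>\<^bsub>additive_space \<alpha> \<beta>\<^esub> i = 0"
  "j < \<beta> \<Longrightarrow> snd \<one>\<^bsub>additive_space \<alpha> \<beta>\<^esub> j = 0"
  by (simp_all add: additive_space_def)

lemma word_inv:
  assumes "x \<in> carrier (additive_space \<alpha> \<beta>)"
  shows "i < \<alpha> \<Longrightarrow> fst (inv\<^bsub>additive_space \<alpha> \<beta>\<^esub> x) i = fst x i"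
    and "j < \<beta> \<Longrightarrow> snd (inv\<^bsub>additive_space \<alpha> \<beta>\<^esub> x) j = (- snd x j) mod 4"
proof -
  interpret group "additive_space \<alpha> \<beta>" by (rule group_additive_space)
  have inv: "inv\<^bsub>additive_space \<alpha> \<beta>\<^esub> x \<in> carrier (additive_space \<alpha> \<beta>)"
    and 1: "x \<otimes>\<^bsub>additive_space \<alpha> \<beta>\<^esub> inv\<^bsub>additive_space \<alpha> \<beta>\<^esub> x = \<one>\<^bsub>additive_space \<alpha> \<beta>\<^esub>"
    using assms by simp_all
  show "fst (inv\<^bsub>additive_space \<alpha> \<beta>\<^esub> x) i = fst x i" if "i < \<alpha>"
    using word_mult(1)[OF that, of \<beta> x "inv\<^bsub>additive_space \<alpha> \<beta>\<^esub> x"] fst_cases[OF assms that]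
      fst_cases[OF inv that] word_one(1)[OF that, of \<beta>] unfolding 1 by auto
  show "snd (inv\<^bsub>additive_space \<alpha> \<beta>\<^esub> x) j = (- snd x j) mod 4" if "j < \<beta>"
    using word_mult(2)[OF that, of \<alpha> x "inv\<^bsub>additive_space \<alpha> \<beta>\<^esub> x"] snd_cases[OF assms that]
      snd_cases[OF inv that] word_one(2)[OF that, of \<alpha>] unfolding 1 by auto
qed

text \<open>Common shape of the inner product, the syndrome and the characters of a box: coordinates
  act as integer scalars on labels attached to the positions.\<close>

definition linear_word :: "nat \<Rightarrow> nat \<Rightarrow> (nat \<Rightarrow> 'a::comm_ring_1) \<Rightarrow> (nat \<Rightarrow> 'a) \<Rightarrow>
    (nat \<Rightarrow> int) \<times> (nat \<Rightarrow> int) \<Rightarrow> 'a" where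
  "linear_word \<alpha> \<beta> g h x = (\<Sum>i<\<alpha>. of_int (fst x i) * g i) + (\<Sum>j<\<beta>. of_int (snd x j) * h j)"

text \<open>The coordinates are added modulo 2 and modulo 4. The first reduction is harmless because
  2 kills the labels \<open>g i\<close>, the second because 4 vanishes in the ring.\<close>

lemma linear_word_mult:
  fixes g h :: "nat \<Rightarrow> 'a::comm_ring_1"
  assumes four: "(4 :: 'a) = 0" and g: "\<And>i. i < \<alpha> \<Longrightarrow> 2 * g i = 0"
  shows "linear_word \<alpha> \<beta> g h (x \<otimes>\<^bsub>additive_space \<alpha> \<beta>\<^esub> y) =
    linear_word \<alpha> \<beta> g h x + linear_word \<alpha> \<beta> g h y"
proof -
  have 2: "of_int (k mod 2) * v = of_int k * v" if "2 * v = 0" for k and v :: 'a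
  proof -
    have "of_int k * v = of_int (2 * (k div 2) + k mod 2) * v" by simp
    also have "\<dots> = of_int (k div 2) * (2 * v) + of_int (k mod 2) * v"
      by (simp only: of_int_add of_int_mult) (simp add: algebra_simps)
    finally show ?thesis using that by simp
  qed
  have 4: "of_int (k mod 4) = (of_int k :: 'a)" for k
  proof -
    have "of_int k = (of_int (4 * (k div 4) + k mod 4) :: 'a)" by simp
    also have "\<dots> = of_int (k mod 4)" by (simp only: of_int_add of_int_mult) (simp add: four)
    finally show ?thesis by simp
  qed
  show ?thesis
    by (simp add: linear_word_def word_mult 2 4 g distrib_right sum.distrib)
qed

lemma four_eq_0: "(4 :: 4) = 0"
  by simp

definition inner4 :: "nat \<Rightarrow> nat \<Rightarrow> (nat \<Rightarrow> int) \<times> (nat \<Rightarrow> int) \<Rightarrow> (nat \<Rightarrow> int) \<times> (nat \<Rightarrow> int) \<Rightarrow> 4" where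
  "inner4 \<alpha> \<beta> u v = linear_word \<alpha> \<beta> (\<lambda>i. 2 * of_int (fst u i)) (\<lambda>j. of_int (snd u j)) v"

lemma inner4_eq_0_iff: "inner4 \<alpha> \<beta> u v = 0 \<longleftrightarrow> additive_inner \<alpha> \<beta> u v = 0"
proof -
  have "inner4 \<alpha> \<beta> u v = of_int (2 * (\<Sum>i<\<alpha>. fst u i * fst v i) + (\<Sum>j<\<beta>. snd u j * snd v j))"
    by (simp add: inner4_def linear_word_def sum_distrib_left mult_ac)
  then show ?thesis by (simp only: four_of_int_eq_0_iff additive_inner_def)
qed

lemma inner4_commute: "inner4 \<alpha> \<beta> u v = inner4 \<alpha> \<beta> v u"
  by (simp add: inner4_def linear_word_def mult_ac)

lemma inner4_mult_right:
  "inner4 \<alpha> \<beta> u (x \<otimes>\<^bsub>additive_space \<alpha> \<beta>\<^esub> y) = inner4 \<alpha> \<beta> u x + inner4 \<alpha> \<beta> u y"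
  unfolding inner4_def by (rule linear_word_mult) (simp_all add: four_eq_0)

lemma inner4_mult_left:
  "inner4 \<alpha> \<beta> (x \<otimes>\<^bsub>additive_space \<alpha> \<beta>\<^esub> y) u = inner4 \<alpha> \<beta> x u + inner4 \<alpha> \<beta> y u"
  by (simp add: inner4_commute[of _ _ _ u] inner4_mult_right)

lemma additive_dual_eq:
  "additive_dual \<alpha> \<beta> C = {u \<in> carrier (additive_space \<alpha> \<beta>). \<forall>v\<in>C. inner4 \<alpha> \<beta> u v = 0}"
  by (simp add: additive_dual_def inner4_eq_0_iff)

definition bit_word :: "nat \<Rightarrow> nat \<Rightarrow> nat \<Rightarrow> (nat \<Rightarrow> int) \<times> (nat \<Rightarrow> int)" where
  "bit_word \<alpha> \<beta> i = ((\<lambda>k\<in>{..<\<alpha>}. if k = i then 1 else 0), (\<lambda>k\<in>{..<\<beta>}. 0))"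

definition quat_word :: "nat \<Rightarrow> nat \<Rightarrow> nat \<Rightarrow> int \<Rightarrow> (nat \<Rightarrow> int) \<times> (nat \<Rightarrow> int)" where
  "quat_word \<alpha> \<beta> j c = ((\<lambda>k\<in>{..<\<alpha>}. 0), (\<lambda>k\<in>{..<\<beta>}. if k = j then c else 0))"

lemma bit_word_carrier: "bit_word \<alpha> \<beta> i \<in> carrier (additive_space \<alpha> \<beta>)"
  by (auto simp: bit_word_def carrier_additive_space)

lemma quat_word_carrier: "0 \<le> c \<Longrightarrow> c < 4 \<Longrightarrow> quat_word \<alpha> \<beta> j c \<in> carrier (additive_space \<alpha> \<beta>)"
  by (auto simp: quat_word_def carrier_additive_space)

lemma linear_word_bit_word: "i < \<alpha> \<Longrightarrow> linear_word \<alpha> \<beta> g h (bit_word \<alpha> \<beta> i) = g i"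
  by (simp add: linear_word_def bit_word_def if_distrib[of of_int] if_distrib[of "\<lambda>c. c * _"] cong: if_cong)

lemma linear_word_quat_word: "j < \<beta> \<Longrightarrow> linear_word \<alpha> \<beta> g h (quat_word \<alpha> \<beta> j c) = of_int c * h j"
  by (simp add: linear_word_def quat_word_def if_distrib[of of_int] if_distrib[of "\<lambda>c. c * _"] cong: if_cong)

lemma inner4_nondegenerate:
  assumes x: "x \<in> carrier (additive_space \<alpha> \<beta>)"
    and 0: "\<And>y. y \<in> carrier (additive_space \<alpha> \<beta>) \<Longrightarrow> inner4 \<alpha> \<beta> x y = 0"
  shows "x = \<one>\<^bsub>additive_space \<alpha> \<beta>\<^esub>"
proof (rule word_eqI[OF x])
  show "\<one>\<^bsub>additive_space \<alpha> \<beta>\<^esub> \<in> carrier (additive_space \<alpha> \<beta>)"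
    using group.is_monoid[OF group_additive_space] by (rule monoid.one_closed)
  show "fst x i = fst \<one>\<^bsub>additive_space \<alpha> \<beta>\<^esub> i" if "i < \<alpha>" for i
    using 0[OF bit_word_carrier[of \<alpha> \<beta> i]] fst_cases[OF x that] that
    by (auto simp: inner4_def linear_word_bit_word word_one)
  show "snd x j = snd \<one>\<^bsub>additive_space \<alpha> \<beta>\<^esub> j" if "j < \<beta>" for j
    using 0[OF quat_word_carrier[of 1 \<alpha> \<beta> j]] snd_cases[OF x that] that
    by (auto simp: inner4_def linear_word_quat_word word_one)
qed

text \<open>Counting annihilators for the pairing of \<open>C\<close> with the whole space: one
  annihilator is the dual, and nondegeneracy makes the other one trivial.\<close>

lemma card_additive_dual:
  assumes C: "subgroup C (additive_space \<alpha> \<beta>)"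
  shows "card C * card (additive_dual \<alpha> \<beta> C) = 2 ^ (\<alpha> + 2 * \<beta>)"
proof -
  let ?G = "additive_space \<alpha> \<beta>"
  have sub: "C \<subseteq> carrier ?G" "\<one>\<^bsub>?G\<^esub> \<in> C" using C by (auto simp: subgroup_def)
  have grp: "group (?G\<lparr>carrier := C\<rparr>)"
    using C group_additive_space by (rule subgroup.subgroup_is_group)
  have "card (carrier (?G\<lparr>carrier := C\<rparr>)) *
      card {y \<in> carrier ?G. \<forall>x\<in>carrier (?G\<lparr>carrier := C\<rparr>). inner4 \<alpha> \<beta> x y = 0} =
      card (carrier ?G) *
      card {x \<in> carrier (?G\<lparr>carrier := C\<rparr>). \<forall>y\<in>carrier ?G. inner4 \<alpha> \<beta> x y = 0}"
    using sub finite_subset[OF _ finite_additive_space]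
    by (intro card_annihilators grp group_additive_space finite_additive_space)
      (auto simp: inner4_mult_left inner4_mult_right)
  moreover have "{x \<in> C. \<forall>y\<in>carrier ?G. inner4 \<alpha> \<beta> x y = 0} = {\<one>\<^bsub>?G\<^esub>}"
    using sub inner4_nondegenerate[of _ \<alpha> \<beta>]
    by (auto simp: inner4_def linear_word_def word_one)
  moreover have "{y \<in> carrier ?G. \<forall>x\<in>C. inner4 \<alpha> \<beta> x y = 0} = additive_dual \<alpha> \<beta> C"
    by (simp add: additive_dual_eq inner4_commute)
  ultimately show ?thesis by (simp add: card_additive_space)
qed

lemma inner4_one: "inner4 \<alpha> \<beta> \<one>\<^bsub>additive_space \<alpha> \<beta>\<^esub> x = 0"
  by (simp add: inner4_def linear_word_def word_one)

lemma subgroup_additive_dual: "subgroup (additive_dual \<alpha> \<beta> C) (additive_space \<alpha> \<beta>)"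
proof -
  interpret group "additive_space \<alpha> \<beta>" by (rule group_additive_space)
  show ?thesis
  proof (rule subgroupI)
    show "additive_dual \<alpha> \<beta> C \<subseteq> carrier (additive_space \<alpha> \<beta>)"
      by (auto simp: additive_dual_eq)
    have "\<one>\<^bsub>additive_space \<alpha> \<beta>\<^esub> \<in> additive_dual \<alpha> \<beta> C"
      by (simp add: additive_dual_eq inner4_one)
    then show "additive_dual \<alpha> \<beta> C \<noteq> {}" by blast
    fix x assume x: "x \<in> additive_dual \<alpha> \<beta> C"
    have "inner4 \<alpha> \<beta> x v + inner4 \<alpha> \<beta> (inv\<^bsub>additive_space \<alpha> \<beta>\<^esub> x) v = 0" for v
      using x by (simp add: additive_dual_eq flip: inner4_mult_left) (simp add: inner4_one)
    then show "inv\<^bsub>additive_space \<alpha> \<beta>\<^esub> x \<in> additive_dual \<alpha> \<beta> C"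
      using x by (simp add: additive_dual_eq) (metis add_0)
    fix y assume "y \<in> additive_dual \<alpha> \<beta> C"
    then show "x \<otimes>\<^bsub>additive_space \<alpha> \<beta>\<^esub> y \<in> additive_dual \<alpha> \<beta> C"
      using x by (simp add: additive_dual_eq inner4_mult_left)
  qed
qed

text \<open>One inclusion is symmetry of the pairing; applying the order formula to \<open>C\<close>
  and to its dual shows that it is an equality.\<close>

lemma additive_dual_dual:
  assumes C: "subgroup C (additive_space \<alpha> \<beta>)"
  shows "additive_dual \<alpha> \<beta> (additive_dual \<alpha> \<beta> C) = C"
proof -
  let ?D = "additive_dual \<alpha> \<beta> C"
  have "C \<subseteq> carrier (additive_space \<alpha> \<beta>)" using C by (rule subgroup.subset)
  then have sub: "C \<subseteq> additive_dual \<alpha> \<beta> ?D"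
    by (auto simp: additive_dual_eq) (metis inner4_commute)
  have "card C * card ?D = card ?D * card (additive_dual \<alpha> \<beta> ?D)"
    using card_additive_dual[OF C] card_additive_dual[OF subgroup_additive_dual] by metis
  moreover have "card ?D \<noteq> 0"
    using card_additive_dual[OF C] by (metis mult_0_right power_not_zero zero_neq_numeral)
  ultimately have "card C = card (additive_dual \<alpha> \<beta> ?D)" by simp
  moreover have "finite (additive_dual \<alpha> \<beta> ?D)"
    using finite_additive_space by (rule finite_subset[rotated]) (auto simp: additive_dual_def)
  ultimately show ?thesis using card_subset_eq[OF _ sub] by simp
qed

section \<open>Lee weight and the Gray map\<close>

text \<open>The Hamming weight of the Gray image of one coordinate. On the values 0 and 1 it is the
  bit itself, so one function serves both kinds of coordinate.\<close>

definition lee :: "int \<Rightarrow> nat" where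
  "lee c = (if c = 0 then 0 else if c = 2 then 2 else 1)"

definition lee_weight :: "nat \<Rightarrow> nat \<Rightarrow> (nat \<Rightarrow> int) \<times> (nat \<Rightarrow> int) \<Rightarrow> nat" where
  "lee_weight \<alpha> \<beta> x = (\<Sum>i<\<alpha>. lee (fst x i)) + (\<Sum>j<\<beta>. lee (snd x j))"

lemma lee_simps [simp]: "lee 0 = 0" "lee 1 = 1" "lee 2 = 2" "lee 3 = 1"
  by (simp_all add: lee_def)

lemma sum_lessThan_add_double:
  fixes f :: "nat \<Rightarrow> 'a::comm_monoid_add"
  shows "sum f {..<a + 2 * b} = sum f {..<a} + (\<Sum>j<b. f (a + 2 * j) + f (a + 2 * j + 1))"
  by (induction b) (simp_all add: add.assoc)

text \<open>The Gray map is an isometry: the four bit pairs lie on a square in cyclic order, so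
  residues differing by 1 or 3 get pairs at distance 1 and residues differing by 2 get pairs at
  distance 2.\<close>

lemma hamming_dist_gray_map:
  assumes x: "x \<in> carrier (additive_space \<alpha> \<beta>)" and y: "y \<in> carrier (additive_space \<alpha> \<beta>)"
  shows "hamming_dist (\<alpha> + 2 * \<beta>) (gray_map \<alpha> \<beta> x) (gray_map \<alpha> \<beta> y) =
    lee_weight \<alpha> \<beta> (x \<otimes>\<^bsub>additive_space \<alpha> \<beta>\<^esub> inv\<^bsub>additive_space \<alpha> \<beta>\<^esub> y)"
proof -
  let ?d = "\<lambda>k. if gray_map \<alpha> \<beta> x k \<noteq> gray_map \<alpha> \<beta> y k then 1 else 0 :: nat"
  have "hamming_dist (\<alpha> + 2 * \<beta>) (gray_map \<alpha> \<beta> x) (gray_map \<alpha> \<beta> y) = sum ?d {..<\<alpha> + 2 * \<beta>}"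
    unfolding hamming_dist_def by (simp add: sum.If_cases Int_def)
  also have "\<dots> = sum ?d {..<\<alpha>} + (\<Sum>j<\<beta>. ?d (\<alpha> + 2 * j) + ?d (\<alpha> + 2 * j + 1))"
    by (rule sum_lessThan_add_double)
  also have "sum ?d {..<\<alpha>} = (\<Sum>i<\<alpha>. lee ((fst x i + fst y i) mod 2))"
  proof (rule sum.cong)
    fix i assume "i \<in> {..<\<alpha>}"
    then show "?d i = lee ((fst x i + fst y i) mod 2)"
      using fst_cases[OF x, of i] fst_cases[OF y, of i] by (auto simp: gray_map_def lee_def)
  qed simp
  also have "(\<Sum>j<\<beta>. ?d (\<alpha> + 2 * j) + ?d (\<alpha> + 2 * j + 1)) = (\<Sum>j<\<beta>. lee ((snd x j + (- snd y j) mod 4) mod 4))"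
  proof (rule sum.cong)
    fix j assume "j \<in> {..<\<beta>}"
    then have j: "j < \<beta>" by simp
    then have "gray_map \<alpha> \<beta> z (\<alpha> + 2 * j) = fst (gray4 (snd z j))"
      "gray_map \<alpha> \<beta> z (\<alpha> + 2 * j + 1) = snd (gray4 (snd z j))" for z
      by (auto simp: gray_map_def)
    then show "?d (\<alpha> + 2 * j) + ?d (\<alpha> + 2 * j + 1) = lee ((snd x j + (- snd y j) mod 4) mod 4)"
      using snd_cases[OF x j] snd_cases[OF y j]
      by (elim disjE) (auto simp: gray4_def)
  qed simp
  finally show ?thesis
    by (simp add: lee_weight_def word_mult word_inv[OF y] cong: sum.cong_simp)
qed

lemma lee_weight_eq_0_iff:
  assumes "x \<in> carrier (additive_space \<alpha> \<beta>)"
  shows "lee_weight \<alpha> \<beta> x = 0 \<longleftrightarrow> x = \<one>\<^bsub>additive_space \<alpha> \<beta>\<^esub>"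
proof
  interpret group "additive_space \<alpha> \<beta>" by (rule group_additive_space)
  assume "lee_weight \<alpha> \<beta> x = 0"
  then show "x = \<one>\<^bsub>additive_space \<alpha> \<beta>\<^esub>"
    by (intro word_eqI[OF assms]) (auto simp: lee_weight_def word_one lee_def split: if_splits)
qed (simp add: lee_weight_def lee_def word_one)

lemma gray_map_inj: "inj_on (gray_map \<alpha> \<beta>) (carrier (additive_space \<alpha> \<beta>))"
proof (rule inj_onI)
  interpret group "additive_space \<alpha> \<beta>" by (rule group_additive_space)
  fix x y assume x: "x \<in> carrier (additive_space \<alpha> \<beta>)" and y: "y \<in> carrier (additive_space \<alpha> \<beta>)"
    and eq: "gray_map \<alpha> \<beta> x = gray_map \<alpha> \<beta> y"
  have "lee_weight \<alpha> \<beta> (x \<otimes>\<^bsub>additive_space \<alpha> \<beta>\<^esub> inv\<^bsub>additive_space \<alpha> \<beta>\<^esub> y) = 0"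
    using hamming_dist_gray_map[OF x y] by (simp add: eq hamming_dist_def)
  then have "x \<otimes>\<^bsub>additive_space \<alpha> \<beta>\<^esub> inv\<^bsub>additive_space \<alpha> \<beta>\<^esub> y = \<one>\<^bsub>additive_space \<alpha> \<beta>\<^esub>"
    using x y by (simp add: lee_weight_eq_0_iff)
  then show "x = y" using x y by (metis inv_equality inv_inv inv_closed)
qed

text \<open>The Gray image is usually not linear, but the isometry turns a distance between two
  codewords into the weight of their quotient, which is again a codeword. From here on only weights
  in the group matter.\<close>

lemma extended_perfect_gray_iff:
  assumes C: "subgroup C (additive_space \<alpha> \<beta>)"
  shows "extended_perfect_parameters (\<alpha> + 2 * \<beta>) (gray_map \<alpha> \<beta> ` C) \<longleftrightarrow>
    (\<exists>t. \<alpha> + 2 * \<beta> = 2 ^ t \<and> card C = 2 ^ (2 ^ t - t - 1) \<and>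
      Min (lee_weight \<alpha> \<beta> ` (C - {\<one>\<^bsub>additive_space \<alpha> \<beta>\<^esub>})) = 4)"
proof -
  interpret group "additive_space \<alpha> \<beta>" by (rule group_additive_space)
  interpret C: subgroup C "additive_space \<alpha> \<beta>" by (rule C)
  let ?d = "\<lambda>x y. hamming_dist (\<alpha> + 2 * \<beta>) (gray_map \<alpha> \<beta> x) (gray_map \<alpha> \<beta> y)"
  have inj: "inj_on (gray_map \<alpha> \<beta>) C"
    using gray_map_inj C.subset by (rule inj_on_subset)
  have "{hamming_dist (\<alpha> + 2 * \<beta>) x y | x y. x \<in> gray_map \<alpha> \<beta> ` C \<and> y \<in> gray_map \<alpha> \<beta> ` C \<and> x \<noteq> y}
      = {?d x y | x y. x \<in> C \<and> y \<in> C \<and> x \<noteq> y}"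
    using inj by (auto simp: inj_on_def)
  also have "\<dots> = lee_weight \<alpha> \<beta> ` (C - {\<one>\<^bsub>additive_space \<alpha> \<beta>\<^esub>})"
  proof (intro equalityI subsetI)
    fix n assume "n \<in> {?d x y | x y. x \<in> C \<and> y \<in> C \<and> x \<noteq> y}"
    then obtain x y where xy: "x \<in> C" "y \<in> C" "x \<noteq> y" and n: "n = ?d x y" by blast
    let ?z = "x \<otimes>\<^bsub>additive_space \<alpha> \<beta>\<^esub> inv\<^bsub>additive_space \<alpha> \<beta>\<^esub> y"
    have "?z \<noteq> \<one>\<^bsub>additive_space \<alpha> \<beta>\<^esub>"
      using xy by (metis C.mem_carrier inv_equality inv_inv inv_closed)
    then show "n \<in> lee_weight \<alpha> \<beta> ` (C - {\<one>\<^bsub>additive_space \<alpha> \<beta>\<^esub>})"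
      using xy n by (simp add: hamming_dist_gray_map)
  next
    fix n assume "n \<in> lee_weight \<alpha> \<beta> ` (C - {\<one>\<^bsub>additive_space \<alpha> \<beta>\<^esub>})"
    then obtain x where x: "x \<in> C" "x \<noteq> \<one>\<^bsub>additive_space \<alpha> \<beta>\<^esub>" "n = lee_weight \<alpha> \<beta> x" by blast
    then have "n = ?d x \<one>\<^bsub>additive_space \<alpha> \<beta>\<^esub>" by (simp add: hamming_dist_gray_map)
    then show "n \<in> {?d x y | x y. x \<in> C \<and> y \<in> C \<and> x \<noteq> y}" using x C.one_closed by blast
  qed
  finally show ?thesis
    by (simp add: extended_perfect_parameters_def min_dist_def card_image[OF inj])
qed

lemma lee_weight_mult_le:
  assumes x: "x \<in> carrier (additive_space \<alpha> \<beta>)" and y: "y \<in> carrier (additive_space \<alpha> \<beta>)"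
  shows "lee_weight \<alpha> \<beta> (x \<otimes>\<^bsub>additive_space \<alpha> \<beta>\<^esub> y) \<le> lee_weight \<alpha> \<beta> x + lee_weight \<alpha> \<beta> y"
proof -
  have "(\<Sum>i<\<alpha>. lee ((fst x i + fst y i) mod 2)) \<le> (\<Sum>i<\<alpha>. lee (fst x i) + lee (fst y i))"
  proof (rule sum_mono)
    fix i assume "i \<in> {..<\<alpha>}"
    then show "lee ((fst x i + fst y i) mod 2) \<le> lee (fst x i) + lee (fst y i)"
      using fst_cases[OF x, of i] fst_cases[OF y, of i] by (auto simp: lee_def)
  qed
  moreover have "(\<Sum>j<\<beta>. lee ((snd x j + snd y j) mod 4)) \<le> (\<Sum>j<\<beta>. lee (snd x j) + lee (snd y j))"
  proof (rule sum_mono)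
    fix j assume "j \<in> {..<\<beta>}"
    then have j: "j < \<beta>" by simp
    show "lee ((snd x j + snd y j) mod 4) \<le> lee (snd x j) + lee (snd y j)"
      using snd_cases[OF x j] snd_cases[OF y j] by (elim disjE) auto
  qed
  ultimately show ?thesis
    by (simp add: lee_weight_def word_mult sum.distrib cong: sum.cong_simp)
qed

text \<open>Each \<open>lee c\<close> has the parity of \<open>c\<close>. This makes the parity of
  the weight a homomorphism, as reduction modulo 2 or 4 preserves parity.\<close>

lemma even_lee_weight_iff:
  assumes x: "x \<in> carrier (additive_space \<alpha> \<beta>)"
  shows "even (lee_weight \<alpha> \<beta> x) \<longleftrightarrow> even ((\<Sum>i<\<alpha>. fst x i) + (\<Sum>j<\<beta>. snd x j))"
proof -
  have "even (lee (fst x i)) \<longleftrightarrow> even (fst x i)" if "i < \<alpha>" for i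
    using fst_cases[OF x that] by (auto simp: lee_def)
  moreover have "even (lee (snd x j)) \<longleftrightarrow> even (snd x j)" if "j < \<beta>" for j
    using snd_cases[OF x that] by (elim disjE) (auto simp: lee_def)
  moreover have "even (sum f {..<n}) \<longleftrightarrow> even (sum g {..<n})"
    if "\<And>i. i < n \<Longrightarrow> even (f i) \<longleftrightarrow> even (g i)" for f :: "nat \<Rightarrow> nat" and g :: "nat \<Rightarrow> int" and n
    using that by (induction n) auto
  ultimately show ?thesis by (simp add: lee_weight_def)
qed

lemma even_lee_weight_mult:
  assumes x: "x \<in> carrier (additive_space \<alpha> \<beta>)" and y: "y \<in> carrier (additive_space \<alpha> \<beta>)"
  shows "even (lee_weight \<alpha> \<beta> (x \<otimes>\<^bsub>additive_space \<alpha> \<beta>\<^esub> y)) \<longleftrightarrow>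
    even (lee_weight \<alpha> \<beta> x + lee_weight \<alpha> \<beta> y)"
proof -
  interpret group "additive_space \<alpha> \<beta>" by (rule group_additive_space)
  have sum_cong: "even (sum f {..<n}) \<longleftrightarrow> even (sum g {..<n})"
    if "\<And>i. i < n \<Longrightarrow> even (f i) \<longleftrightarrow> even (g i)" for f g :: "nat \<Rightarrow> int" and n
    using that by (induction n) auto
  have mod2: "even (a mod 2) \<longleftrightarrow> even a" for a :: int by presburger
  have mod4: "even (a mod 4) \<longleftrightarrow> even a" for a :: int by presburger
  have "even (\<Sum>i<\<alpha>. fst (x \<otimes>\<^bsub>additive_space \<alpha> \<beta>\<^esub> y) i) \<longleftrightarrow> even (\<Sum>i<\<alpha>. fst x i + fst y i)"
    by (rule sum_cong) (simp only: word_mult mod2)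
  moreover have "even (\<Sum>j<\<beta>. snd (x \<otimes>\<^bsub>additive_space \<alpha> \<beta>\<^esub> y) j) \<longleftrightarrow> even (\<Sum>j<\<beta>. snd x j + snd y j)"
    by (rule sum_cong) (simp only: word_mult mod4)
  ultimately show ?thesis
    using x y by (simp only: even_lee_weight_iff m_closed even_add sum.distrib) auto
qed

section \<open>Words of Lee weight 1\<close>

definition unit_words :: "nat \<Rightarrow> nat \<Rightarrow> ((nat \<Rightarrow> int) \<times> (nat \<Rightarrow> int)) set" where
  "unit_words \<alpha> \<beta> = bit_word \<alpha> \<beta> ` {..<\<alpha>} \<union>
     (\<lambda>(j, c). quat_word \<alpha> \<beta> j c) ` ({..<\<beta>} \<times> {1, 3})"

lemma unit_words_carrier: "unit_words \<alpha> \<beta> \<subseteq> carrier (additive_space \<alpha> \<beta>)"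
  by (auto simp: unit_words_def bit_word_carrier quat_word_carrier)

lemma bit_word_inj: "inj_on (bit_word \<alpha> \<beta>) {..<\<alpha>}"
proof (rule inj_onI)
  fix i i' assume "i \<in> {..<\<alpha>}" "bit_word \<alpha> \<beta> i = bit_word \<alpha> \<beta> i'"
  then have "fst (bit_word \<alpha> \<beta> i) i = fst (bit_word \<alpha> \<beta> i') i" "i < \<alpha>" by simp_all
  then show "i = i'" by (simp add: bit_word_def split: if_splits)
qed

lemma quat_word_inj: "inj_on (\<lambda>(j, c). quat_word \<alpha> \<beta> j c) ({..<\<beta>} \<times> {1, 3})"
proof (rule inj_onI)
  fix p q assume "p \<in> {..<\<beta>} \<times> {1, 3::int}" "q \<in> {..<\<beta>} \<times> {1, 3::int}"
    "(\<lambda>(j, c). quat_word \<alpha> \<beta> j c) p = (\<lambda>(j, c). quat_word \<alpha> \<beta> j c) q"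
  then obtain j c j' c' where *: "p = (j, c)" "q = (j', c')" "j < \<beta>" "c \<in> {1, 3}" "c' \<in> {1, 3}"
    and "quat_word \<alpha> \<beta> j c = quat_word \<alpha> \<beta> j' c'" by auto
  then have "snd (quat_word \<alpha> \<beta> j c) j = snd (quat_word \<alpha> \<beta> j' c') j" by simp
  then show "p = q" using * by (auto simp: quat_word_def split: if_splits)
qed

lemma bit_word_neq_quat_word: "i < \<alpha> \<Longrightarrow> bit_word \<alpha> \<beta> i \<noteq> quat_word \<alpha> \<beta> j c"
  by (auto simp: bit_word_def quat_word_def fun_eq_iff intro!: exI[of _ i])

lemma card_unit_words: "card (unit_words \<alpha> \<beta>) = \<alpha> + 2 * \<beta>"
proof -
  have "bit_word \<alpha> \<beta> ` {..<\<alpha>} \<inter> (\<lambda>(j, c). quat_word \<alpha> \<beta> j c) ` ({..<\<beta>} \<times> {1, 3}) = {}"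
  proof (rule ccontr)
    assume "bit_word \<alpha> \<beta> ` {..<\<alpha>} \<inter> (\<lambda>(j, c). quat_word \<alpha> \<beta> j c) ` ({..<\<beta>} \<times> {1, 3}) \<noteq> {}"
    then obtain x i p where "i < \<alpha>" "x = bit_word \<alpha> \<beta> i" "x = (\<lambda>(j, c). quat_word \<alpha> \<beta> j c) p"
      by blast
    then show False by (cases p) (metis bit_word_neq_quat_word case_prod_conv)
  qed
  then have "card (unit_words \<alpha> \<beta>) = card (bit_word \<alpha> \<beta> ` {..<\<alpha>}) +
      card ((\<lambda>(j, c). quat_word \<alpha> \<beta> j c) ` ({..<\<beta>} \<times> {1, 3}))"
    unfolding unit_words_def
    by (intro card_Un_disjoint) auto
  then show ?thesis
    by (simp add: card_image bit_word_inj quat_word_inj card_cartesian_product)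
qed

lemma lee_weight_unit_word: "w \<in> unit_words \<alpha> \<beta> \<Longrightarrow> lee_weight \<alpha> \<beta> w = 1"
  by (auto simp: unit_words_def lee_weight_def bit_word_def quat_word_def
      if_distrib[of lee] cong: if_cong sum.cong_simp)

lemma inv_bit_word:
  "inv\<^bsub>additive_space \<alpha> \<beta>\<^esub> bit_word \<alpha> \<beta> i = bit_word \<alpha> \<beta> i"
proof -
  interpret group "additive_space \<alpha> \<beta>" by (rule group_additive_space)
  show ?thesis
    by (rule word_eqI[where \<alpha> = \<alpha> and \<beta> = \<beta>])
      (auto simp: bit_word_carrier word_inv, simp add: bit_word_def)
qed

lemma inv_quat_word:
  assumes "c \<in> {1, 3}"
  shows "inv\<^bsub>additive_space \<alpha> \<beta>\<^esub> quat_word \<alpha> \<beta> j c = quat_word \<alpha> \<beta> j (4 - c)"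
proof -
  interpret group "additive_space \<alpha> \<beta>" by (rule group_additive_space)
  have c: "quat_word \<alpha> \<beta> j c \<in> carrier (additive_space \<alpha> \<beta>)"
    "quat_word \<alpha> \<beta> j (4 - c) \<in> carrier (additive_space \<alpha> \<beta>)"
    using assms by (auto intro: quat_word_carrier)
  show ?thesis
    by (rule word_eqI[where \<alpha> = \<alpha> and \<beta> = \<beta>])
      (use c assms in \<open>auto simp: word_inv\<close>, auto simp: quat_word_def)
qed

lemma inv_unit_word:
  "w \<in> unit_words \<alpha> \<beta> \<Longrightarrow> inv\<^bsub>additive_space \<alpha> \<beta>\<^esub> w \<in> unit_words \<alpha> \<beta>"
  by (auto simp: unit_words_def inv_bit_word inv_quat_word)

text \<open>Provides the step of an induction on the Lee weight: a nonzero coordinate can be moved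
  one unit closer to 0.\<close>

lemma split_unit_word:
  assumes x: "x \<in> carrier (additive_space \<alpha> \<beta>)" and "x \<noteq> \<one>\<^bsub>additive_space \<alpha> \<beta>\<^esub>"
  obtains w y where "w \<in> unit_words \<alpha> \<beta>" "y \<in> carrier (additive_space \<alpha> \<beta>)"
    "x = y \<otimes>\<^bsub>additive_space \<alpha> \<beta>\<^esub> w" "lee_weight \<alpha> \<beta> x = lee_weight \<alpha> \<beta> y + 1"
proof -
  interpret comm_group "additive_space \<alpha> \<beta>" by (rule comm_group_additive_space)
  obtain w where w: "w \<in> unit_words \<alpha> \<beta>"
    "lee_weight \<alpha> \<beta> x = lee_weight \<alpha> \<beta> (x \<otimes>\<^bsub>additive_space \<alpha> \<beta>\<^esub> inv\<^bsub>additive_space \<alpha> \<beta>\<^esub> w) + 1"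
  proof (cases "\<exists>i<\<alpha>. fst x i \<noteq> 0")
    case True
    then obtain i where i: "i < \<alpha>" "fst x i = 1" using fst_cases[OF x] by blast
    have "(fst x k + fst (bit_word \<alpha> \<beta> i) k) mod 2 = (if k = i then 0 else fst x k)" if "k < \<alpha>" for k
      using fst_cases[OF x that] that i by (auto simp: bit_word_def)
    moreover have "(snd x k + snd (bit_word \<alpha> \<beta> i) k) mod 4 = snd x k" if "k < \<beta>" for k
      using snd_cases[OF x that] that by (auto simp: bit_word_def)
    ultimately have "lee_weight \<alpha> \<beta> (x \<otimes>\<^bsub>additive_space \<alpha> \<beta>\<^esub> inv\<^bsub>additive_space \<alpha> \<beta>\<^esub> bit_word \<alpha> \<beta> i) + 1 =
        (\<Sum>k<\<alpha>. lee (if k = i then 0 else fst x k)) + 1 + (\<Sum>j<\<beta>. lee (snd x j))"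
      by (simp add: inv_bit_word lee_weight_def word_mult cong: sum.cong_simp)
    also have "(\<Sum>k<\<alpha>. lee (if k = i then 0 else fst x k)) + 1 = (\<Sum>k<\<alpha>. lee (fst x k))"
    proof -
      have "(\<Sum>k\<in>{..<\<alpha>} - {i}. lee (if k = i then 0 else fst x k)) = (\<Sum>k\<in>{..<\<alpha>} - {i}. lee (fst x k))"
        by (rule sum.cong) auto
      then show ?thesis using i by (simp add: sum.remove[of "{..<\<alpha>}" i])
    qed
    also have "(\<Sum>k<\<alpha>. lee (fst x k)) + (\<Sum>j<\<beta>. lee (snd x j)) = lee_weight \<alpha> \<beta> x"
      by (simp add: lee_weight_def)
    finally show ?thesis using i by (intro that[of "bit_word \<alpha> \<beta> i"]) (auto simp: unit_words_def)
  next
    case False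
    have "\<exists>j<\<beta>. snd x j \<noteq> 0"
    proof (rule ccontr)
      assume "\<not> (\<exists>j<\<beta>. snd x j \<noteq> 0)"
      then have "x = \<one>\<^bsub>additive_space \<alpha> \<beta>\<^esub>"
        using False by (intro word_eqI[OF x]) (auto simp: word_one)
      then show False using assms by simp
    qed
    then obtain j where j: "j < \<beta>" "snd x j \<noteq> 0" by blast
    \<comment> \<open>The direction is chosen so that the weight drops by exactly 1: the entries 1
      and 3 become 0, and 2 becomes 1.\<close>
    define c :: int where "c = (if snd x j = 3 then 3 else 1)"
    have c: "c \<in> {1, 3}" by (simp add: c_def)
    have "(fst x k + fst (quat_word \<alpha> \<beta> j (4 - c)) k) mod 2 = fst x k" if "k < \<alpha>" for k
      using fst_cases[OF x that] that by (auto simp: quat_word_def)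
    moreover have "(snd x k + snd (quat_word \<alpha> \<beta> j (4 - c)) k) mod 4 =
        (if k = j then (snd x j - c) mod 4 else snd x k)" if "k < \<beta>" for k
      using snd_cases[OF x that] that by (auto simp: quat_word_def c_def)
    ultimately have "lee_weight \<alpha> \<beta> (x \<otimes>\<^bsub>additive_space \<alpha> \<beta>\<^esub> inv\<^bsub>additive_space \<alpha> \<beta>\<^esub> quat_word \<alpha> \<beta> j c) + 1 =
        (\<Sum>i<\<alpha>. lee (fst x i)) + ((\<Sum>k<\<beta>. lee (if k = j then (snd x j - c) mod 4 else snd x k)) + 1)"
      by (simp add: inv_quat_word[OF c] lee_weight_def word_mult cong: sum.cong_simp)
    also have "(\<Sum>k<\<beta>. lee (if k = j then (snd x j - c) mod 4 else snd x k)) + 1 = (\<Sum>k<\<beta>. lee (snd x k))"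
    proof -
      have "(\<Sum>k\<in>{..<\<beta>} - {j}. lee (if k = j then (snd x j - c) mod 4 else snd x k)) =
          (\<Sum>k\<in>{..<\<beta>} - {j}. lee (snd x k))"
        by (rule sum.cong) auto
      moreover have "lee ((snd x j - c) mod 4) + 1 = lee (snd x j)"
        using j snd_cases[OF x j(1)] by (auto simp: c_def)
      ultimately show ?thesis using j by (simp add: sum.remove[of "{..<\<beta>}" j])
    qed
    also have "(\<Sum>i<\<alpha>. lee (fst x i)) + (\<Sum>k<\<beta>. lee (snd x k)) = lee_weight \<alpha> \<beta> x"
      by (simp add: lee_weight_def)
    finally show ?thesis using j c by (intro that[of "quat_word \<alpha> \<beta> j c"]) (auto simp: unit_words_def)
  qed
  have wc: "w \<in> carrier (additive_space \<alpha> \<beta>)" using w unit_words_carrier by blast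
  show thesis
    by (rule that[OF w(1) _ _ w(2)]) (use x wc in \<open>simp_all add: m_assoc\<close>)
qed

section \<open>Parameters of the dual of an extended perfect code\<close>

text \<open>Together with the order \<open>2 ^ (\<gamma> + 2 * \<delta>)\<close> this count
  determines the type, and it is invariant under isomorphism.\<close>

lemma card_doubling_kernel_additive_space:
  "card {x \<in> carrier (additive_space \<gamma> \<delta>). x \<otimes>\<^bsub>additive_space \<gamma> \<delta>\<^esub> x = \<one>\<^bsub>additive_space \<gamma> \<delta>\<^esub>} =
    2 ^ (\<gamma> + \<delta>)"
proof -
  interpret group "additive_space \<gamma> \<delta>" by (rule group_additive_space)
  let ?G = "additive_space \<gamma> \<delta>"
  have "x \<otimes>\<^bsub>?G\<^esub> x = \<one>\<^bsub>?G\<^esub> \<longleftrightarrow> (\<forall>j<\<delta>. snd x j \<in> {0, 2})" if x: "x \<in> carrier ?G" for x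
  proof
    assume *: "x \<otimes>\<^bsub>?G\<^esub> x = \<one>\<^bsub>?G\<^esub>"
    show "\<forall>j<\<delta>. snd x j \<in> {0, 2}"
    proof (intro allI impI)
      fix j assume j: "j < \<delta>"
      have "(snd x j + snd x j) mod 4 = 0"
        using word_mult(2)[OF j, of \<gamma> x x] word_one(2)[OF j, of \<gamma>] * by simp
      then show "snd x j \<in> {0, 2}" using snd_cases[OF x j] by auto
    qed
  next
    assume *: "\<forall>j<\<delta>. snd x j \<in> {0, 2}"
    show "x \<otimes>\<^bsub>?G\<^esub> x = \<one>\<^bsub>?G\<^esub>"
      using x * by (intro word_eqI[where \<alpha> = \<gamma> and \<beta> = \<delta>]) (auto simp: word_mult word_one)
  qed
  then have "{x \<in> carrier ?G. x \<otimes>\<^bsub>?G\<^esub> x = \<one>\<^bsub>?G\<^esub>} = {x \<in> carrier ?G. \<forall>j<\<delta>. snd x j \<in> {0, 2}}"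
    by blast
  also have "\<dots> = ({..<\<gamma>} \<rightarrow>\<^sub>E {0..<2}) \<times> ({..<\<delta>} \<rightarrow>\<^sub>E {0, 2})"
  proof (intro equalityI subsetI)
    fix x :: "(nat \<Rightarrow> int) \<times> (nat \<Rightarrow> int)"
    assume x: "x \<in> ({..<\<gamma>} \<rightarrow>\<^sub>E {0..<2}) \<times> ({..<\<delta>} \<rightarrow>\<^sub>E {0, 2})"
    have *: "snd x j \<in> {0, 2}" if "j < \<delta>" for j using x that by (auto simp: PiE_iff)
    moreover have "0 \<le> snd x j \<and> snd x j < 4" if "j < \<delta>" for j using *[OF that] by auto
    ultimately show "x \<in> {x \<in> carrier ?G. \<forall>j<\<delta>. snd x j \<in> {0, 2}}"
      using x by (auto simp: carrier_additive_space PiE_iff)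
  qed (auto simp: carrier_additive_space PiE_iff)
  finally show ?thesis
    by (simp add: card_cartesian_product card_PiE power_add flip: numeral_2_eq_2)
qed

text \<open>The group of syndromes of \<open>C\<close> has order \<open>2 ^ (t + 1)\<close>.
  Syndromes of unit words form a subset of half that order which contains no sum of two of its
  members. This pins down how involutions and doubles are distributed between that subset and its
  complement.\<close>

lemma dual_type_parameters:
  assumes perfect: "additive_extended_perfect_code \<alpha> \<beta> C" and type: "of_dual_type \<alpha> \<beta> \<gamma> \<delta> C"
    and \<alpha>: "\<alpha> \<noteq> 0" and t: "\<alpha> + 2 * \<beta> = 2 ^ t"
  shows "\<gamma> + 2 * \<delta> = t + 1" and "2 * \<alpha> = 2 ^ (\<gamma> + \<delta>)" and "\<gamma> \<ge> 1"
proof -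
  let ?G = "additive_space \<alpha> \<beta>"
  interpret G: comm_group ?G by (rule comm_group_additive_space)
  let ?wt = "lee_weight \<alpha> \<beta>" and ?W = "unit_words \<alpha> \<beta>"
  define D where "D = additive_dual \<alpha> \<beta> C"
  have C: "subgroup C ?G"
    using perfect by (simp add: additive_extended_perfect_code_def additive_code_def)
  interpret C: subgroup C ?G by (rule C)
  have D: "subgroup D ?G" unfolding D_def by (rule subgroup_additive_dual)
  interpret D: subgroup D ?G by (rule D)
  have dualD: "additive_dual \<alpha> \<beta> D = C" unfolding D_def by (rule additive_dual_dual[OF C])
  have finC: "finite C" and finD: "finite D"
    using finite_additive_space C.subset D.subset by (auto intro: finite_subset)
  obtain t' where t': "\<alpha> + 2 * \<beta> = 2 ^ t'" "card C = 2 ^ (2 ^ t' - t' - 1)"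
    "Min (?wt ` (C - {\<one>\<^bsub>?G\<^esub>})) = 4"
    using perfect extended_perfect_gray_iff[OF C]
    unfolding additive_extended_perfect_code_def by blast
  have "t' = t" using t t'(1) by simp
  then have cardC: "card C = 2 ^ (2 ^ t - t - 1)" using t'(2) by simp
  have dist: "x = \<one>\<^bsub>?G\<^esub>" if "x \<in> C" "?wt x < 4" for x
  proof (rule ccontr)
    assume "x \<noteq> \<one>\<^bsub>?G\<^esub>"
    then have "Min (?wt ` (C - {\<one>\<^bsub>?G\<^esub>})) \<le> ?wt x"
      using finC that by (intro Min_le) auto
    then show False using t'(3) that by simp
  qed
  \<comment> \<open>Makes the truncated subtraction in the exponent of \<open>card C\<close>
    exact.\<close>
  have tt: "t + 1 \<le> 2 ^ t" by (induction t) auto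
  have prod: "card C * card D = 2 ^ 2 ^ t"
    using card_additive_dual[OF C] t by (simp add: D_def)
  have "2 ^ t = (2 ^ t - t - 1) + (t + 1)" using tt by simp
  then have "(2::nat) ^ 2 ^ t = 2 ^ (2 ^ t - t - 1) * 2 ^ (t + 1)"
    by (metis power_add)
  then have cardD: "card D = 2 ^ (t + 1)" using prod cardC by simp
  obtain \<phi> where \<phi>: "\<phi> \<in> iso (?G\<lparr>carrier := D\<rparr>) (additive_space \<gamma> \<delta>)"
    using type by (auto simp: of_dual_type_def of_type_def is_iso_def D_def)
  then have bij: "bij_betw \<phi> D (carrier (additive_space \<gamma> \<delta>))"
    and hom: "\<And>x y. x \<in> D \<Longrightarrow> y \<in> D \<Longrightarrow> \<phi> (x \<otimes>\<^bsub>?G\<^esub> y) = \<phi> x \<otimes>\<^bsub>additive_space \<gamma> \<delta>\<^esub> \<phi> y"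
    by (auto simp: iso_def hom_def)
  have "card D = 2 ^ (\<gamma> + 2 * \<delta>)"
    using bij_betw_same_card[OF bij] by (simp add: card_additive_space)
  then have "(2::nat) ^ (t + 1) = 2 ^ (\<gamma> + 2 * \<delta>)" using cardD by simp
  then show sum: "\<gamma> + 2 * \<delta> = t + 1" by (simp only: power_inject_exp[of 2] one_less_numeral_iff semiring_norm)
  have card_invol: "card {u \<in> D. u \<otimes>\<^bsub>?G\<^esub> u = \<one>\<^bsub>?G\<^esub>} = 2 ^ (\<gamma> + \<delta>)"
  proof -
    interpret H: group "additive_space \<gamma> \<delta>" by (rule group_additive_space)
    have \<phi>D: "\<phi> x \<in> carrier (additive_space \<gamma> \<delta>)" if "x \<in> D" for x
      using bij that by (auto simp: bij_betw_def)
    have \<phi>1: "\<phi> \<one>\<^bsub>?G\<^esub> = \<one>\<^bsub>additive_space \<gamma> \<delta>\<^esub>"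
      using hom[of "\<one>\<^bsub>?G\<^esub>" "\<one>\<^bsub>?G\<^esub>"] \<phi>D[of "\<one>\<^bsub>?G\<^esub>"] by simp
    have *: "u \<otimes>\<^bsub>?G\<^esub> u = \<one>\<^bsub>?G\<^esub> \<longleftrightarrow> \<phi> u \<otimes>\<^bsub>additive_space \<gamma> \<delta>\<^esub> \<phi> u = \<one>\<^bsub>additive_space \<gamma> \<delta>\<^esub>" if "u \<in> D" for u
      using bij that hom[OF that that] \<phi>1 by (metis D.m_closed D.one_closed bij_betw_def inj_onD)
    have "bij_betw \<phi> {u \<in> D. u \<otimes>\<^bsub>?G\<^esub> u = \<one>\<^bsub>?G\<^esub>}
        {x \<in> carrier (additive_space \<gamma> \<delta>). x \<otimes>\<^bsub>additive_space \<gamma> \<delta>\<^esub> x = \<one>\<^bsub>additive_space \<gamma> \<delta>\<^esub>}"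
      unfolding bij_betw_def
    proof
      show "inj_on \<phi> {u \<in> D. u \<otimes>\<^bsub>?G\<^esub> u = \<one>\<^bsub>?G\<^esub>}"
        using bij by (auto simp: bij_betw_def inj_on_def)
      show "\<phi> ` {u \<in> D. u \<otimes>\<^bsub>?G\<^esub> u = \<one>\<^bsub>?G\<^esub>} =
          {x \<in> carrier (additive_space \<gamma> \<delta>). x \<otimes>\<^bsub>additive_space \<gamma> \<delta>\<^esub> x = \<one>\<^bsub>additive_space \<gamma> \<delta>\<^esub>}"
      proof (intro equalityI subsetI)
        fix x assume "x \<in> \<phi> ` {u \<in> D. u \<otimes>\<^bsub>?G\<^esub> u = \<one>\<^bsub>?G\<^esub>}"
        then show "x \<in> {x \<in> carrier (additive_space \<gamma> \<delta>).
            x \<otimes>\<^bsub>additive_space \<gamma> \<delta>\<^esub> x = \<one>\<^bsub>additive_space \<gamma> \<delta>\<^esub>}"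
          using * \<phi>D by force
      next
        fix x assume x: "x \<in> {x \<in> carrier (additive_space \<gamma> \<delta>).
            x \<otimes>\<^bsub>additive_space \<gamma> \<delta>\<^esub> x = \<one>\<^bsub>additive_space \<gamma> \<delta>\<^esub>}"
        then have "x \<in> \<phi> ` D" using bij_betw_imp_surj_on[OF bij] by blast
        then obtain u where "u \<in> D" "x = \<phi> u" by blast
        then show "x \<in> \<phi> ` {u \<in> D. u \<otimes>\<^bsub>?G\<^esub> u = \<one>\<^bsub>?G\<^esub>}"
          using x *[of u] by simp
      qed
    qed
    from bij_betw_same_card[OF this] show ?thesis
      by (simp only: card_doubling_kernel_additive_space)
  qed

  \<comment> \<open>The syndrome of \<open>g\<close> is its pairing with the dual code. The default
    value 0 off \<open>D\<close> makes equality of functions the same as equality on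
    \<open>D\<close>; by double duality the kernel is \<open>C\<close>.\<close>
  define s where "s g = (\<lambda>u. if u \<in> D then inner4 \<alpha> \<beta> u g else 0)" for g
  have s_mult: "s (x \<otimes>\<^bsub>?G\<^esub> y) = s x + s y" for x y
    by (auto simp: s_def inner4_mult_right fun_eq_iff)
  have s_0: "s g = 0 \<longleftrightarrow> g \<in> C" if "g \<in> carrier ?G" for g
    using that unfolding dualD[symmetric] by (auto simp: s_def additive_dual_eq fun_eq_iff inner4_commute)
  have s_inv: "s (inv\<^bsub>?G\<^esub> x) = - s x" if "x \<in> carrier ?G" for x
    using s_mult[of x "inv\<^bsub>?G\<^esub> x"] s_0[of "\<one>\<^bsub>?G\<^esub>"] that by (simp add: eq_neg_iff_add_eq_0 add.commute)
  have four: "x + x + (x + x) = 0" for x :: "(nat \<Rightarrow> int) \<times> (nat \<Rightarrow> int) \<Rightarrow> 4"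
    by (simp add: fun_eq_iff four_eq_0)

  \<comment> \<open>The words whose syndrome has order at most 2.\<close>
  define C' where "C' = {g \<in> carrier ?G. g \<otimes>\<^bsub>?G\<^esub> g \<in> C}"
  have C'_iff: "g \<in> C' \<longleftrightarrow> g \<in> carrier ?G \<and> s g + s g = 0" for g
    by (auto simp: C'_def s_0 simp flip: s_mult)
  have C'_C: "C \<subseteq> C'" using C.subset by (auto simp: C'_def)
  have C'sub: "subgroup C' ?G"
  proof (rule G.subgroupI)
    show "C' \<noteq> {}" using C'_C C.one_closed by blast
    show "inv\<^bsub>?G\<^esub> x \<in> C'" if "x \<in> C'" for x
    proof -
      have "- s x + - s x = - (s x + s x)" by simp
      then show ?thesis using that by (simp add: C'_iff s_inv)
    qed
    show "x \<otimes>\<^bsub>?G\<^esub> y \<in> C'" if "x \<in> C'" "y \<in> C'" for x y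
    proof -
      have "s x + s y + (s x + s y) = (s x + s x) + (s y + s y)" by (simp only: add_ac)
      then show ?thesis using that by (simp add: C'_iff s_mult)
    qed
  qed (auto simp: C'_def)
  have grpD: "group (?G\<lparr>carrier := D\<rparr>)" and grpC': "group (?G\<lparr>carrier := C'\<rparr>)"
    using D C'sub G.is_group by (auto intro: subgroup.subgroup_is_group)
  \<comment> \<open>Since the pairing of \<open>u\<close> with the double of \<open>g\<close> equals
    the pairing of the double of \<open>u\<close> with \<open>g\<close>, counting annihilators
    relates \<open>C'\<close> to the involutions of \<open>D\<close>, whose number is known from the
    type.\<close>
  have "card (carrier (?G\<lparr>carrier := D\<rparr>)) *
      card {g \<in> carrier ?G. \<forall>u\<in>carrier (?G\<lparr>carrier := D\<rparr>). inner4 \<alpha> \<beta> u (g \<otimes>\<^bsub>?G\<^esub> g) = 0} =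
      card (carrier ?G) *
      card {u \<in> carrier (?G\<lparr>carrier := D\<rparr>). \<forall>g\<in>carrier ?G. inner4 \<alpha> \<beta> u (g \<otimes>\<^bsub>?G\<^esub> g) = 0}"
    by (intro card_annihilators grpD G.is_group finite_additive_space)
      (auto simp: finD inner4_mult_left inner4_mult_right algebra_simps)
  moreover have "{g \<in> carrier ?G. \<forall>u\<in>D. inner4 \<alpha> \<beta> u (g \<otimes>\<^bsub>?G\<^esub> g) = 0} = C'"
    unfolding C'_def dualD[symmetric] by (auto simp: additive_dual_eq inner4_commute)
  moreover have "{u \<in> D. \<forall>g\<in>carrier ?G. inner4 \<alpha> \<beta> u (g \<otimes>\<^bsub>?G\<^esub> g) = 0} =
      {u \<in> D. u \<otimes>\<^bsub>?G\<^esub> u = \<one>\<^bsub>?G\<^esub>}"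
  proof -
    have "inner4 \<alpha> \<beta> u (g \<otimes>\<^bsub>?G\<^esub> g) = inner4 \<alpha> \<beta> (u \<otimes>\<^bsub>?G\<^esub> u) g" for u g
      by (simp add: inner4_mult_left inner4_mult_right)
    then show ?thesis
      using inner4_nondegenerate[of "_ \<otimes>\<^bsub>?G\<^esub> _" \<alpha> \<beta>] by (auto simp: inner4_one)
  qed
  ultimately have "card D * card C' = 2 ^ 2 ^ t * 2 ^ (\<gamma> + \<delta>)"
    using card_invol card_additive_space[of \<alpha> \<beta>] t by simp
  then have "card D * card C' = card D * (card C * 2 ^ (\<gamma> + \<delta>))"
    using prod by (simp add: mult_ac)
  then have cardC': "card C' = card C * 2 ^ (\<gamma> + \<delta>)" using cardD by simp
  have "{x \<in> C'. s x = 0} = C"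
    using C'_C C'sub s_0 by (auto dest: subgroup.mem_carrier)
  then have "card C' = card C * card (s ` C')"
    using card_kernel_image[OF grpC', of s] finite_subset[OF subgroup.subset[OF C'sub] finite_additive_space]
    by (simp add: s_mult)
  then have card_sC': "card (s ` C') = 2 ^ (\<gamma> + \<delta>)"
    using cardC' cardC by simp
  have "{x \<in> carrier ?G. s x = 0} = C" using C.subset s_0 by auto
  then have "card (carrier ?G) = card C * card (s ` carrier ?G)"
    using card_kernel_image[OF G.is_group finite_additive_space, of s] by (simp add: s_mult)
  then have "card C * card (s ` carrier ?G) = card C * card D"
    by (metis card_additive_space prod t)
  then have card_sG: "card (s ` carrier ?G) = 2 ^ (t + 1)" using cardC cardD by simp

  have Wc: "w \<in> carrier ?G" if "w \<in> ?W" for w using that unit_words_carrier by blast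
  have inj: "inj_on s ?W"
  proof (rule inj_onI)
    fix w w' assume w: "w \<in> ?W" "w' \<in> ?W" "s w = s w'"
    let ?x = "w \<otimes>\<^bsub>?G\<^esub> inv\<^bsub>?G\<^esub> w'"
    have "?x \<in> C" using w by (simp flip: s_0 add: Wc s_mult s_inv)
    moreover have "?wt ?x < 4"
      using lee_weight_mult_le[of w \<alpha> \<beta> "inv\<^bsub>?G\<^esub> w'"] lee_weight_unit_word[OF w(1)]
        lee_weight_unit_word[OF inv_unit_word[OF w(2)]] w Wc by simp
    ultimately have "?x = \<one>\<^bsub>?G\<^esub>" by (rule dist)
    then show "w = w'" using w Wc by (metis G.inv_equality G.inv_inv G.inv_closed)
  qed
  \<comment> \<open>Otherwise three unit words would combine to a codeword of weight at most 3. Such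
    a codeword is zero, but a product of three unit words has odd weight.\<close>
  have cap_free: "s w + s w' \<noteq> s w''" if w: "w \<in> ?W" "w' \<in> ?W" "w'' \<in> ?W" for w w' w''
  proof
    assume *: "s w + s w' = s w''"
    let ?x = "w \<otimes>\<^bsub>?G\<^esub> w' \<otimes>\<^bsub>?G\<^esub> inv\<^bsub>?G\<^esub> w''"
    have 1: "?wt w = 1" "?wt w' = 1" "?wt (inv\<^bsub>?G\<^esub> w'') = 1"
      using w inv_unit_word lee_weight_unit_word by blast+
    have "?x \<in> C" using w * by (simp flip: s_0 add: Wc s_mult s_inv)
    moreover have "?wt ?x < 4"
      using lee_weight_mult_le[of "w \<otimes>\<^bsub>?G\<^esub> w'" \<alpha> \<beta> "inv\<^bsub>?G\<^esub> w''"]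
        lee_weight_mult_le[of w \<alpha> \<beta> w'] 1 w Wc by simp
    ultimately have "?x = \<one>\<^bsub>?G\<^esub>" by (rule dist)
    then have "even (?wt ?x)" using lee_weight_eq_0_iff[OF G.one_closed] by simp
    then show False using 1 w Wc by (simp add: even_lee_weight_mult)
  qed
  define S where "S = s ` ?W"
  have cardS: "card S = 2 ^ t" unfolding S_def using card_image[OF inj] card_unit_words t by simp
  have finS: "finite S" using cardS by (rule_tac card_ge_0_finite) simp
  \<comment> \<open>A binary coordinate exists because \<open>\<alpha> \<noteq> 0\<close>, and its
    syndrome is killed by 2. Translation by \<open>e\<close> moves \<open>S\<close> off itself, so
    by cardinality \<open>S\<close> and its translate exhaust all syndromes. The same translation
    preserves doubles, hence half of the involutive syndromes lie in \<open>S\<close>.\<close>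
  define e where "e = s (bit_word \<alpha> \<beta> 0)"
  have b0: "bit_word \<alpha> \<beta> 0 \<in> ?W" using \<alpha> by (auto simp: unit_words_def)
  have ee: "e + e = 0"
    using s_inv[OF Wc[OF b0]] by (simp add: e_def inv_bit_word eq_neg_iff_add_eq_0)
  let ?T = "(\<lambda>y. e + y) ` S"
  have disj: "S \<inter> ?T = {}"
    using cap_free b0 unfolding S_def e_def by fastforce
  have STG: "S \<union> ?T \<subseteq> s ` carrier ?G"
  proof -
    have "e + s w \<in> s ` carrier ?G" if "w \<in> ?W" for w
      using that b0 Wc by (intro image_eqI[of _ _ "bit_word \<alpha> \<beta> 0 \<otimes>\<^bsub>?G\<^esub> w"]) (auto simp: s_mult e_def)
    then show ?thesis using Wc by (auto simp: S_def)
  qed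
  have cardT: "card ?T = card S" by (simp add: card_image)
  have "card (S \<union> ?T) = 2 ^ (t + 1)"
    using card_Un_disjoint[OF finS _ disj] finS cardT cardS by simp
  then have sG: "s ` carrier ?G = S \<union> ?T"
    using card_subset_eq[OF _ STG] card_sG finite_additive_space by (metis finite_imageI)
  have e2: "(e + y) + (e + y) = y + y" for y
  proof -
    have "(e + y) + (e + y) = (e + e) + (y + y)" by (simp only: add_ac)
    then show ?thesis by (simp add: ee)
  qed
  let ?S2 = "{y \<in> S. y + y = 0}"
  have sC': "s ` C' = {y \<in> s ` carrier ?G. y + y = 0}"
    by (auto simp: C'_iff)
  also have "\<dots> = ?S2 \<union> (\<lambda>y. e + y) ` ?S2"
    unfolding sG using e2 by auto
  finally have "card (s ` C') = card ?S2 + card ((\<lambda>y. e + y) ` ?S2)"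
    using disj finS by (simp only:) (rule card_Un_disjoint; auto)
  then have "2 ^ (\<gamma> + \<delta>) = 2 * card ?S2"
    unfolding card_sC' by (simp add: card_image)
  moreover have "?S2 = s ` bit_word \<alpha> \<beta> ` {..<\<alpha>}"
  proof
    show "s ` bit_word \<alpha> \<beta> ` {..<\<alpha>} \<subseteq> ?S2"
      using s_inv[OF bit_word_carrier[of \<alpha> \<beta>]]
      by (auto simp: S_def unit_words_def inv_bit_word eq_neg_iff_add_eq_0)
    show "?S2 \<subseteq> s ` bit_word \<alpha> \<beta> ` {..<\<alpha>}"
    proof
      fix y assume y: "y \<in> ?S2"
      then obtain w where w: "w \<in> ?W" "y = s w" by (auto simp: S_def)
      \<comment> \<open>If the syndrome of a quaternary unit word were killed by 2, the double of
        that word would be a nonzero codeword of weight below 4.\<close>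
      have "w \<notin> (\<lambda>(j, c). quat_word \<alpha> \<beta> j c) ` ({..<\<beta>} \<times> {1, 3})"
      proof
        assume "w \<in> (\<lambda>(j, c). quat_word \<alpha> \<beta> j c) ` ({..<\<beta>} \<times> {1, 3})"
        then obtain j c where jc: "j < \<beta>" "c \<in> {1, 3}" "w = quat_word \<alpha> \<beta> j c" by auto
        have "w \<otimes>\<^bsub>?G\<^esub> w \<in> C" using y w Wc by (simp flip: s_0 add: s_mult)
        moreover have "?wt (w \<otimes>\<^bsub>?G\<^esub> w) < 4"
          using lee_weight_mult_le[of w \<alpha> \<beta> w] lee_weight_unit_word[OF w(1)] Wc[OF w(1)] by simp
        ultimately have "w \<otimes>\<^bsub>?G\<^esub> w = \<one>\<^bsub>?G\<^esub>" by (rule dist)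
        then have "(snd w j + snd w j) mod 4 = 0"
          using word_mult(2)[OF jc(1), of \<alpha> w w] word_one(2)[OF jc(1), of \<alpha>] by simp
        then show False using jc by (auto simp: quat_word_def)
      qed
      then show "y \<in> s ` bit_word \<alpha> \<beta> ` {..<\<alpha>}"
        using w by (auto simp: unit_words_def)
    qed
  qed
  moreover have "card (s ` bit_word \<alpha> \<beta> ` {..<\<alpha>}) = \<alpha>"
  proof -
    have "inj_on s (bit_word \<alpha> \<beta> ` {..<\<alpha>})"
      using inj by (rule inj_on_subset) (auto simp: unit_words_def)
    then show ?thesis by (simp add: card_image bit_word_inj)
  qed
  ultimately have \<alpha>2: "2 * \<alpha> = 2 ^ (\<gamma> + \<delta>)" and S2: "card ?S2 = \<alpha>" by simp_all
  show "2 * \<alpha> = 2 ^ (\<gamma> + \<delta>)" by (rule \<alpha>2)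

  \<comment> \<open>For \<open>\<gamma> \<ge> 1\<close>: there are \<open>2 ^ \<delta>\<close>
    doubles of syndromes, and they fit into a set of \<alpha> = 2^(\<gamma>+\<delta>-1)
    elements.\<close>
  define d where "d g = s g + s g" for g
  have "{x \<in> carrier ?G. d x = 0} = C'" by (auto simp: C'_iff d_def)
  then have "card (carrier ?G) = card C' * card (d ` carrier ?G)"
    using card_kernel_image[OF G.is_group finite_additive_space, of d] by (simp add: s_mult d_def algebra_simps)
  then have "card C * 2 ^ (t + 1) = card C * (2 ^ (\<gamma> + \<delta>) * card (d ` carrier ?G))"
    by (metis card_additive_space prod cardD cardC' t mult.assoc)
  then have "(2::nat) ^ (t + 1) = 2 ^ (\<gamma> + \<delta>) * card (d ` carrier ?G)" using cardC by simp
  moreover have "t + 1 = (\<gamma> + \<delta>) + \<delta>" using sum by simp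
  then have "(2::nat) ^ (t + 1) = 2 ^ (\<gamma> + \<delta>) * 2 ^ \<delta>"
    by (metis power_add)
  ultimately have "card (d ` carrier ?G) = 2 ^ \<delta>" by simp
  \<comment> \<open>Every double is \<open>y + y\<close> with \<open>y\<close> in \<open>S\<close>.
    It cannot lie in \<open>S\<close> by \<open>cap_free\<close>, so it lies in the translate of
    \<open>S\<close>, and it is itself killed by 2.\<close>
  moreover have "d ` carrier ?G \<subseteq> (\<lambda>y. e + y) ` ?S2"
  proof
    fix z assume "z \<in> d ` carrier ?G"
    then obtain g where g: "g \<in> carrier ?G" "z = s g + s g" by (auto simp: d_def)
    then have "s g \<in> S \<union> ?T" unfolding sG[symmetric] by simp
    then have "\<exists>y\<in>S. s g = y \<or> s g = e + y" by blast
    then obtain y where y: "y \<in> S" "z = y + y" using g(2) e2[of _] by metis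
    have "z \<in> s ` carrier ?G"
      using g by (intro image_eqI[of _ _ "g \<otimes>\<^bsub>?G\<^esub> g"]) (auto simp: s_mult)
    moreover have "z \<notin> S"
    proof
      assume "z \<in> S"
      then obtain w'' where "w'' \<in> ?W" "z = s w''" unfolding S_def by (rule imageE)
      moreover obtain w where "w \<in> ?W" "y = s w" using y(1) unfolding S_def by (rule imageE)
      ultimately show False using cap_free[of w w w''] y(2) by simp
    qed
    ultimately have "z \<in> ?T" unfolding sG by simp
    then obtain y' where y': "y' \<in> S" "z = e + y'" by (rule imageE)
    have "y' + y' = z + z" unfolding y'(2) by (rule e2[symmetric])
    also have "\<dots> = 0" unfolding y(2) by (rule four)
    finally have "y' \<in> ?S2" using y'(1) by blast
    then show "z \<in> (\<lambda>y. e + y) ` ?S2" unfolding y'(2) by (rule imageI)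
  qed
  ultimately have "2 ^ \<delta> \<le> card ((\<lambda>y. e + y) ` ?S2)"
    using card_mono[of "(\<lambda>y. e + y) ` ?S2" "d ` carrier ?G"] finS by simp
  then have "2 ^ \<delta> \<le> \<alpha>" using S2 by (simp add: card_image)
  then have "(2::nat) ^ (\<delta> + 1) \<le> 2 ^ (\<gamma> + \<delta>)" using \<alpha>2 by simp
  then have "\<delta> + 1 \<le> \<gamma> + \<delta>" by (rule power_le_imp_le_exp[rotated]) simp
  then show "\<gamma> \<ge> 1" by simp
qed

section \<open>Extended perfect codes from labellings\<close>

text \<open>Lets homomorphisms on the ambient group be compared and bounded on unit words
  only.\<close>

lemma word_induct [consumes 1, case_names one mult]:
  assumes x: "x \<in> carrier (additive_space \<alpha> \<beta>)" and one: "P \<one>\<^bsub>additive_space \<alpha> \<beta>\<^esub>"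
    and mult: "\<And>y w. y \<in> carrier (additive_space \<alpha> \<beta>) \<Longrightarrow> w \<in> unit_words \<alpha> \<beta> \<Longrightarrow> P y \<Longrightarrow>
      P (y \<otimes>\<^bsub>additive_space \<alpha> \<beta>\<^esub> w)"
  shows "P x"
  using x
proof (induction "lee_weight \<alpha> \<beta> x" arbitrary: x rule: less_induct)
  case less
  show ?case
  proof (cases "x = \<one>\<^bsub>additive_space \<alpha> \<beta>\<^esub>")
    case False
    obtain w y where "w \<in> unit_words \<alpha> \<beta>" "y \<in> carrier (additive_space \<alpha> \<beta>)"
      "x = y \<otimes>\<^bsub>additive_space \<alpha> \<beta>\<^esub> w" "lee_weight \<alpha> \<beta> x = lee_weight \<alpha> \<beta> y + 1"
      by (rule split_unit_word[OF less.prems False])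
    then show ?thesis using less.hyps[of y] mult by simp
  qed (simp add: one)
qed

text \<open>Supplies the labels of the quaternary coordinates: one representative of each pair of
  opposite elements.\<close>

lemma sign_transversal:
  fixes R :: "'a::ab_group_add set"
  assumes "card R = 2 * n" "finite R" "\<And>b. b \<in> R \<Longrightarrow> - b \<in> R \<and> b \<noteq> - b"
  shows "\<exists>h. (\<forall>j<n. h j \<in> R) \<and> (\<forall>i<n. \<forall>j<n. h i = h j \<or> h i = - h j \<longrightarrow> i = j) \<and>
    (\<forall>b\<in>R. \<exists>j<n. b = h j \<or> b = - h j)"
  using assms
proof (induction n arbitrary: R)
  case 0
  then show ?case by simp
next
  case (Suc n)
  then have "R \<noteq> {}" by auto
  then obtain b where b: "b \<in> R" by blast
  then have b': "- b \<in> R" "b \<noteq> - b" using Suc.prems by auto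
  let ?R = "R - {b, - b}"
  have "card ?R = 2 * n"
    using Suc.prems b b' by (simp add: card_Diff_subset)
  moreover have "- c \<in> ?R \<and> c \<noteq> - c" if "c \<in> ?R" for c
    using that Suc.prems(3)[of c] by (auto simp: minus_equation_iff)
  ultimately obtain h where h: "\<forall>j<n. h j \<in> ?R"
    "\<forall>i<n. \<forall>j<n. h i = h j \<or> h i = - h j \<longrightarrow> i = j" "\<forall>c\<in>?R. \<exists>j<n. c = h j \<or> c = - h j"
    using Suc.IH[of ?R] Suc.prems(2) by blast
  let ?h = "h(n := b)"
  have "?h j \<in> R" if "j < Suc n" for j using that h(1) b by (auto simp: less_Suc_eq)
  moreover have "i = j" if "i < Suc n" "j < Suc n" "?h i = ?h j \<or> ?h i = - ?h j" for i j
    using that h(1,2) by (auto simp: less_Suc_eq minus_equation_iff[of b] split: if_splits)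
  moreover have "\<exists>j<Suc n. c = ?h j \<or> c = - ?h j" if "c \<in> R" for c
  proof (cases "c \<in> ?R")
    case True
    then obtain j where "j < n" "c = h j \<or> c = - h j" using h(3) by blast
    then show ?thesis by (intro exI[of _ j]) auto
  next
    case False
    then show ?thesis using that by (intro exI[of _ n]) auto
  qed
  ultimately show ?case by blast
qed

text \<open>The labels live in a commutative ring with 4 = 0, so that integer coordinates act on
  them as scalars. The conditions on \<open>h\<close> say that it picks exactly one element of each
  pair of opposite elements of order 4.\<close>

locale labelling =
  fixes \<alpha> \<beta> :: nat and B :: "'r::comm_ring_1 set" and e :: 'r and g h :: "nat \<Rightarrow> 'r"
  assumes four: "(4 :: 'r) = 0"
    and B: "add_subgroup B" "finite B" and e: "2 * e = 0" "e \<notin> B"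
    and g: "bij_betw g {..<\<alpha>} {b \<in> B. 2 * b = 0}"
    and h: "\<And>j. j < \<beta> \<Longrightarrow> h j \<in> B" "\<And>j. j < \<beta> \<Longrightarrow> 2 * h j \<noteq> 0"
    and h_inj: "\<And>i j. i < \<beta> \<Longrightarrow> j < \<beta> \<Longrightarrow> h i = h j \<or> h i = - h j \<Longrightarrow> i = j"
    and h_surj: "\<And>b. b \<in> B \<Longrightarrow> 2 * b \<noteq> 0 \<Longrightarrow> \<exists>j<\<beta>. b = h j \<or> b = - h j"
begin

abbreviation G where "G \<equiv> additive_space \<alpha> \<beta>"

sublocale G: comm_group G by (rule comm_group_additive_space)

definition syndrome :: "(nat \<Rightarrow> int) \<times> (nat \<Rightarrow> int) \<Rightarrow> 'r" where
  "syndrome = linear_word \<alpha> \<beta> (\<lambda>i. e + g i) (\<lambda>j. e + h j)"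

definition code :: "((nat \<Rightarrow> int) \<times> (nat \<Rightarrow> int)) set" where
  "code = {x \<in> carrier G. syndrome x = 0}"

lemma g_mem: "i < \<alpha> \<Longrightarrow> g i \<in> B" and g_double: "i < \<alpha> \<Longrightarrow> 2 * g i = 0"
  using g by (auto simp: bij_betw_def)

lemma syndrome_mult: "syndrome (x \<otimes>\<^bsub>G\<^esub> y) = syndrome x + syndrome y"
  unfolding syndrome_def by (rule linear_word_mult[OF four]) (simp add: distrib_left e g_double)

lemma syndrome_one: "syndrome \<one>\<^bsub>G\<^esub> = 0"
  by (simp add: syndrome_def linear_word_def word_one)

lemma syndrome_inv: "x \<in> carrier G \<Longrightarrow> syndrome (inv\<^bsub>G\<^esub> x) = - syndrome x"
  using syndrome_mult[of x "inv\<^bsub>G\<^esub> x"] syndrome_one by (simp add: eq_neg_iff_add_eq_0 add.commute)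

lemma e_minus: "- e = e"
  using e(1) by (simp add: eq_neg_iff_add_eq_0 flip: mult_2)

lemma e_cancel: "e + (e + x) = x" "e + (x + (e + y)) = x + y"
proof -
  have ee: "e + e = 0" using e(1) by (simp only: mult_2)
  show *: "e + (e + x) = x" for x by (metis add.assoc add_0 ee)
  have "e + (x + (e + y)) = e + (e + (x + y))" by (simp only: add_ac)
  then show "e + (x + (e + y)) = x + y" by (simp only: *)
qed

lemma syndrome_bit_word: "i < \<alpha> \<Longrightarrow> syndrome (bit_word \<alpha> \<beta> i) = e + g i"
  by (simp add: syndrome_def linear_word_bit_word)

lemma three: "(3 :: 'r) = - 1"
  using four by (simp add: eq_neg_iff_add_eq_0)

lemma syndrome_quat_word:
  "j < \<beta> \<Longrightarrow> syndrome (quat_word \<alpha> \<beta> j 1) = e + h j"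
  "j < \<beta> \<Longrightarrow> syndrome (quat_word \<alpha> \<beta> j 3) = e - h j"
  using e_minus by (simp_all add: syndrome_def linear_word_quat_word three)

lemma unit_word_syndrome:
  assumes "w \<in> unit_words \<alpha> \<beta>" shows "\<exists>b\<in>B. syndrome w = e + b"
  using assms g_mem h B(1)
  by (auto simp: unit_words_def syndrome_bit_word syndrome_quat_word add_subgroup_minus
      intro: bexI[of _ "- h _"])

lemma unit_word_of_syndrome:
  assumes b: "b \<in> B"
  obtains i where "i < \<alpha>" "b = g i" "2 * b = 0"
  | j where "j < \<beta>" "b = h j" | j where "j < \<beta>" "b = - h j"
proof (cases "2 * b = 0")
  case True
  then have "b \<in> g ` {..<\<alpha>}" using g b by (simp add: bij_betw_def)
  then show thesis using that(1) True by blast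
next
  case False
  then show thesis using h_surj[OF b] that(2,3) by blast
qed

lemma syndrome_surj_unit:
  assumes b: "b \<in> B" obtains w where "w \<in> unit_words \<alpha> \<beta>" "syndrome w = e + b"
  using b
proof (cases rule: unit_word_of_syndrome)
  case (1 i)
  then show ?thesis by (intro that[of "bit_word \<alpha> \<beta> i"]) (auto simp: unit_words_def syndrome_bit_word)
next
  case (2 j)
  then show ?thesis by (intro that[of "quat_word \<alpha> \<beta> j 1"]) (auto simp: unit_words_def syndrome_quat_word)
next
  case (3 j)
  then show ?thesis by (intro that[of "quat_word \<alpha> \<beta> j 3"]) (auto simp: unit_words_def syndrome_quat_word)
qed

text \<open>After cancelling \<open>e\<close>, the syndromes are \<open>g i\<close>,
  \<open>h j\<close> and \<open>- h j\<close>. The first are killed by 2 and the others are not, and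
  \<open>h j = - h j\<close> is excluded for the same reason.\<close>

lemma syndrome_inj_unit: "inj_on syndrome (unit_words \<alpha> \<beta>)"
proof (rule inj_onI)
  have ng: "h j \<noteq> g i" "- h j \<noteq> g i" "g i \<noteq> h j" "g i \<noteq> - h j" if "i < \<alpha>" "j < \<beta>" for i j
  proof -
    have "2 * g i = 0" "2 * h j \<noteq> 0" "2 * - h j \<noteq> 0"
      using g_double[OF that(1)] h(2)[OF that(2)] by simp_all
    then show "h j \<noteq> g i" "- h j \<noteq> g i" "g i \<noteq> h j" "g i \<noteq> - h j" by metis+
  qed
  have nh: "h i \<noteq> - h j" if "i < \<beta>" "j < \<beta>" for i j
  proof
    assume *: "h i = - h j"
    then have "i = j" using h_inj that by blast
    then have "h j + h j = 0" using * by (simp only: eq_neg_iff_add_eq_0)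
    then show False using h(2)[OF that(2)] by (metis mult_2)
  qed
  fix w w' assume w: "w \<in> unit_words \<alpha> \<beta>" "w' \<in> unit_words \<alpha> \<beta>" and eq: "syndrome w = syndrome w'"
  have cases: "(\<exists>i<\<alpha>. w = bit_word \<alpha> \<beta> i) \<or> (\<exists>j<\<beta>. w = quat_word \<alpha> \<beta> j 1) \<or> (\<exists>j<\<beta>. w = quat_word \<alpha> \<beta> j 3)"
    if "w \<in> unit_words \<alpha> \<beta>" for w using that by (auto simp: unit_words_def)
  have g_inj: "g i = g i' \<longleftrightarrow> i = i'" if "i < \<alpha>" "i' < \<alpha>" for i i'
    using g that by (auto simp: bij_betw_def inj_on_def)
  have h_inj': "h i = h j \<longleftrightarrow> i = j" if "i < \<beta>" "j < \<beta>" for i j using h_inj that by blast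
  have nh': "- h i \<noteq> h j" if "i < \<beta>" "j < \<beta>" for i j using nh[OF that(2,1)] by metis
  show "w = w'"
    using cases[OF w(1)] cases[OF w(2)] eq ng nh nh' g_inj h_inj'
    by (elim disjE exE conjE)
      (simp_all add: syndrome_bit_word syndrome_quat_word flip: add_uminus_conv_diff)
qed

text \<open>Unit words have syndromes in the coset of \<open>e\<close>, so the class of the syndrome
  modulo \<open>B\<close> counts unit words modulo 2.\<close>

lemma syndrome_parity:
  assumes "x \<in> carrier G"
  shows "if even (lee_weight \<alpha> \<beta> x) then syndrome x \<in> B else e + syndrome x \<in> B"
  using assms
proof (induction rule: word_induct)
  case one
  then show ?case
    using B lee_weight_eq_0_iff[OF G.one_closed] by (simp add: syndrome_one add_subgroup_zero)
next
  case (mult y w)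
  obtain b where b: "b \<in> B" "syndrome w = e + b" using unit_word_syndrome[OF mult(2)] by blast
  have w: "w \<in> carrier G" using mult unit_words_carrier by blast
  have 1: "e + syndrome (y \<otimes>\<^bsub>G\<^esub> w) = syndrome y + b"
    unfolding syndrome_mult b(2) by (rule e_cancel)
  have 2: "syndrome (y \<otimes>\<^bsub>G\<^esub> w) = (e + syndrome y) + b"
    unfolding syndrome_mult b(2) by (simp only: add_ac)
  have 3: "even (lee_weight \<alpha> \<beta> (y \<otimes>\<^bsub>G\<^esub> w)) \<longleftrightarrow> \<not> even (lee_weight \<alpha> \<beta> y)"
    using even_lee_weight_mult[OF mult(1) w] lee_weight_unit_word[OF mult(2)] by simp
  show ?case
  proof (cases "even (lee_weight \<alpha> \<beta> y)")
    case True
    then have "syndrome y \<in> B" using mult.IH by simp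
    then show ?thesis unfolding 3 1 using True b(1) B(1) by (simp add: add_subgroup_add)
  next
    case False
    then have "e + syndrome y \<in> B" using mult.IH by simp
    then show ?thesis unfolding 3 2 using False b(1) B(1) by (simp add: add_subgroup_add)
  qed
qed

lemma syndrome_image: "syndrome ` carrier G = B \<union> (\<lambda>b. e + b) ` B"
proof
  show "syndrome ` carrier G \<subseteq> B \<union> (\<lambda>b. e + b) ` B"
  proof (rule image_subsetI)
    fix x assume "x \<in> carrier G"
    moreover have "syndrome x = e + (e + syndrome x)" by (simp only: e_cancel)
    ultimately show "syndrome x \<in> B \<union> (\<lambda>b. e + b) ` B"
      using syndrome_parity[of x] by (metis UnI1 UnI2 image_eqI)
  qed
  have Wc: "w \<in> carrier G" if "w \<in> unit_words \<alpha> \<beta>" for w using that unit_words_carrier by blast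
  have "e + b \<in> syndrome ` carrier G" if b: "b \<in> B" for b
    using syndrome_surj_unit[OF b] Wc by (metis image_eqI)
  moreover have "b \<in> syndrome ` carrier G" if b: "b \<in> B" for b
  proof -
    obtain w where w: "w \<in> unit_words \<alpha> \<beta>" "syndrome w = e + b" by (rule syndrome_surj_unit[OF b])
    obtain w0 where w0: "w0 \<in> unit_words \<alpha> \<beta>" "syndrome w0 = e + 0"
      by (rule syndrome_surj_unit[OF add_subgroup_zero[OF B(1)]])
    have "syndrome (w0 \<otimes>\<^bsub>G\<^esub> w) = b" using w w0 by (simp add: syndrome_mult e_cancel)
    then show ?thesis using w w0 Wc by (metis G.m_closed image_eqI)
  qed
  ultimately show "B \<union> (\<lambda>b. e + b) ` B \<subseteq> syndrome ` carrier G" by blast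
qed

lemma e_plus_notin: "b \<in> B \<Longrightarrow> e + b \<notin> B"
  using add_subgroup_diff[OF B(1), of "e + b" b] e(2) by auto

lemma card_syndrome_image: "card (syndrome ` carrier G) = 2 * card B"
proof -
  have "B \<inter> (\<lambda>b. e + b) ` B = {}" using e_plus_notin by blast
  then show ?thesis
    unfolding syndrome_image using B(2) by (simp add: card_Un_disjoint card_image)
qed

lemma card_code: "card code * (2 * card B) = 2 ^ (\<alpha> + 2 * \<beta>)"
  using card_kernel_image[OF G.is_group finite_additive_space, of syndrome]
  by (simp add: syndrome_mult card_additive_space card_syndrome_image code_def)

lemma subgroup_code: "subgroup code G"
proof (rule G.subgroupI)
  have "\<one>\<^bsub>G\<^esub> \<in> code" by (simp add: code_def syndrome_one)
  then show "code \<noteq> {}" by blast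
qed (auto simp: code_def syndrome_mult syndrome_inv)

text \<open>A zero syndrome forces even weight, as \<open>e\<close> is not in \<open>B\<close>. In
  weight 2 the word would be a product of two unit words with opposite syndromes; by injectivity
  these are inverse to each other and the product is trivial.\<close>

lemma code_weight:
  assumes "x \<in> code" "x \<noteq> \<one>\<^bsub>G\<^esub>" shows "lee_weight \<alpha> \<beta> x \<ge> 4"
proof -
  have x: "x \<in> carrier G" "syndrome x = 0" using assms by (auto simp: code_def)
  have "even (lee_weight \<alpha> \<beta> x)"
    using syndrome_parity[OF x(1)] x(2) e by (auto split: if_splits)
  moreover have "lee_weight \<alpha> \<beta> x \<noteq> 0" using assms lee_weight_eq_0_iff[OF x(1)] by simp
  moreover have "lee_weight \<alpha> \<beta> x \<noteq> 2"
  proof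
    assume wt: "lee_weight \<alpha> \<beta> x = 2"
    obtain w y where w: "w \<in> unit_words \<alpha> \<beta>" and y: "y \<in> carrier G"
      and xy: "x = y \<otimes>\<^bsub>G\<^esub> w" "lee_weight \<alpha> \<beta> x = lee_weight \<alpha> \<beta> y + 1"
      by (rule split_unit_word[OF x(1) assms(2)])
    have "y \<noteq> \<one>\<^bsub>G\<^esub>" using wt xy lee_weight_eq_0_iff[OF y] by auto
    then obtain w' y' where w': "w' \<in> unit_words \<alpha> \<beta>" and y': "y' \<in> carrier G"
      and yy: "y = y' \<otimes>\<^bsub>G\<^esub> w'" "lee_weight \<alpha> \<beta> y = lee_weight \<alpha> \<beta> y' + 1"
      by (rule split_unit_word[OF y])
    have c: "w \<in> carrier G" "w' \<in> carrier G" using w w' unit_words_carrier by blast+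
    have "y' = \<one>\<^bsub>G\<^esub>" using wt xy yy lee_weight_eq_0_iff[OF y'] by simp
    then have xw: "x = w' \<otimes>\<^bsub>G\<^esub> w" using xy yy c by simp
    then have "syndrome w' = syndrome (inv\<^bsub>G\<^esub> w)"
      using x(2) c by (simp add: syndrome_mult syndrome_inv eq_neg_iff_add_eq_0)
    then have "w' = inv\<^bsub>G\<^esub> w"
      using syndrome_inj_unit w' inv_unit_word[OF w] by (auto simp: inj_on_def)
    then show False using xw c assms(2) by simp
  qed
  ultimately show ?thesis by presburger
qed

end

context labelling
begin

text \<open>The minimum 4 also has to be attained. From \<open>\<alpha> \<ge> 3\<close> there are
  distinct nonzero involutions \<open>x\<close>, \<open>y\<close> in \<open>B\<close>, and the four
  binary coordinates labelled 0, \<open>x\<close>, \<open>y\<close>, \<open>x + y\<close> have total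
  syndrome 4e + 2x + 2y = 0.\<close>

lemma perfect:
  assumes t: "\<alpha> + 2 * \<beta> = 2 ^ t" and cardB: "card B = 2 ^ t" and \<alpha>: "\<alpha> \<ge> 3"
  shows "additive_extended_perfect_code \<alpha> \<beta> code"
proof -
  let ?B2 = "{b \<in> B. 2 * b = 0}"
  have cardB2: "card ?B2 = \<alpha>" using bij_betw_same_card[OF g] by simp
  have 0: "0 \<in> ?B2" using add_subgroup_zero[OF B(1)] by simp
  have "card (?B2 - {0}) \<ge> 2" using cardB2 \<alpha> 0 by (simp add: card_Diff_singleton)
  then obtain T where "T \<subseteq> ?B2 - {0}" "card T = 2" by (meson obtain_subset_with_card_n)
  then obtain x y where xy: "x \<in> ?B2" "y \<in> ?B2" "x \<noteq> 0" "y \<noteq> 0" "x \<noteq> y"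
    by (auto simp: card_2_iff)
  have xy2: "x + y \<in> ?B2" using xy B(1) by (simp add: add_subgroup_add distrib_left)
  have pre: "\<exists>i<\<alpha>. g i = b" if "b \<in> ?B2" for b
    using g that by (force simp: bij_betw_def)
  obtain i0 i1 i2 i3 where i: "i0 < \<alpha>" "g i0 = 0" "i1 < \<alpha>" "g i1 = x" "i2 < \<alpha>" "g i2 = y"
    "i3 < \<alpha>" "g i3 = x + y"
    using pre[OF 0] pre[OF xy(1)] pre[OF xy(2)] pre[OF xy2] by blast
  have xx: "x + x = 0" "y + y = 0" using xy by (simp_all flip: mult_2)
  have "x + y \<noteq> 0"
  proof
    assume "x + y = 0"
    then have "x + y = x + x" using xx by simp
    then show False using xy by simp
  qed
  then have ne: "i0 \<noteq> i1" "i0 \<noteq> i2" "i0 \<noteq> i3" using i xy by auto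
  let ?b = "bit_word \<alpha> \<beta>"
  let ?v = "?b i0 \<otimes>\<^bsub>G\<^esub> (?b i1 \<otimes>\<^bsub>G\<^esub> (?b i2 \<otimes>\<^bsub>G\<^esub> ?b i3))"
  have bc: "?b k \<in> carrier G" for k by (rule bit_word_carrier)
  have "syndrome ?v = (e + e) + (e + e) + (x + x) + (y + y)"
    using i by (simp add: syndrome_mult syndrome_bit_word add_ac)
  also have "\<dots> = 0" using e(1) xx by (simp flip: mult_2)
  finally have vC: "?v \<in> code" using bc by (simp add: code_def)
  have v1: "?v \<noteq> \<one>\<^bsub>G\<^esub>"
  proof
    assume "?v = \<one>\<^bsub>G\<^esub>"
    then have "fst ?v i0 = 0" using i by (simp only: word_one)
    then show False using i ne by (simp add: word_mult) (simp add: bit_word_def)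
  qed
  have wt1: "lee_weight \<alpha> \<beta> (?b k) = 1" if "k < \<alpha>" for k
    using that by (intro lee_weight_unit_word) (auto simp: unit_words_def)
  have "lee_weight \<alpha> \<beta> (?b i2 \<otimes>\<^bsub>G\<^esub> ?b i3) \<le> 2"
    using lee_weight_mult_le[OF bc bc, of i2 i3] wt1 i by simp
  then have "lee_weight \<alpha> \<beta> (?b i1 \<otimes>\<^bsub>G\<^esub> (?b i2 \<otimes>\<^bsub>G\<^esub> ?b i3)) \<le> 3"
    using lee_weight_mult_le[OF bc G.m_closed[OF bc bc], of i1 i2 i3] wt1 i by simp
  then have "lee_weight \<alpha> \<beta> ?v \<le> 4"
    using lee_weight_mult_le[OF bc G.m_closed[OF bc G.m_closed[OF bc bc]], of i0 i1 i2 i3] wt1 i by simp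
  then have wt: "lee_weight \<alpha> \<beta> ?v = 4" using code_weight[OF vC v1] by simp
  have fin: "finite code"
    using finite_additive_space by (rule finite_subset[rotated]) (auto simp: code_def)
  have "Min (lee_weight \<alpha> \<beta> ` (code - {\<one>\<^bsub>G\<^esub>})) = 4"
  proof (rule Min_eqI)
    show "4 \<in> lee_weight \<alpha> \<beta> ` (code - {\<one>\<^bsub>G\<^esub>})"
      using vC v1 wt by (intro image_eqI[of _ _ ?v]) auto
  qed (use fin code_weight in auto)
  moreover have "card code = 2 ^ (2 ^ t - t - 1)"
  proof -
    have "t + 1 \<le> 2 ^ t" by (induction t) auto
    then have "2 ^ t = (2 ^ t - t - 1) + (t + 1)" by simp
    then have "(2::nat) ^ 2 ^ t = 2 ^ (2 ^ t - t - 1) * 2 ^ (t + 1)" by (metis power_add)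
    then have "card code * 2 ^ (t + 1) = 2 ^ (2 ^ t - t - 1) * 2 ^ (t + 1)"
      using card_code cardB t by simp
    then show ?thesis by simp
  qed
  ultimately show ?thesis
    unfolding additive_extended_perfect_code_def additive_code_def
    using extended_perfect_gray_iff[OF subgroup_code] subgroup_code t by blast
qed

text \<open>An odd permutation preserves the relation \<open>b = - b\<close>, hence the split into
  binary and quaternary labels, and it maps pairs of opposite elements to such pairs.\<close>

lemma labelling_shuffle:
  assumes sh: "shuffle B F N \<sigma> E"
  shows "labelling \<alpha> \<beta> B e (\<sigma> \<circ> g) (\<sigma> \<circ> h)"
proof -
  have \<sigma>: "bij_betw \<sigma> B B" "\<And>b. b \<in> B \<Longrightarrow> \<sigma> (- b) = - \<sigma> b"
    using sh by (auto simp: shuffle_def)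
  have \<sigma>B: "\<sigma> b \<in> B" if "b \<in> B" for b using \<sigma>(1) that by (auto simp: bij_betw_def)
  have inj: "\<sigma> b = \<sigma> c \<longleftrightarrow> b = c" if "b \<in> B" "c \<in> B" for b c
    using \<sigma>(1) that by (auto simp: bij_betw_def inj_on_def)
  have dbl: "2 * b = 0 \<longleftrightarrow> b = - b" for b :: 'r
    by (simp only: mult_2 eq_neg_iff_add_eq_0)
  have mB: "- b \<in> B" if "b \<in> B" for b using B(1) that by (rule add_subgroup_minus)
  have tors: "2 * \<sigma> b = 0 \<longleftrightarrow> 2 * b = 0" if "b \<in> B" for b
    unfolding dbl using inj[OF that mB[OF that]] \<sigma>(2)[OF that] by simp
  show ?thesis
  proof
    have "bij_betw \<sigma> {b \<in> B. 2 * b = 0} {b \<in> B. 2 * b = 0}"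
      unfolding bij_betw_def
    proof
      show "inj_on \<sigma> {b \<in> B. 2 * b = 0}" using inj by (auto simp: inj_on_def)
      show "\<sigma> ` {b \<in> B. 2 * b = 0} = {b \<in> B. 2 * b = 0}"
      proof (intro equalityI subsetI)
        fix b assume "b \<in> {b \<in> B. 2 * b = 0}"
        moreover from this obtain c where "c \<in> B" "b = \<sigma> c"
          using \<sigma>(1) by (auto simp: bij_betw_def)
        ultimately show "b \<in> \<sigma> ` {b \<in> B. 2 * b = 0}" using tors by auto
      qed (use tors \<sigma>B in auto)
    qed
    with g show "bij_betw (\<sigma> \<circ> g) {..<\<alpha>} {b \<in> B. 2 * b = 0}" by (rule bij_betw_trans)
    show "(\<sigma> \<circ> h) j \<in> B" if "j < \<beta>" for j using \<sigma>B h(1)[OF that] by simp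
    show "2 * (\<sigma> \<circ> h) j \<noteq> 0" if "j < \<beta>" for j using tors[OF h(1)[OF that]] h(2)[OF that] by simp
    show "i = j" if "i < \<beta>" "j < \<beta>" "(\<sigma> \<circ> h) i = (\<sigma> \<circ> h) j \<or> (\<sigma> \<circ> h) i = - (\<sigma> \<circ> h) j" for i j
    proof -
      have "h i = h j \<or> h i = - h j"
        using that inj h(1) mB \<sigma>(2) by (metis comp_apply)
      then show ?thesis using h_inj that by blast
    qed
    show "\<exists>j<\<beta>. b = (\<sigma> \<circ> h) j \<or> b = - (\<sigma> \<circ> h) j" if b: "b \<in> B" "2 * b \<noteq> 0" for b
    proof -
      have "b \<in> \<sigma> ` B" using \<sigma>(1) b(1) by (simp add: bij_betw_def)
      then obtain c where c: "c \<in> B" "b = \<sigma> c" by blast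
      then obtain j where "j < \<beta>" "c = h j \<or> c = - h j" using h_surj[of c] tors[OF c(1)] b(2) by auto
      then show ?thesis using c(2) \<sigma>(2) h(1) by auto
    qed
  qed (use four B e in auto)
qed

text \<open>The intersection is the kernel, on the first code, of the difference \<open>d\<close> of
  the two syndromes. What needs proof is that \<open>d\<close> maps this code onto \<open>N\<close>;
  here the fixed generating set enters.\<close>

lemma card_code_Int_shuffle:
  assumes sh: "shuffle B F N \<sigma> E" and N: "add_subgroup N"
  shows "card (code \<inter> labelling.code \<alpha> \<beta> e (\<sigma> \<circ> g) (\<sigma> \<circ> h)) * card N = card code"
proof -
  interpret L: labelling \<alpha> \<beta> B e "\<sigma> \<circ> g" "\<sigma> \<circ> h" by (rule labelling_shuffle[OF sh])
  have \<sigma>: "\<And>b. b \<in> B \<Longrightarrow> \<sigma> (- b) = - \<sigma> b" "0 \<in> F" "F \<subseteq> B" "B \<subseteq> group_closure F"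
    "\<And>b. b \<in> F \<Longrightarrow> \<sigma> b = b" "\<And>b. b \<in> B \<Longrightarrow> \<sigma> b - b \<in> N"
    "N \<subseteq> group_closure ((\<lambda>b. \<sigma> b - b) ` (B - E))"
    using sh by (auto simp: shuffle_def)
  define d where "d x = L.syndrome x - syndrome x" for x
  have d_mult: "d (x \<otimes>\<^bsub>G\<^esub> y) = d x + d y" for x y
    by (simp add: d_def syndrome_mult L.syndrome_mult)
  have d_inv: "d (inv\<^bsub>G\<^esub> x) = - d x" if "x \<in> carrier G" for x
    using that by (simp add: d_def syndrome_inv L.syndrome_inv)
  have d_one: "d \<one>\<^bsub>G\<^esub> = 0" by (simp add: d_def syndrome_one L.syndrome_one)
  have Wc: "w \<in> carrier G" if "w \<in> unit_words \<alpha> \<beta>" for w using that unit_words_carrier by blast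
  have unit: "\<exists>w\<in>unit_words \<alpha> \<beta>. syndrome w = e + b \<and> d w = \<sigma> b - b" if b: "b \<in> B" for b
    using b
  proof (cases rule: unit_word_of_syndrome)
    case (1 i)
    then show ?thesis
      by (intro bexI[of _ "bit_word \<alpha> \<beta> i"])
        (auto simp: unit_words_def syndrome_bit_word L.syndrome_bit_word d_def)
  next
    case (2 j)
    then show ?thesis
      by (intro bexI[of _ "quat_word \<alpha> \<beta> j 1"])
        (auto simp: unit_words_def syndrome_quat_word L.syndrome_quat_word d_def)
  next
    \<comment> \<open>This word is labelled \<open>- h j\<close>, and its displacement is the right
      one because \<open>\<sigma>\<close> is odd.\<close>
    case (3 j)
    then show ?thesis
      by (intro bexI[of _ "quat_word \<alpha> \<beta> j 3"])
        (auto simp: unit_words_def syndrome_quat_word L.syndrome_quat_word d_def \<sigma>(1) h(1))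
  qed
  have dW: "d w \<in> N" if w: "w \<in> unit_words \<alpha> \<beta>" for w
  proof -
    obtain b where b: "b \<in> B" "syndrome w = e + b" using unit_word_syndrome[OF w] by blast
    obtain w' where w': "w' \<in> unit_words \<alpha> \<beta>" "syndrome w' = e + b" "d w' = \<sigma> b - b"
      using unit[OF b(1)] by blast
    then have "w = w'" using syndrome_inj_unit w b by (simp add: inj_on_def)
    then show ?thesis using w' \<sigma>(6) b by simp
  qed
  have dN: "d x \<in> N" if "x \<in> carrier G" for x
    using that by (induction rule: word_induct)
      (use N dW in \<open>auto simp: d_one d_mult add_subgroup_zero add_subgroup_add\<close>)

  \<comment> \<open>The syndromes reached by words on which both syndromes agree. Labels in
    \<open>F\<close> are unchanged, so \<open>e + b\<close> is in \<open>K\<close> for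
    \<open>b\<close> in \<open>F\<close>; taking \<open>b = 0\<close> gives \<open>e\<close>, and
    then \<open>F\<close> and all of \<open>B\<close> follow.\<close>
  define K where "K = syndrome ` {x \<in> carrier G. d x = 0}"
  have sK: "add_subgroup K"
    unfolding add_subgroup_def
  proof (intro conjI ballI)
    show "0 \<in> K" unfolding K_def using d_one syndrome_one by (intro image_eqI[of _ _ "\<one>\<^bsub>G\<^esub>"]) auto
    fix a b assume "a \<in> K" "b \<in> K"
    then obtain x y where "x \<in> carrier G" "y \<in> carrier G" "d x = 0" "d y = 0" "a = syndrome x" "b = syndrome y"
      by (auto simp: K_def)
    then show "a - b \<in> K"
      unfolding K_def by (intro image_eqI[of _ _ "x \<otimes>\<^bsub>G\<^esub> inv\<^bsub>G\<^esub> y"])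
        (auto simp: d_mult d_inv syndrome_mult syndrome_inv)
  qed
  have eF: "e + b \<in> K" if "b \<in> F" for b
  proof -
    have bB: "b \<in> B" using that \<sigma>(3) by blast
    obtain w where "w \<in> unit_words \<alpha> \<beta>" "syndrome w = e + b" "d w = \<sigma> b - b"
      using unit[OF bB] by blast
    then show ?thesis unfolding K_def using \<sigma>(5)[OF that] Wc by (intro image_eqI[of _ _ w]) auto
  qed
  have eK: "e \<in> K" using eF[OF \<sigma>(2)] by simp
  have "b \<in> K" if "b \<in> F" for b
    using add_subgroup_diff[OF sK eF[OF that] eK] by simp
  then have "group_closure F \<subseteq> K" using group_closure_subset_iff[OF sK] by blast
  then have BK: "B \<subseteq> K" using \<sigma>(4) by blast

  have sd: "add_subgroup (d ` code)"
    unfolding add_subgroup_def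
  proof (intro conjI ballI)
    show "0 \<in> d ` code"
      using d_one by (intro image_eqI[of _ _ "\<one>\<^bsub>G\<^esub>"]) (auto simp: code_def syndrome_one)
    fix a b assume "a \<in> d ` code" "b \<in> d ` code"
    then obtain x y where "x \<in> code" "y \<in> code" "a = d x" "b = d y" by blast
    then show "a - b \<in> d ` code"
      by (intro image_eqI[of _ _ "x \<otimes>\<^bsub>G\<^esub> inv\<^bsub>G\<^esub> y"])
        (auto simp: code_def d_mult d_inv syndrome_mult syndrome_inv)
  qed
  have "\<sigma> b - b \<in> d ` code" if b: "b \<in> B" for b
  proof -
    obtain w where w: "w \<in> unit_words \<alpha> \<beta>" "syndrome w = e + b" "d w = \<sigma> b - b"
      using unit[OF b] by blast
    \<comment> \<open>The unit word with displacement \<open>\<sigma> b - b\<close> is corrected by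
      a word of the same syndrome with vanishing \<open>d\<close>. The quotient is a codeword with
      unchanged \<open>d\<close>.\<close>
    have "e + b \<in> K" using add_subgroup_add[OF sK eK] BK b by blast
    then obtain x where "x \<in> carrier G" "d x = 0" "syndrome x = e + b" by (auto simp: K_def)
    then show ?thesis
      using w Wc[OF w(1)] by (intro image_eqI[of _ _ "w \<otimes>\<^bsub>G\<^esub> inv\<^bsub>G\<^esub> x"])
        (auto simp: code_def d_mult d_inv syndrome_mult syndrome_inv)
  qed
  then have "group_closure ((\<lambda>b. \<sigma> b - b) ` (B - E)) \<subseteq> d ` code"
    using group_closure_subset_iff[OF sd] by blast
  then have "N \<subseteq> d ` code" using \<sigma>(7) by blast
  moreover have "d ` code \<subseteq> N" using dN by (auto simp: code_def)
  ultimately have img: "d ` code = N" by blast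
  have "group (G\<lparr>carrier := code\<rparr>)"
    using subgroup_code G.is_group by (rule subgroup.subgroup_is_group)
  moreover have "finite code"
    using finite_additive_space by (rule finite_subset[rotated]) (auto simp: code_def)
  ultimately have "card code = card {x \<in> code. d x = 0} * card (d ` code)"
    using card_kernel_image[of "G\<lparr>carrier := code\<rparr>" d] by (simp add: d_mult)
  moreover have "{x \<in> code. d x = 0} = code \<inter> L.code"
    by (auto simp: code_def L.code_def d_def)
  ultimately show ?thesis by (simp add: img)
qed

end

section \<open>Characters of a box and the type of the dual code\<close>

definition four_to_int :: "4 \<Rightarrow> int" where
  "four_to_int c = (if c = 0 then 0 else if c = 1 then 1 else if c = 2 then 2 else 3)"

lemma of_int_four_to_int: "of_int (four_to_int c) = c"
  using four_cases[of c] by (auto simp: four_to_int_def)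

lemma four_to_int_bounds: "0 \<le> four_to_int c" "four_to_int c < 4"
  by (simp_all add: four_to_int_def)

lemma four_to_int_add: "four_to_int (a + b) = (four_to_int a + four_to_int b) mod 4"
  using four_cases[of a] four_cases[of b] by (elim disjE) (simp_all add: four_to_int_def)

lemma four_of_int_inj:
  "(of_int a :: 4) = of_int b \<Longrightarrow> a mod 4 = b mod 4"
  using four_of_int_eq_0_iff[of "a - b"] by (simp add: mod_eq_dvd_iff dvd_eq_mod_eq_0)

text \<open>The pairing of Z2^\<gamma> x Z4^\<delta> with the box on \<gamma> + \<delta>
  coordinates. The first \<gamma> coordinates of \<open>x\<close> lie in \<open>{0, 2}\<close>
  there, so coefficients modulo 2 suffice, and the words \<open>a\<close> parametrise the characters
  of the box.\<close>

definition box_character :: "nat \<Rightarrow> nat \<Rightarrow> (nat \<Rightarrow> int) \<times> (nat \<Rightarrow> int) \<Rightarrow> (nat \<Rightarrow> 4) \<Rightarrow> 4" where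
  "box_character \<gamma> \<delta> a x = linear_word \<gamma> \<delta> x (\<lambda>s. x (\<gamma> + s)) a"

lemma box_character_add:
  "box_character \<gamma> \<delta> a (x + y) = box_character \<gamma> \<delta> a x + box_character \<gamma> \<delta> a y"
  by (simp add: box_character_def linear_word_def distrib_left sum.distrib)

lemma box_character_zero: "box_character \<gamma> \<delta> a 0 = 0"
  by (simp add: box_character_def linear_word_def)

lemma box_character_minus: "box_character \<gamma> \<delta> a (- x) = - box_character \<gamma> \<delta> a x"
  using box_character_add[of \<gamma> \<delta> a x "- x"] by (simp add: box_character_zero eq_neg_iff_add_eq_0 add.commute)

lemma box_character_inj:
  assumes a: "a \<in> carrier (additive_space \<gamma> \<delta>)" "a' \<in> carrier (additive_space \<gamma> \<delta>)"
    and eq: "\<And>x. x \<in> box {..<\<gamma>} {\<gamma>..<\<gamma> + \<delta>} \<Longrightarrow> box_character \<gamma> \<delta> a x = box_character \<gamma> \<delta> a' x"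
  shows "a = a'"
proof (rule word_eqI[OF a])
  fix r assume r: "r < \<gamma>"
  have "box_character \<gamma> \<delta> b (0(r := 2)) = of_int (fst b r) * 2" for b
    using r by (simp add: box_character_def linear_word_def if_distrib[of "\<lambda>c. _ * c"] fun_upd_apply cong: if_cong)
  moreover have "0(r := 2) \<in> box {..<\<gamma>} {\<gamma>..<\<gamma> + \<delta>}" using r by (auto simp: box_def)
  ultimately have "of_int (fst a r) * 2 = (of_int (fst a' r) * 2 :: 4)" using eq by metis
  then show "fst a r = fst a' r"
    using fst_cases[OF a(1) r] fst_cases[OF a(2) r] by auto
next
  fix s assume s: "s < \<delta>"
  have "box_character \<gamma> \<delta> b (0(\<gamma> + s := 1)) = of_int (snd b s)" for b
    using s by (simp add: box_character_def linear_word_def if_distrib[of "\<lambda>c. _ * c"] fun_upd_apply cong: if_cong)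
  moreover have "0(\<gamma> + s := 1) \<in> box {..<\<gamma>} {\<gamma>..<\<gamma> + \<delta>}" using s by (auto simp: box_def)
  ultimately have "(of_int (snd a s) :: 4) = of_int (snd a' s)" using eq by metis
  then have "snd a s mod 4 = snd a' s mod 4" by (rule four_of_int_inj)
  then show "snd a s = snd a' s"
    using snd_bounds[OF a(1) s] snd_bounds[OF a(2) s] by simp
qed

text \<open>The generator e of the split-off factor Z2. Coordinate 0 is reserved for it, which is
  why the box for \<open>B\<close> starts at index 1.\<close>

definition marker :: "nat \<Rightarrow> 4" where
  "marker = 0(0 := 2)"

locale box_labelling =
  labelling \<alpha> \<beta> "box {1..<\<gamma>} {\<gamma>..<\<gamma> + \<delta>}" marker g h
  for \<alpha> \<beta> \<gamma> \<delta> :: nat and g h +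
  assumes \<gamma>: "\<gamma> \<ge> 1"
begin

lemma box_in_image: "box {..<\<gamma>} {\<gamma>..<\<gamma> + \<delta>} = syndrome ` carrier G"
proof -
  have 0: "insert 0 {1..<\<gamma>} = {..<\<gamma>}" using \<gamma> by auto
  have "box (insert 0 {1..<\<gamma>}) {\<gamma>..<\<gamma> + \<delta>} =
      (\<lambda>(c, x). x(0 := c)) ` ({0, 2} \<times> box {1..<\<gamma>} {\<gamma>..<\<gamma> + \<delta>})"
    using \<gamma> by (intro box_insert_left) auto
  also have "\<dots> = box {1..<\<gamma>} {\<gamma>..<\<gamma> + \<delta>} \<union> (\<lambda>b. marker + b) ` box {1..<\<gamma>} {\<gamma>..<\<gamma> + \<delta>}"
  proof -
    have "x(0 := 0) = x" "x(0 := 2) = marker + x" if "x \<in> box {1..<\<gamma>} {\<gamma>..<\<gamma> + \<delta>}" for x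
      using that \<gamma> by (auto simp: box_def marker_def fun_eq_iff)
    then show ?thesis by (force simp: image_iff)
  qed
  finally show ?thesis unfolding 0 syndrome_image .
qed

text \<open>The word through which pairing with \<open>x\<close> evaluates the character
  \<open>a\<close> at the syndrome of \<open>x\<close>. On a binary coordinate the character takes
  the value 0 or 2, stored as 0 or 1 because the inner product doubles binary coordinates.\<close>

definition character_word :: "(nat \<Rightarrow> int) \<times> (nat \<Rightarrow> int) \<Rightarrow> (nat \<Rightarrow> int) \<times> (nat \<Rightarrow> int)" where
  "character_word a =
     ((\<lambda>i\<in>{..<\<alpha>}. if box_character \<gamma> \<delta> a (syndrome (bit_word \<alpha> \<beta> i)) = 0 then 0 else 1),
      (\<lambda>j\<in>{..<\<beta>}. four_to_int (box_character \<gamma> \<delta> a (syndrome (quat_word \<alpha> \<beta> j 1)))))"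

lemma character_word_carrier: "character_word a \<in> carrier G"
  by (auto simp: character_word_def carrier_additive_space four_to_int_bounds)

lemma bit_character:
  assumes "i < \<alpha>"
  shows "box_character \<gamma> \<delta> a (syndrome (bit_word \<alpha> \<beta> i)) \<in> {0, 2}"
proof -
  let ?s = "syndrome (bit_word \<alpha> \<beta> i)"
  have "?s = - ?s" using syndrome_inv[OF bit_word_carrier[of \<alpha> \<beta> i]] by (simp add: inv_bit_word)
  then have "box_character \<gamma> \<delta> a ?s = - box_character \<gamma> \<delta> a ?s"
    using box_character_minus by metis
  then have "2 * box_character \<gamma> \<delta> a ?s = 0" by (simp only: mult_2 eq_neg_iff_add_eq_0)
  then show ?thesis by (simp add: four_double_eq_0_iff)
qed

lemma inner4_character_word:
  assumes "x \<in> carrier G"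
  shows "inner4 \<alpha> \<beta> (character_word a) x = box_character \<gamma> \<delta> a (syndrome x)"
  using assms
proof (induction rule: word_induct)
  case one
  show ?case unfolding syndrome_one box_character_zero
    by (simp add: inner4_def linear_word_def word_one)
next
  case (mult y w)
  have "inner4 \<alpha> \<beta> (character_word a) w = box_character \<gamma> \<delta> a (syndrome w)"
  proof -
    consider i where "i < \<alpha>" "w = bit_word \<alpha> \<beta> i" | j where "j < \<beta>" "w = quat_word \<alpha> \<beta> j 1"
      | j where "j < \<beta>" "w = quat_word \<alpha> \<beta> j 3"
      using mult(2) by (auto simp: unit_words_def)
    then show ?thesis
    proof cases
      case (1 i)
      then show ?thesis using bit_character[OF 1(1), of a]
        by (auto simp: inner4_def linear_word_bit_word character_word_def)
    next
      case (2 j)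
      then show ?thesis
        by (simp add: inner4_def linear_word_quat_word character_word_def of_int_four_to_int)
    next
      case (3 j)
      have "quat_word \<alpha> \<beta> j 3 = inv\<^bsub>G\<^esub> quat_word \<alpha> \<beta> j 1" by (simp add: inv_quat_word)
      then have "box_character \<gamma> \<delta> a (syndrome w) =
          - box_character \<gamma> \<delta> a (syndrome (quat_word \<alpha> \<beta> j 1))"
        using 3 by (simp add: syndrome_inv quat_word_carrier box_character_minus)
      moreover have "(3 :: 4) * c = - c" for c using four_cases[of c] by auto
      ultimately show ?thesis using 3
        by (simp add: inner4_def linear_word_quat_word character_word_def of_int_four_to_int)
    qed
  qed
  then show ?case unfolding inner4_mult_right syndrome_mult box_character_add
    using mult.IH by simp
qed

lemma character_word_mult:
  assumes "a \<in> carrier (additive_space \<gamma> \<delta>)" "a' \<in> carrier (additive_space \<gamma> \<delta>)"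
  shows "character_word (a \<otimes>\<^bsub>additive_space \<gamma> \<delta>\<^esub> a') = character_word a \<otimes>\<^bsub>G\<^esub> character_word a'"
proof -
  have add: "box_character \<gamma> \<delta> (a \<otimes>\<^bsub>additive_space \<gamma> \<delta>\<^esub> a') (syndrome x) =
      box_character \<gamma> \<delta> a (syndrome x) + box_character \<gamma> \<delta> a' (syndrome x)" if "x \<in> carrier G" for x
  proof -
    have "syndrome x \<in> box {..<\<gamma>} {\<gamma>..<\<gamma> + \<delta>}" using that box_in_image by blast
    then have "2 * syndrome x r = 0" if "r < \<gamma>" for r
      using that by (auto simp: box_def four_double_eq_0_iff)
    then show ?thesis unfolding box_character_def by (intro linear_word_mult) auto
  qed
  show ?thesis
  proof (rule word_eqI[where \<alpha> = \<alpha> and \<beta> = \<beta>])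
    fix i assume i: "i < \<alpha>"
    show "fst (character_word (a \<otimes>\<^bsub>additive_space \<gamma> \<delta>\<^esub> a')) i = fst (character_word a \<otimes>\<^bsub>G\<^esub> character_word a') i"
      using i bit_character[OF i, of a] bit_character[OF i, of a']
      by (auto simp: word_mult character_word_def add[OF bit_word_carrier])
  next
    fix j assume j: "j < \<beta>"
    show "snd (character_word (a \<otimes>\<^bsub>additive_space \<gamma> \<delta>\<^esub> a')) j = snd (character_word a \<otimes>\<^bsub>G\<^esub> character_word a') j"
      using j by (simp add: word_mult character_word_def add quat_word_carrier four_to_int_add)
  qed (simp_all add: character_word_carrier)
qed

text \<open>Characters of the syndrome group vanish on zero syndromes, so they yield dual words, and
  distinct characters yield distinct words because every element of the box is a syndrome. Equality
  of orders then gives surjectivity.\<close>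

lemma of_dual_type_code: "of_dual_type \<alpha> \<beta> \<gamma> \<delta> code"
proof -
  let ?D = "additive_dual \<alpha> \<beta> code" and ?H = "additive_space \<gamma> \<delta>"
  have sub: "subgroup ?D G" by (rule subgroup_additive_dual)
  have into: "character_word a \<in> ?D" for a
    unfolding additive_dual_eq code_def
    using character_word_carrier inner4_character_word box_character_zero by simp
  have inj: "inj_on character_word (carrier ?H)"
  proof (rule inj_onI)
    fix a a' assume a: "a \<in> carrier ?H" "a' \<in> carrier ?H" and eq: "character_word a = character_word a'"
    show "a = a'"
    proof (rule box_character_inj[OF a])
      fix x assume "x \<in> box {..<\<gamma>} {\<gamma>..<\<gamma> + \<delta>}"
      then obtain y where "y \<in> carrier G" "x = syndrome y" using box_in_image by blast
      then show "box_character \<gamma> \<delta> a x = box_character \<gamma> \<delta> a' x"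
        using inner4_character_word eq by metis
    qed
  qed
  have "card code * card ?D = card code * (2 * card (box {1..<\<gamma>} {\<gamma>..<\<gamma> + \<delta>}))"
    using card_additive_dual[OF subgroup_code] card_code by simp
  moreover have "card code \<noteq> 0" using card_code by (metis mult_is_0 power_not_zero zero_neq_numeral)
  moreover have "2 * card (box {1..<\<gamma>} {\<gamma>..<\<gamma> + \<delta>}) = 2 ^ (\<gamma> + 2 * \<delta>)"
  proof -
    have "(4::nat) ^ \<delta> = 2 ^ (2 * \<delta>)" by (simp add: power_mult)
    then have "2 * card (box {1..<\<gamma>} {\<gamma>..<\<gamma> + \<delta>}) = 2 ^ (1 + (\<gamma> - 1) + 2 * \<delta>)"
      by (simp add: card_box power_add)
    then show ?thesis using \<gamma> by simp
  qed
  ultimately have card: "card ?D = card (carrier ?H)" by (simp add: card_additive_space)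
  have fin: "finite ?D"
    using finite_additive_space by (rule finite_subset[rotated]) (auto simp: additive_dual_def)
  have "character_word ` carrier ?H = ?D"
    using into by (intro card_subset_eq[OF fin]) (auto simp: card_image[OF inj] card)
  then have "character_word \<in> iso ?H (G\<lparr>carrier := ?D\<rparr>)"
    using inj by (simp add: iso_def hom_def bij_betw_def character_word_mult into)
  then have "?H \<cong> G\<lparr>carrier := ?D\<rparr>" by (auto simp: is_iso_def)
  then have "G\<lparr>carrier := ?D\<rparr> \<cong> ?H" by (rule group.iso_sym[OF group_additive_space])
  then show ?thesis using sub by (simp add: of_dual_type_def of_type_def additive_code_def)
qed

end

section \<open>Assembly of the two codes\<close>

theorem theorem11:
  fixes t \<alpha> \<beta> \<gamma> \<delta> l :: nat
  assumes "t \<ge> 3"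
    and "\<alpha> \<noteq> 0"
    and "\<alpha> + 2 * \<beta> = 2 ^ t"
    and "\<exists>C. additive_extended_perfect_code \<alpha> \<beta> C \<and> of_dual_type \<alpha> \<beta> \<gamma> \<delta> C"
    and "l \<in> (if \<delta> = 1 then {t + 1..2 * t} else {t + 1..2 * t + 1})"
  shows "\<exists>C\<^sub>1 C\<^sub>2.
     additive_extended_perfect_code \<alpha> \<beta> C\<^sub>1 \<and> of_dual_type \<alpha> \<beta> \<gamma> \<delta> C\<^sub>1 \<and>
     additive_extended_perfect_code \<alpha> \<beta> C\<^sub>2 \<and> of_dual_type \<alpha> \<beta> \<gamma> \<delta> C\<^sub>2 \<and>
     card (C\<^sub>1 \<inter> C\<^sub>2) = 2 ^ (\<alpha> + 2 * \<beta> - l)"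
proof -
  have par: "\<gamma> + 2 * \<delta> = t + 1" "2 * \<alpha> = 2 ^ (\<gamma> + \<delta>)" "\<gamma> \<ge> 1"
    using assms(2,3,4) dual_type_parameters by blast+
  let ?I = "{1..<\<gamma>}" and ?J = "{\<gamma>..<\<gamma> + \<delta>}"
  let ?B = "box ?I ?J"
  have IJ: "finite ?I" "finite ?J" "?I \<inter> ?J = {}" by auto
  have "(4::nat) ^ \<delta> = 2 ^ (2 * \<delta>)" by (simp add: power_mult)
  then have "card ?B = 2 ^ ((\<gamma> - 1) + 2 * \<delta>)"
    by (simp add: card_box power_add)
  then have cardB: "card ?B = 2 ^ t" using par by simp
  have "{b \<in> ?B. 2 * b = 0} = box (?I \<union> ?J) {}"
    using box_double_eq_0[of ?I ?J] by (simp only: mult_2)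
  moreover have "card (?I \<union> ?J) = \<gamma> - 1 + \<delta>" using card_Un_disjoint[OF IJ] by simp
  then have "card (box (?I \<union> ?J) {}) = 2 ^ (\<gamma> - 1 + \<delta>)" by (simp add: card_box)
  moreover have "(2::nat) * 2 ^ (\<gamma> - 1 + \<delta>) = 2 ^ (\<gamma> + \<delta>)"
    using par(3) by (simp flip: power_Suc)
  ultimately have cardB2: "card {b \<in> ?B. 2 * b = 0} = \<alpha>" using par(2) by simp
  have finB: "finite ?B" using IJ by (rule finite_box)
  obtain g where "bij_betw g {0..<card {b \<in> ?B. 2 * b = 0}} {b \<in> ?B. 2 * b = 0}"
    using ex_bij_betw_nat_finite[of "{b \<in> ?B. 2 * b = 0}"] finB by auto
  then have g: "bij_betw g {..<\<alpha>} {b \<in> ?B. 2 * b = 0}"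
    by (simp only: cardB2 lessThan_atLeast0)
  let ?R = "?B - {b \<in> ?B. 2 * b = 0}"
  have "card ?R = card ?B - card {b \<in> ?B. 2 * b = 0}" using finB by (intro card_Diff_subset) auto
  then have "card ?R = 2 * \<beta>" unfolding cardB cardB2 using assms(3) by simp
  moreover have "- b \<in> ?R \<and> b \<noteq> - b" if "b \<in> ?R" for b
  proof -
    have "- b \<in> ?B" using that by (simp add: add_subgroup_minus[OF add_subgroup_box])
    moreover have "b \<noteq> - b"
    proof
      assume "b = - b"
      then have "b + b = 0" by (simp only: eq_neg_iff_add_eq_0)
      then have "2 * b = 0" by (simp only: mult_2)
      then show False using that by blast
    qed
    ultimately show ?thesis using that by simp
  qed
  ultimately obtain h where h: "\<forall>j<\<beta>. h j \<in> ?R"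
    "\<forall>i<\<beta>. \<forall>j<\<beta>. h i = h j \<or> h i = - h j \<longrightarrow> i = j" "\<forall>b\<in>?R. \<exists>j<\<beta>. b = h j \<or> b = - h j"
    using sign_transversal[of ?R \<beta>] finB by auto
  have lab: "labelling \<alpha> \<beta> ?B marker g h"
  proof
    show "(4 :: nat \<Rightarrow> 4) = 0"
    proof -
      have "(4 :: nat \<Rightarrow> 4) = 1 + 1 + 1 + 1" by simp
      then show ?thesis by (simp only:) (simp add: fun_eq_iff)
    qed
    show "2 * marker = 0" unfolding mult_2 by (auto simp: marker_def fun_eq_iff)
    show "marker \<notin> ?B" using par(3) by (auto simp: box_def marker_def)
  qed (use g h finB add_subgroup_box in auto)
  \<comment> \<open>Because 2(\<gamma>+\<delta>) = (t+1) + \<gamma> >= 5. It provides the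
    involutions needed for a word of weight 4.\<close>
  have "\<gamma> + \<delta> \<ge> 3" using par(1,3) assms(1) by arith
  then have "(2::nat) ^ 3 \<le> 2 ^ (\<gamma> + \<delta>)" by (intro power_increasing) auto
  then have \<alpha>3: "\<alpha> \<ge> 3" using par(2) by simp

  \<comment> \<open>The syndrome group has order \<open>2 ^ (t + 1)\<close>; the remaining factor
    \<open>2 ^ k\<close> of the index of the intersection must come from \<open>N\<close>.\<close>
  define k where "k = l - (t + 1)"
  have k: "l = t + 1 + k" "k \<le> t" "\<delta> = 1 \<Longrightarrow> k < t"
    using assms(1,5) by (auto simp: k_def split: if_splits)
  \<comment> \<open>The exponent of the order of \<open>B\<close> is (\<gamma>-1) + 2\<delta> = t,
    and the strict bound for \<delta> = 1 matches the shorter range of \<open>l\<close>.\<close>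
  have "shufflable ?I ?J k"
    using k par(1,3) assms(1) by (intro shufflable_box IJ) auto
  then obtain \<sigma> F N z where sh: "shuffle ?B F N \<sigma> {z, - z}" and N: "add_subgroup N" "card N = 2 ^ k"
    unfolding shufflable_def by blast
  have lab2: "labelling \<alpha> \<beta> ?B marker (\<sigma> \<circ> g) (\<sigma> \<circ> h)"
    by (rule labelling.labelling_shuffle[OF lab sh])
  have box_lab: "box_labelling \<alpha> \<beta> \<gamma> \<delta> g h" "box_labelling \<alpha> \<beta> \<gamma> \<delta> (\<sigma> \<circ> g) (\<sigma> \<circ> h)"
    using lab lab2 par(3) by (simp_all add: box_labelling_def box_labelling_axioms_def)
  let ?C1 = "labelling.code \<alpha> \<beta> marker g h" and ?C2 = "labelling.code \<alpha> \<beta> marker (\<sigma> \<circ> g) (\<sigma> \<circ> h)"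
  have 1: "card (?C1 \<inter> ?C2) * 2 ^ k = card ?C1"
    using labelling.card_code_Int_shuffle[OF lab sh N(1)] N(2) by simp
  have 2: "card ?C1 * 2 ^ (t + 1) = 2 ^ 2 ^ t"
    using labelling.card_code[OF lab] cardB assms(3) by simp
  have "card (?C1 \<inter> ?C2) * 2 ^ l = (card (?C1 \<inter> ?C2) * 2 ^ k) * 2 ^ (t + 1)"
    unfolding k(1) by (simp only: power_add mult_ac)
  also have "\<dots> = 2 ^ 2 ^ t" by (simp only: 1 2)
  finally have "card (?C1 \<inter> ?C2) * 2 ^ l = 2 ^ 2 ^ t" .
  moreover have "l \<le> 2 ^ t"
  proof -
    \<comment> \<open>Holds from t = 3 on and makes the subtraction in the final exponent
      exact.\<close>
    have "2 * t + 1 \<le> 2 ^ t" using assms(1) by (induction t rule: dec_induct) auto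
    then show ?thesis using k by simp
  qed
  then have "(2::nat) ^ 2 ^ t = 2 ^ (2 ^ t - l) * 2 ^ l" by (simp flip: power_add)
  ultimately have "card (?C1 \<inter> ?C2) = 2 ^ (\<alpha> + 2 * \<beta> - l)" using assms(3) by simp
  then show ?thesis
    using labelling.perfect[OF lab assms(3) cardB \<alpha>3] labelling.perfect[OF lab2 assms(3) cardB \<alpha>3]
      box_labelling.of_dual_type_code[OF box_lab(1)] box_labelling.of_dual_type_code[OF box_lab(2)]
    by blast
qed

end
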